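(* Let $f$ be a strongly hyperbolic complex Dulac germ and let $\widehat f(\zeta)=\alpha\zeta+o(1)$, $\alpha\in\mathbb R_{>1}$, be its asymptotic expansion in the $\zeta$-chart. Then: 1. There exists a unique parabolic complex Dulac germ $\varphi$ (given in the $\zeta$-chart) which is a solution of the normalization equation $$\varphi\circ f=\alpha\cdot\varphi .$$ Furthermore, if $f$ is a real Dulac germ, so is $\varphi$. 2. $\varphi\sim\widehat\varphi(\zeta)$, uniformly as $\Re(\zeta)\to+\infty$, where $\widehat\varphi$ is the unique parabolic logarithmic transseries with complex coefficients satisfying $\widehat\varphi\circ\widehat f\circ\widehat\varphi^{-1}=z^{\alpha}$ (in the formal variable $z$; equivalently $\widehat\varphi(\widehat f(\zeta))=\alpha\,\widehat\varphi(\zeta)$ in the formal variable $\zeta=-\log z$ at infinity).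
   Context: The Riemann surface of the logarithm $\widetilde{\mathbb C}=\{(r,\theta):r>0,\theta\in\mathbb R\}$ has the global chart $\zeta=-\log r-\mathrm i\theta$ (the $\zeta$-chart); informally $z=re^{\mathrm i\theta}$ and $\zeta=-\log z$. A map $f$ on a subset of $\widetilde{\mathbb C}$ is written in the $\zeta$-chart as $f(\zeta):=-\log(f(e^{-\zeta}))$. Let $\mathbb C^{+}=\{\zeta\in\mathbb C:\Re(\zeta)>0\}$. The standard quadratic domain $\mathcal R_C$, $C>0$, is given in the $\zeta$-chart by $\mathcal R_C=\kappa(\mathbb C^{+})$, $\kappa(\zeta)=\zeta+C(\zeta+1)^{1/2}$. A spiraling domain is a set $\{re^{\mathrm i\theta}:0<r<h(\theta)\}\subseteq\widetilde{\mathbb C}$ with $h:\mathbb R\to(0,+\infty)$ continuous; standard quadratic domains are spiraling domains. Germs are equivalence classes of maps on spiraling domains, two maps being equivalent if they coincide on some spiraling domain. Complex Dulac series: formal series $\widehat f=\lambda z^{\alpha}+\sum_{i\ge1}z^{\alpha_i}P_i(-\log z)$ with $\alpha>0$, $(\alpha_i)$ a strictly increasing sequence of reals $>\alpha$ tending to $+\infty$, $P_i$ complex polynomials; in the variable $\zeta=-\log z$ it becomes $\widehat f(\zeta)=-\log\widehat f(e^{-\zeta})=\sum_{i\ge0}e^{-\beta_i\zeta}Q_i(\zeta)$ with $\beta_0=0$, $Q_0(\zeta)=\alpha\zeta+\beta$, $\beta=-\log\lambda\in\mathbb C$, $(\beta_i)$ strictly increasing to $+\infty$ and $Q_i$ complex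 polynomials. A germ $f$ has asymptotic expansion $\widehat f$ ($f\sim\widehat f$) uniformly on a domain (in the $\zeta$-chart) if for every $c>0$ there is $n_c\in\mathbb N$ with $\left|f(\zeta)-\sum_{i=0}^{n_c}e^{-\beta_i\zeta}Q_i(\zeta)\right|=o(e^{-c\zeta})$ (that is, $o(e^{-c\Re(\zeta)})$) uniformly on that domain as $\Re(\zeta)\to+\infty$. A complex Dulac germ is a germ $f$ having a representative that is analytic (in the $\zeta$-chart) on some standard quadratic domain $\mathcal R_C$ and such that $f\sim\widehat f$ uniformly on $\mathcal R_C$ as $\Re(\zeta)\to+\infty$ for some complex Dulac series $\widehat f$. It is a real Dulac germ if in addition it preserves the positive real half-line $\{\theta=0\}$ (i.e. it is real-valued for real $\zeta$ in the $\zeta$-chart). A germ is parabolic if $f(\zeta)=\zeta+o(1)$, and strongly hyperbolic if $f(\zeta)=\alpha\zeta+\beta+o(1)$ with $\alpha\in\mathbb R_{>0}\setminus\{1\}$, $\beta\in\mathbb C$, uniformly as $\Re(\zeta)\to+\infty$. Parabolic logarithmic transseries with complex coefficients: with $\boldsymbol\ell_1=-1/\log z$, $\boldsymbol\ell_{n+1}=\boldsymbol\ell_1\circ\boldsymbol\ell_n$, these are formal sums $\sum a_{\beta,\mathbf n}z^{\beta}\boldsymbol\ell_1^{n_1}\cdots\boldsymbol\ell_k^{n_k}$ (some $k\in\mathbb N$; $a_{\beta,\mathbf n}\in\mathbb C$, $(\beta,\mathbf n)\in\mathbb R\times\mathbb Z^k$) with support well-ordered lexicographically and leading (lowest order) term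 $z$. Composition is the standard formal one obtained by Taylor expansion around the leading term.
   Formalization: In the asymptotic expansion, the estimate o(e^{-cζ}) is required for all partial sums with n ≥ n_c, not just for one n_c; with a single n_c the expansion would not be unique and part 2 would fail (e.g. 2ζ+e^{-ζ} would also have the expansion 2ζ+e^{-ζ}+e^{-5ζ}). *)

theory Defs
  imports "HOL-Analysis.Analysis" "HOL-Library.Landau_Symbols" "HOL-Library.Poly_Mapping"
begin

section \<open>Domains and germs in the \<open>\<zeta>\<close>-chart\<close>

text \<open>
  The surface of the logarithm is identified with the complex plane by its global chart
  \<open>\<zeta> = - log r - \<i> \<theta>\<close>, so that \<open>r = exp (- Re \<zeta>)\<close> and \<open>\<theta> = - Im \<zeta>\<close>.
\<close>

definition quadratic_domain :: "real \<Rightarrow> complex set" where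
  "quadratic_domain C = (\<lambda>\<zeta>. \<zeta> + of_real C * csqrt (\<zeta> + 1)) ` {\<zeta>. Re \<zeta> > 0}"

definition spiraling_domain :: "complex set \<Rightarrow> bool" where
  "spiraling_domain D \<longleftrightarrow>
     (\<exists>h :: real \<Rightarrow> real. continuous_on UNIV h \<and> (\<forall>\<theta>. h \<theta> > 0) \<and>
        D = {\<zeta>. exp (- Re \<zeta>) < h (- Im \<zeta>)})"

text \<open>
  Maps on spiraling domains are represented by total functions; values outside of some spiraling
  domain do not matter.
\<close>

definition germ_eq :: "(complex \<Rightarrow> complex) \<Rightarrow> (complex \<Rightarrow> complex) \<Rightarrow> bool" where
  "germ_eq f g \<longleftrightarrow> (\<exists>D. spiraling_domain D \<and> (\<forall>\<zeta>\<in>D. f \<zeta> = g \<zeta>))"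

lemma spiraling_domain_UNIV_ex: "\<exists>D. spiraling_domain D"
  unfolding spiraling_domain_def by (intro exI[of _ "{\<zeta>. exp (- Re \<zeta>) < 1}"] exI[of _ "\<lambda>_. 1"]) auto

lemma spiraling_domain_Int:
  assumes "spiraling_domain D" "spiraling_domain E"
  shows "spiraling_domain (D \<inter> E)"
proof -
  obtain h k where h: "continuous_on UNIV h" "\<And>\<theta>. h \<theta> > (0::real)"
      "D = {\<zeta>. exp (- Re \<zeta>) < h (- Im \<zeta>)}"
    and k: "continuous_on UNIV k" "\<And>\<theta>. k \<theta> > (0::real)"
      "E = {\<zeta>. exp (- Re \<zeta>) < k (- Im \<zeta>)}"
    using assms unfolding spiraling_domain_def by blast
  show ?thesis unfolding spiraling_domain_def
    by (rule exI[of _ "\<lambda>\<theta>. min (h \<theta>) (k \<theta>)"]) (use h k in \<open>auto intro: continuous_on_min\<close>)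
qed

lemma equivp_germ_eq: "equivp germ_eq"
proof (rule equivpI)
  show "reflp germ_eq"
    using spiraling_domain_UNIV_ex by (auto simp: germ_eq_def intro!: reflpI)
  show "symp germ_eq"
    unfolding germ_eq_def by (rule sympI) metis
  show "transp germ_eq"
  proof (rule transpI)
    fix f g h assume "germ_eq f g" "germ_eq g h"
    then obtain D E where "spiraling_domain D" "\<forall>\<zeta>\<in>D. f \<zeta> = g \<zeta>"
      "spiraling_domain E" "\<forall>\<zeta>\<in>E. g \<zeta> = h \<zeta>" unfolding germ_eq_def by blast
    thus "germ_eq f h" unfolding germ_eq_def
      by (intro exI[of _ "D \<inter> E"]) (auto intro: spiraling_domain_Int)
  qed
qed

quotient_type germ = "complex \<Rightarrow> complex" / germ_eq
  morphisms germ_rep germ_of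
  by (rule equivp_germ_eq)

text \<open>
  The composition \<open>g \<circ> f\<close> makes sense as a germ only if \<open>f\<close> maps sufficiently small spiraling
  domains into any prescribed one; otherwise it gets the dummy value \<open>0\<close>.
\<close>

lift_definition germ_comp :: "germ \<Rightarrow> germ \<Rightarrow> germ" is
  "\<lambda>g f. if \<forall>D. spiraling_domain D \<longrightarrow> (\<exists>E. spiraling_domain E \<and> f ` E \<subseteq> D)
         then g \<circ> f else (\<lambda>_. 0)"
proof -
  fix g g' f f' :: "complex \<Rightarrow> complex"
  let ?P = "\<lambda>f :: complex \<Rightarrow> complex.
    \<forall>D. spiraling_domain D \<longrightarrow> (\<exists>E. spiraling_domain E \<and> f ` E \<subseteq> D)"
  assume "germ_eq g g'" and ff': "germ_eq f f'"
  then obtain D E where D: "spiraling_domain D" "\<And>\<zeta>. \<zeta> \<in> D \<Longrightarrow> g \<zeta> = g' \<zeta>"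
    and E: "spiraling_domain E" "\<And>\<zeta>. \<zeta> \<in> E \<Longrightarrow> f \<zeta> = f' \<zeta>"
    unfolding germ_eq_def by blast
  have P: "?P q" if p: "?P p" and pq: "germ_eq p q" for p q
  proof (intro allI impI)
    fix A assume "spiraling_domain A"
    with p obtain B where B: "spiraling_domain B" "p ` B \<subseteq> A" by blast
    obtain B' where B': "spiraling_domain B'" "\<And>\<zeta>. \<zeta> \<in> B' \<Longrightarrow> p \<zeta> = q \<zeta>"
      using pq unfolding germ_eq_def by blast
    have "q ` (B \<inter> B') \<subseteq> A" using B B' by force
    with B B' show "\<exists>E. spiraling_domain E \<and> q ` E \<subseteq> A"
      using spiraling_domain_Int by blast
  qed
  show "germ_eq (if ?P f then g \<circ> f else (\<lambda>_. 0)) (if ?P f' then g' \<circ> f' else (\<lambda>_. 0))"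
  proof (cases "?P f")
    case True
    have True': "?P f'" by (rule P[OF True ff'])
    obtain B where B: "spiraling_domain B" "f ` B \<subseteq> D" using True D by blast
    have "\<forall>\<zeta>\<in>B \<inter> E. (g \<circ> f) \<zeta> = (g' \<circ> f') \<zeta>"
      using B D(2) E(2) by fastforce
    hence "germ_eq (g \<circ> f) (g' \<circ> f')"
      unfolding germ_eq_def using spiraling_domain_Int[OF B(1) E(1)] by blast
    thus ?thesis using True True' by simp
  next
    case False
    have "germ_eq f' f" using ff' equivp_germ_eq by (metis equivp_symp)
    hence "\<not> ?P f'" using P False by blast
    thus ?thesis using False equivp_reflp[OF equivp_germ_eq] by (simp only: if_False)
  qed
qed

lift_definition germ_scale :: "complex \<Rightarrow> germ \<Rightarrow> germ" is
  "\<lambda>c g \<zeta>. c * g \<zeta>"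
  by (auto simp: germ_eq_def)


section \<open>Logarithmic transseries with complex coefficients\<close>

text \<open>
  A monomial \<open>m\<close> stands for \<open>z\<^sup>\<beta> \<ell>\<^sub>1\<^bsup>n 1\<^esup> \<ell>\<^sub>2\<^bsup>n 2\<^esup> \<dots>\<close> with \<open>\<beta> = lookup m 0\<close>
  and \<open>n j = lookup m j\<close> for \<open>j \<ge> 1\<close>; multiplication of monomials is addition of exponents.
  The order of \<^typ>\<open>nat \<Rightarrow>\<^sub>0 real\<close> provided by the library is the lexicographic one, index \<open>0\<close>
  being the most significant.
\<close>

type_synonym monomial = "nat \<Rightarrow>\<^sub>0 real"

abbreviation expo :: "monomial \<Rightarrow> nat \<Rightarrow> real" where
  "expo \<equiv> Poly_Mapping.lookup"

definition log_support :: "monomial set \<Rightarrow> bool" where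
  "log_support S \<longleftrightarrow>
     wfp_on S (<) \<and>
     (\<forall>m\<in>S. \<forall>j\<ge>1. expo m j \<in> \<int>) \<and>
     (\<exists>k. \<forall>m\<in>S. Poly_Mapping.keys m \<subseteq> {..k})"

lemma log_support_empty [simp]: "log_support {}"
  by (auto simp: log_support_def wfp_on_def)

lemma log_support_subset: "log_support T \<Longrightarrow> S \<subseteq> T \<Longrightarrow> log_support S"
  unfolding log_support_def by (meson subsetD wfp_on_subset)

lemma wfp_on_Un:
  fixes S T :: "'a :: linorder set"
  assumes "wfp_on S (<)" "wfp_on T (<)"
  shows "wfp_on (S \<union> T) (<)"
  unfolding wfp_on_iff_ex_minimal
proof (intro allI impI)
  fix B assume B: "B \<subseteq> S \<union> T" "B \<noteq> {}"
  have min: "\<exists>z\<in>B \<inter> A. \<forall>y\<in>B \<inter> A. z \<le> y" if "wfp_on A (<)" "B \<inter> A \<noteq> {}" for A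
    using that unfolding wfp_on_iff_ex_minimal by (metis Int_lower2 linorder_not_less)
  show "\<exists>z\<in>B. \<forall>y. y < z \<longrightarrow> y \<notin> B"
  proof (cases "B \<inter> S = {} \<or> B \<inter> T = {}")
    case True
    with B have "B \<subseteq> S \<or> B \<subseteq> T" by blast
    with B assms show ?thesis unfolding wfp_on_iff_ex_minimal by blast
  next
    case False
    obtain a where a: "a \<in> B \<inter> S" "\<And>y. y \<in> B \<inter> S \<Longrightarrow> a \<le> y"
      using min[OF assms(1)] False by blast
    obtain b where b: "b \<in> B \<inter> T" "\<And>y. y \<in> B \<inter> T \<Longrightarrow> b \<le> y"
      using min[OF assms(2)] False by blast
    have "min a b \<in> B" using a b by (auto simp: min_def)
    moreover have "min a b \<le> y" if "y \<in> B" for y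
      using that a(2)[of y] b(2)[of y] B by (auto simp: min_le_iff_disj)
    ultimately show ?thesis by (meson linorder_not_less)
  qed
qed

lemma log_support_Un:
  assumes "log_support S" "log_support T"
  shows "log_support (S \<union> T)"
proof -
  obtain k l where "\<forall>m\<in>S. Poly_Mapping.keys m \<subseteq> {..k}" "\<forall>m\<in>T. Poly_Mapping.keys m \<subseteq> {..l}"
    using assms unfolding log_support_def by blast
  hence "\<forall>m\<in>S \<union> T. Poly_Mapping.keys m \<subseteq> {..max k l}" by fastforce
  thus ?thesis using assms wfp_on_Un unfolding log_support_def by blast
qed

lemma wfp_on_no_decreasing_seq:
  fixes S :: "'a :: linorder set"
  assumes "wfp_on S (<)" "\<And>n. s n \<in> S" "\<And>n :: nat. s (Suc n) < s n"
  shows False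
proof -
  have "range s \<subseteq> S" "range s \<noteq> {}" using assms(2) by auto
  hence "\<exists>z\<in>range s. \<forall>y. y < z \<longrightarrow> y \<notin> range s"
    using assms(1) unfolding wfp_on_iff_ex_minimal by (metis (no_types, lifting))
  then obtain n where "\<forall>y. y < s n \<longrightarrow> y \<notin> range s" by auto
  thus False using assms(3)[of n] rangeI[of s "Suc n"] by metis
qed

lemma ex_decreasing_seq:
  fixes S :: "'a :: linorder set"
  assumes "\<not> wfp_on S (<)"
  shows "\<exists>s :: nat \<Rightarrow> 'a. (\<forall>n. s n \<in> S) \<and> (\<forall>n. s (Suc n) < s n)"
proof -
  have "\<exists>B\<subseteq>S. B \<noteq> {} \<and> (\<forall>z\<in>B. \<exists>y. y < z \<and> y \<in> B)"
    using assms unfolding wfp_on_iff_ex_minimal by auto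
  then obtain B where B: "B \<subseteq> S" "B \<noteq> {}" "\<forall>z\<in>B. \<exists>y. y < z \<and> y \<in> B"
    by (elim exE conjE)
  obtain b where b: "b \<in> B" using B(2) by blast
  have "\<exists>d. \<forall>z\<in>B. d z < z \<and> d z \<in> B" using B(3) by (rule bchoice)
  then obtain d where d: "\<And>z. z \<in> B \<Longrightarrow> d z < z" "\<And>z. z \<in> B \<Longrightarrow> d z \<in> B" by blast
  have mem: "(d ^^ n) b \<in> B" for n by (induction n) (simp_all add: b d(2))
  show ?thesis
  proof (intro exI[of _ "\<lambda>n. (d ^^ n) b"] conjI allI)
    show "(d ^^ n) b \<in> S" for n using mem B(1) by (rule rev_subsetD)
    show "(d ^^ Suc n) b < (d ^^ n) b" for n using d(1)[OF mem[of n]] by simp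
  qed
qed

lemma wfp_on_nondecreasing_subseq:
  fixes s :: "nat \<Rightarrow> 'a :: linorder"
  assumes "wfp_on S (<)" "\<And>n. s n \<in> S"
  shows "\<exists>r :: nat \<Rightarrow> nat. strict_mono r \<and> (\<forall>n. s (r n) \<le> s (r (Suc n)))"
proof -
  have "\<exists>i\<ge>n. \<forall>j\<ge>n. s i \<le> s j" for n
  proof -
    have "s ` {n..} \<subseteq> S" "s ` {n..} \<noteq> {}" using assms(2) by auto
    hence "\<exists>z\<in>s ` {n..}. \<forall>y. y < z \<longrightarrow> y \<notin> s ` {n..}"
      using assms(1) unfolding wfp_on_iff_ex_minimal by (metis (no_types, lifting))
    then obtain i where i: "i \<ge> n" "\<forall>y. y < s i \<longrightarrow> y \<notin> s ` {n..}"
      by (elim bexE imageE) simp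
    hence "s i \<le> s j" if "j \<ge> n" for j
      using that imageI[of j "{n..}" s] by (meson atLeast_iff not_less)
    with i(1) show ?thesis by (intro exI[of _ i]) simp
  qed
  then obtain g where g: "\<And>n. g n \<ge> n" "\<And>n j. j \<ge> n \<Longrightarrow> s (g n) \<le> s j" by metis
  define r where "r = rec_nat (g 0) (\<lambda>_ i. g (Suc i))"
  have r: "r (Suc n) = g (Suc (r n))" for n by (simp add: r_def)
  have "r n < r (Suc n)" for n using g(1)[of "Suc (r n)"] by (simp add: r)
  hence mono: "strict_mono r" by (simp add: strict_mono_Suc_iff)
  have "s (r n) \<le> s (r (Suc n))" for n
  proof (cases n)
    case 0
    thus ?thesis using g(2)[of 0] by (simp add: r_def)
  next
    case (Suc k)
    have "Suc (r k) \<le> r (Suc n)"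
      using strict_monoD[OF mono, of k "Suc n"] Suc by simp
    hence "s (g (Suc (r k))) \<le> s (r (Suc n))" by (rule g(2))
    thus ?thesis using Suc by (simp add: r)
  qed
  with mono show ?thesis by blast
qed

lemma wfp_on_sumset:
  fixes S T :: "'a :: linordered_ab_group_add set"
  assumes "wfp_on S (<)" "wfp_on T (<)"
  shows "wfp_on {a + b | a b. a \<in> S \<and> b \<in> T} (<)"
proof (rule ccontr)
  assume "\<not> ?thesis"
  from ex_decreasing_seq[OF this] obtain s where
    s: "\<And>n. \<exists>a b. s n = a + b \<and> a \<in> S \<and> b \<in> T" "\<And>n :: nat. s (Suc n) < s n" by auto
  then obtain a b where ab: "\<And>n. s n = a n + b n" "\<And>n. a n \<in> S" "\<And>n. b n \<in> T" by metis
  obtain r :: "nat \<Rightarrow> nat" where r: "strict_mono r" "\<And>n. a (r n) \<le> a (r (Suc n))"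
    using wfp_on_nondecreasing_subseq[of S a, OF assms(1) ab(2)] by blast
  have "b (r (Suc n)) < b (r n)" for n
  proof -
    have "s (r (Suc n)) < s (r n)"
      using lift_Suc_mono_less[of "\<lambda>n. - s n" "r n" "r (Suc n)"] s(2) strict_monoD[OF r(1), of n]
      by simp
    hence "a (r (Suc n)) + b (r (Suc n)) < a (r n) + b (r n)" by (simp only: ab(1))
    moreover have "a (r n) + b (r n) \<le> a (r (Suc n)) + b (r (Suc n))"
      if "b (r n) \<le> b (r (Suc n))" using r(2) that by (rule add_mono)
    ultimately show ?thesis by (meson not_le)
  qed
  thus False using wfp_on_no_decreasing_seq[OF assms(2), of "\<lambda>n. b (r n)"] ab(3) by blast
qed

lemma finite_sumset_fibre:
  fixes S T :: "'a :: linordered_ab_group_add set"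
  assumes "wfp_on S (<)" "wfp_on T (<)"
  shows "finite {(a, b). a \<in> S \<and> b \<in> T \<and> a + b = c}"
proof (rule ccontr)
  let ?X = "{(a, b). a \<in> S \<and> b \<in> T \<and> a + b = c}"
  assume "infinite ?X"
  then obtain p :: "nat \<Rightarrow> 'a \<times> 'a" where p: "inj p" "range p \<subseteq> ?X"
    using infinite_countable_subset by blast
  define a b where "a n = fst (p n)" and "b n = snd (p n)" for n
  have "p n \<in> ?X" for n using p(2) rangeI[of p n] by (rule subsetD)
  hence "a n \<in> S \<and> b n \<in> T \<and> a n + b n = c" for n
    by (simp add: a_def b_def case_prod_beta)
  hence ab: "a n \<in> S" "b n \<in> T" "a n + b n = c" for n by auto
  obtain r :: "nat \<Rightarrow> nat" where r: "strict_mono r" "\<And>n. a (r n) \<le> a (r (Suc n))"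
    using wfp_on_nondecreasing_subseq[of S a, OF assms(1) ab(1)] by blast
  have "a (r n) \<noteq> a (r (Suc n))" for n
  proof
    assume eq: "a (r n) = a (r (Suc n))"
    hence "b (r n) = b (r (Suc n))" using ab(3) by (metis add_left_imp_eq)
    hence "p (r n) = p (r (Suc n))" using eq by (simp add: a_def b_def prod_eq_iff)
    hence "r n = r (Suc n)" using p(1) by (simp add: inj_eq)
    thus False using r(1) by (metis lessI order_less_irrefl strict_mono_less)
  qed
  hence "a (r n) < a (r (Suc n))" for n using r(2) order_le_neq_trans by blast
  hence "b (r (Suc n)) < b (r n)" for n
    using ab(3)[of "r n"] ab(3)[of "r (Suc n)"] add_less_le_mono[of "a (r n)" "a (r (Suc n))"]
    by (metis linorder_not_less order_less_irrefl)
  thus False using wfp_on_no_decreasing_seq[OF assms(2), of "\<lambda>n. b (r n)"] ab(2) by blast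
qed

lemma log_support_sumset:
  assumes "log_support S" "log_support T"
  shows "log_support {a + b | a b. a \<in> S \<and> b \<in> T}"
proof -
  obtain k l where kl: "\<forall>m\<in>S. Poly_Mapping.keys m \<subseteq> {..k}" "\<forall>m\<in>T. Poly_Mapping.keys m \<subseteq> {..l}"
    using assms unfolding log_support_def by blast
  have "Poly_Mapping.keys (a + b) \<subseteq> {..max k l}" if "a \<in> S" "b \<in> T" for a b
    using Poly_Mapping.keys_add[of a b] kl that by fastforce
  hence "\<exists>k. \<forall>m\<in>{a + b | a b. a \<in> S \<and> b \<in> T}. Poly_Mapping.keys m \<subseteq> {..k}" by blast
  moreover have "\<forall>m\<in>{a + b | a b. a \<in> S \<and> b \<in> T}. \<forall>j\<ge>1. expo m j \<in> \<int>"
    using assms by (auto simp: log_support_def lookup_add)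
  ultimately show ?thesis
    using assms wfp_on_sumset[of S T] unfolding log_support_def by blast
qed

typedef transseries = "{f :: monomial \<Rightarrow> complex. log_support {m. f m \<noteq> 0}}"
  morphisms tcoeff Abs_transseries
  by (rule exI[of _ "\<lambda>_. 0"]) simp

setup_lifting type_definition_transseries

abbreviation tsupp :: "transseries \<Rightarrow> monomial set" where
  "tsupp x \<equiv> {m. tcoeff x m \<noteq> 0}"

lemma log_support_tsupp: "log_support (tsupp x)"
  using tcoeff[of x] by simp

lemma transseries_eqI: "(\<And>m. tcoeff x m = tcoeff y m) \<Longrightarrow> x = y"
  by (simp add: tcoeff_inject[symmetric] fun_eq_iff)

lemma finite_tfibre: "finite {(a, b). a \<in> tsupp x \<and> b \<in> tsupp y \<and> a + b = m}"
  using finite_sumset_fibre log_support_tsupp unfolding log_support_def by blast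

lemma log_support_single:
  assumes "\<forall>j\<ge>1. expo m j \<in> \<int>"
  shows "log_support {m}"
proof -
  have "Poly_Mapping.keys m \<subseteq> {..Max (insert 0 (Poly_Mapping.keys m))}" by (auto intro: Max_ge)
  moreover have "wfp_on {m} (<)" by (auto simp: wfp_on_def)
  ultimately show ?thesis unfolding log_support_def using assms by blast
qed

instantiation transseries :: comm_ring_1
begin

lift_definition zero_transseries :: transseries is "\<lambda>_. 0" by simp

lift_definition one_transseries :: transseries is "\<lambda>m. if m = 0 then 1 else 0"
  by (rule log_support_subset[of "{0}"]) (auto intro!: log_support_single)

lift_definition plus_transseries :: "transseries \<Rightarrow> transseries \<Rightarrow> transseries" is
  "\<lambda>f g m. f m + g m"
  by (rule log_support_subset, rule log_support_Un, assumption, assumption) auto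

lift_definition uminus_transseries :: "transseries \<Rightarrow> transseries" is "\<lambda>f m. - f m"
  by simp

lift_definition minus_transseries :: "transseries \<Rightarrow> transseries \<Rightarrow> transseries" is
  "\<lambda>f g m. f m - g m"
  by (rule log_support_subset, rule log_support_Un, assumption, assumption) auto

lift_definition times_transseries :: "transseries \<Rightarrow> transseries \<Rightarrow> transseries" is
  "\<lambda>f g m. \<Sum>(a, b) | f a \<noteq> 0 \<and> g b \<noteq> 0 \<and> a + b = m. f a * g b"
proof -
  fix f g :: "monomial \<Rightarrow> complex"
  assume "log_support {m. f m \<noteq> 0}" "log_support {m. g m \<noteq> 0}"
  from log_support_sumset[OF this]
  show "log_support {m. (\<Sum>(a, b) | f a \<noteq> 0 \<and> g b \<noteq> 0 \<and> a + b = m. f a * g b) \<noteq> 0}"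
  proof (rule log_support_subset, intro subsetI, clarify)
    fix m assume "(\<Sum>(a, b) | f a \<noteq> 0 \<and> g b \<noteq> 0 \<and> a + b = m. f a * g b) \<noteq> 0"
    then obtain p where "p \<in> {(a, b). f a \<noteq> 0 \<and> g b \<noteq> 0 \<and> a + b = m}"
      using sum.not_neutral_contains_not_neutral by blast
    thus "\<exists>a b. m = a + b \<and> a \<in> {m. f m \<noteq> 0} \<and> b \<in> {m. g m \<noteq> 0}"
      by auto
  qed
qed

lemma tcoeff_times_superset:
  assumes "finite A" "{(a, b). a \<in> tsupp x \<and> b \<in> tsupp y \<and> a + b = m} \<subseteq> A"
    "\<And>a b. (a, b) \<in> A \<Longrightarrow> a + b = m"
  shows "tcoeff (x * y) m = (\<Sum>(a, b)\<in>A. tcoeff x a * tcoeff y b)"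
  unfolding times_transseries.rep_eq
  by (rule sum.mono_neutral_left) (use assms in auto)

instance
proof
  fix x y w :: transseries
  show "x + y + w = x + (y + w)" "x + y = y + x" "0 + x = x" "- x + x = 0" "x - y = x + - y"
    by (transfer; auto simp: fun_eq_iff)+
  show "x * y = y * x"
  proof (rule transseries_eqI)
    fix m
    show "tcoeff (x * y) m = tcoeff (y * x) m"
      unfolding times_transseries.rep_eq
      by (rule sum.reindex_bij_witness[of _ prod.swap prod.swap]) (auto simp: add.commute)
  qed
  show "1 * x = x"
  proof (rule transseries_eqI)
    fix m
    have "tcoeff (1 * x) m = (\<Sum>(a, b)\<in>{(0, m)}. tcoeff 1 a * tcoeff x b)"
      by (rule tcoeff_times_superset) (auto simp: one_transseries.rep_eq split: if_splits)
    thus "tcoeff (1 * x) m = tcoeff x m" by (simp add: one_transseries.rep_eq)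
  qed
  show "(x + y) * w = x * w + y * w"
  proof (rule transseries_eqI)
    fix m
    let ?A = "{(a, b). a \<in> tsupp x \<and> b \<in> tsupp w \<and> a + b = m} \<union>
              {(a, b). a \<in> tsupp y \<and> b \<in> tsupp w \<and> a + b = m}"
    have fin: "finite ?A" using finite_tfibre[of x w m] finite_tfibre[of y w m] by simp
    have "tcoeff ((x + y) * w) m = (\<Sum>(a, b)\<in>?A. tcoeff (x + y) a * tcoeff w b)"
      by (rule tcoeff_times_superset[OF fin]) (auto simp: plus_transseries.rep_eq)
    also have "\<dots> = (\<Sum>(a, b)\<in>?A. tcoeff x a * tcoeff w b) + (\<Sum>(a, b)\<in>?A. tcoeff y a * tcoeff w b)"
      by (simp add: plus_transseries.rep_eq case_prod_beta algebra_simps sum.distrib)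
    also have "(\<Sum>(a, b)\<in>?A. tcoeff x a * tcoeff w b) = tcoeff (x * w) m"
      by (rule tcoeff_times_superset[OF fin, symmetric]) auto
    also have "(\<Sum>(a, b)\<in>?A. tcoeff y a * tcoeff w b) = tcoeff (y * w) m"
      by (rule tcoeff_times_superset[OF fin, symmetric]) auto
    finally show "tcoeff ((x + y) * w) m = tcoeff (x * w + y * w) m"
      by (simp add: plus_transseries.rep_eq)
  qed
  show "x * y * w = x * (y * w)"
  proof (rule transseries_eqI)
    fix m
    let ?S = "\<lambda>u v. {a + b | a b. a \<in> tsupp u \<and> b \<in> tsupp v}"
    have wf: "wfp_on (tsupp u) (<)" for u
      using log_support_tsupp unfolding log_support_def by blast
    let ?P = "{(p, c). p \<in> ?S x y \<and> c \<in> tsupp w \<and> p + c = m}"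
    let ?Q = "{(a, q). a \<in> tsupp x \<and> q \<in> ?S y w \<and> a + q = m}"
    have finP: "finite ?P" by (rule finite_sumset_fibre[OF wfp_on_sumset[OF wf wf] wf])
    have finQ: "finite ?Q" by (rule finite_sumset_fibre[OF wf wfp_on_sumset[OF wf wf]])
    have supp: "tsupp (u * v) \<subseteq> ?S u v" for u v
    proof (intro subsetI, clarify)
      fix p assume "tcoeff (u * v) p \<noteq> 0"
      then obtain q where "q \<in> {(a, b). tcoeff u a \<noteq> 0 \<and> tcoeff v b \<noteq> 0 \<and> a + b = p}"
        unfolding times_transseries.rep_eq using sum.not_neutral_contains_not_neutral by blast
      thus "\<exists>a b. p = a + b \<and> a \<in> tsupp u \<and> b \<in> tsupp v" by auto
    qed
    let ?F = "\<lambda>u v p. {(a, b). a \<in> tsupp u \<and> b \<in> tsupp v \<and> a + b = p}"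
    let ?T = "{(a, b, c). a \<in> tsupp x \<and> b \<in> tsupp y \<and> c \<in> tsupp w \<and> a + b + c = m}"
    have "tcoeff (x * y * w) m = (\<Sum>(p, c)\<in>?P. tcoeff (x * y) p * tcoeff w c)"
      using supp[of x y] by (intro tcoeff_times_superset finP) auto
    also have "\<dots> = (\<Sum>t\<in>?P. \<Sum>s\<in>?F x y (fst t). tcoeff x (fst s) * tcoeff y (snd s) * tcoeff w (snd t))"
      by (rule sum.cong[OF refl])
         (simp add: times_transseries.rep_eq sum_distrib_right case_prod_beta)
    also have "\<dots> = (\<Sum>(t, s)\<in>Sigma ?P (\<lambda>t. ?F x y (fst t)).
                      tcoeff x (fst s) * tcoeff y (snd s) * tcoeff w (snd t))"
      by (rule sum.Sigma[OF finP]) (intro ballI finite_tfibre)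
    also have "\<dots> = (\<Sum>(a, b, c)\<in>?T. tcoeff x a * tcoeff y b * tcoeff w c)"
      by (rule sum.reindex_bij_witness[of _
            "\<lambda>(a, b, c). ((a + b, c), (a, b))" "\<lambda>((p, c), (a, b)). (a, b, c)"]) auto
    also have "\<dots> = (\<Sum>(t, s)\<in>Sigma ?Q (\<lambda>t. ?F y w (snd t)).
                      tcoeff x (fst t) * (tcoeff y (fst s) * tcoeff w (snd s)))"
      by (rule sum.reindex_bij_witness[of _
            "\<lambda>((a, q), (b, c)). (a, b, c)" "\<lambda>(a, b, c). ((a, b + c), (b, c))"])
         (auto simp: add.assoc mult.assoc)
    also have "\<dots> = (\<Sum>t\<in>?Q. \<Sum>s\<in>?F y w (snd t). tcoeff x (fst t) * (tcoeff y (fst s) * tcoeff w (snd s)))"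
      by (rule sum.Sigma[symmetric, OF finQ]) (intro ballI finite_tfibre)
    also have "\<dots> = (\<Sum>(a, q)\<in>?Q. tcoeff x a * tcoeff (y * w) q)"
      by (rule sum.cong[OF refl])
         (simp add: times_transseries.rep_eq sum_distrib_left case_prod_beta)
    also have "\<dots> = tcoeff (x * (y * w)) m"
      using supp[of y w] by (intro tcoeff_times_superset[symmetric] finQ) auto
    finally show "tcoeff (x * y * w) m = tcoeff (x * (y * w)) m" .
  qed
  show "(0 :: transseries) \<noteq> 1"
  proof
    assume "(0 :: transseries) = 1"
    hence "tcoeff 0 0 = tcoeff 1 (0 :: monomial)" by simp
    thus False by (simp add: zero_transseries.rep_eq one_transseries.rep_eq)
  qed
qed

end

text \<open>
  \<open>tmono c m\<close> is the series \<open>c m\<close>; it is meaningful if the exponents of \<open>m\<close> at the indices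
  \<open>j \<ge> 1\<close> are integers. \<open>tsum F\<close> is the formal sum of a family of series; it is meaningful
  if every monomial occurs in finitely many members only and the union of the supports is an
  admissible support.
\<close>

definition tmono :: "complex \<Rightarrow> monomial \<Rightarrow> transseries" where
  "tmono c m = Abs_transseries (\<lambda>m'. if m' = m then c else 0)"

abbreviation tconst :: "complex \<Rightarrow> transseries" where
  "tconst c \<equiv> tmono c 0"

definition tsum :: "('i \<Rightarrow> transseries) \<Rightarrow> transseries" where
  "tsum F = Abs_transseries (\<lambda>m. \<Sum>i | tcoeff (F i) m \<noteq> 0. tcoeff (F i) m)"

definition tpowser :: "(nat \<Rightarrow> complex) \<Rightarrow> transseries \<Rightarrow> transseries" where
  "tpowser c x = tsum (\<lambda>k. tconst (c k) * x ^ k)"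

definition infinitesimal :: "transseries \<Rightarrow> bool" where
  "infinitesimal x \<longleftrightarrow> (\<forall>m\<in>tsupp x. m > 0)"

definition tlog1p :: "transseries \<Rightarrow> transseries" where
  "tlog1p = tpowser (\<lambda>k. if k = 0 then 0 else (-1) ^ (k + 1) / of_nat k)"

definition tpow1p :: "real \<Rightarrow> transseries \<Rightarrow> transseries" where
  "tpow1p s = tpowser (\<lambda>k. of_real s gchoose k)"

definition zmon :: monomial where
  "zmon = Poly_Mapping.single 0 1"

definition zetamon :: monomial where
  "zetamon = Poly_Mapping.single 1 (-1)"

definition tzeta :: transseries where
  "tzeta = tmono 1 zetamon"

definition tell :: "nat \<Rightarrow> transseries" where
  "tell j = tmono 1 (Poly_Mapping.single j 1)"

definition parabolic_transseries :: "transseries \<Rightarrow> bool" where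
  "parabolic_transseries x \<longleftrightarrow> tcoeff x zmon = 1 \<and> (\<forall>m\<in>tsupp x. zmon \<le> m)"

text \<open>
  The \<open>\<zeta>\<close>-chart form \<open>- log x\<close> of a parabolic transseries \<open>x = z (1 + \<epsilon>)\<close>, i.e.
  \<open>\<zeta> - log (1 + \<epsilon>)\<close>. Through \<open>z = e\<^bsup>-\<zeta>\<^esup>\<close>, \<open>\<ell>\<^sub>1 = 1 / \<zeta>\<close>, \<open>\<ell>\<^sub>2 = 1 / log \<zeta>\<close>, \<dots>, series
  in \<open>z\<close> and series in \<open>\<zeta>\<close> share the type \<^typ>\<open>transseries\<close>.
\<close>

definition zeta_chart :: "transseries \<Rightarrow> transseries" where
  "zeta_chart x = tzeta - tlog1p (tmono 1 (- zmon) * x - 1)"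


subsection \<open>Composition in the variable \<open>\<zeta>\<close>\<close>

text \<open>
  \<open>T\<close> prescribes the images of the monomials; \<open>tlinear T\<close> is its strongly linear extension.
\<close>

definition tlinear :: "(monomial \<Rightarrow> transseries) \<Rightarrow> transseries \<Rightarrow> transseries" where
  "tlinear T x = tsum (\<lambda>m. tconst (tcoeff x m) * T m)"

text \<open>
  The derivation \<open>d/d\<zeta>\<close>: it maps \<open>e\<^bsup>-\<beta>\<zeta>\<^esup>\<close> to \<open>- \<beta> e\<^bsup>-\<beta>\<zeta>\<^esup>\<close> and, since \<open>\<ell>\<^sub>1 = 1 / \<zeta>\<close> and
  \<open>\<ell>\<^bsub>j+1\<^esub> = - 1 / log \<ell>\<^sub>j\<close>, it satisfies \<open>\<ell>\<^sub>j' = - \<ell>\<^sub>j \<ell>\<^sub>1 \<dots> \<ell>\<^sub>j\<close>.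
\<close>

definition tderiv :: "transseries \<Rightarrow> transseries" where
  "tderiv = tlinear (\<lambda>m. - (tmono (of_real (expo m 0)) m
     + (\<Sum>j\<in>Poly_Mapping.keys m - {0}. tmono (of_real (expo m j)) m * (\<Prod>i\<in>{1..j}. tell i))))"

text \<open>
  Substitution \<open>\<zeta> \<mapsto> a \<zeta>\<close> for \<open>a > 0\<close>. With \<open>L\<^sub>j = 1 / \<ell>\<^sub>j\<close>, i.e. \<open>L\<^sub>1 = \<zeta>\<close> and
  \<open>L\<^bsub>j+1\<^esub> = log L\<^sub>j\<close>, one has \<open>L\<^sub>2(a \<zeta>) = L\<^sub>2 + log a\<close> and, if \<open>L\<^sub>j(a \<zeta>) = L\<^sub>j + w\<^sub>j\<close>, then
  \<open>L\<^bsub>j+1\<^esub>(a \<zeta>) = log (L\<^sub>j + w\<^sub>j) = L\<^bsub>j+1\<^esub> + log (1 + \<ell>\<^sub>j w\<^sub>j)\<close>. The series \<open>log_shift a j\<close> is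
  \<open>w\<^bsub>j+2\<^esub>\<close>. Hence \<open>\<ell>\<^sub>1(a \<zeta>) = \<ell>\<^sub>1 / a\<close> and \<open>\<ell>\<^sub>j(a \<zeta>)\<^sup>n = \<ell>\<^sub>j\<^sup>n (1 + \<ell>\<^sub>j w\<^sub>j)\<^bsup>-n\<^esup>\<close> for \<open>j \<ge> 2\<close>.
\<close>

primrec log_shift :: "real \<Rightarrow> nat \<Rightarrow> transseries" where
  "log_shift a 0 = tconst (of_real (ln a))"
| "log_shift a (Suc j) = tlog1p (tell (j + 2) * log_shift a j)"

definition tscale :: "real \<Rightarrow> transseries \<Rightarrow> transseries" where
  "tscale a = tlinear (\<lambda>m.
     tmono (of_real (a powr (- expo m 1))) (Poly_Mapping.update 0 (a * expo m 0) m)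
     * (\<Prod>j | j + 2 \<in> Poly_Mapping.keys m.
          tpow1p (- expo m (j + 2)) (tell (j + 2) * log_shift a j)))"

text \<open>
  \<open>tcomp g f = g(f(\<zeta>))\<close> for \<open>f = a \<zeta> + \<eta>\<close> with \<open>a > 0\<close> and infinitesimal \<open>\<eta>\<close>: the Taylor
  expansion of \<open>g\<close> around the leading term \<open>a \<zeta>\<close>.
\<close>

definition tcomp :: "transseries \<Rightarrow> transseries \<Rightarrow> transseries" where
  "tcomp g f =
     (let a = Re (tcoeff f zetamon); \<eta> = f - tconst (of_real a) * tzeta
      in tsum (\<lambda>k. tconst (1 / fact k) * tscale a ((tderiv ^^ k) g) * \<eta> ^ k))"


section \<open>Complex Dulac series and germs\<close>

text \<open>
  Complex Dulac series are given in the variable \<open>\<zeta>\<close>, as \<open>\<Sum>i. e\<^bsup>- b i \<zeta>\<^esup> Q i(\<zeta>)\<close>. With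
  \<open>Q 0(\<zeta>) = \<alpha> \<zeta> + \<beta>\<close> the leading term is \<open>\<lambda> z\<^bsup>\<alpha>\<^esup>\<close>, \<open>\<beta> = - log \<lambda>\<close>.
\<close>

definition dulac_data :: "(nat \<Rightarrow> real) \<Rightarrow> (nat \<Rightarrow> complex poly) \<Rightarrow> bool" where
  "dulac_data b Q \<longleftrightarrow>
     b 0 = 0 \<and> strict_mono b \<and> filterlim b at_top sequentially \<and>
     (\<exists>\<alpha>>0. \<exists>\<beta>. Q 0 = [:\<beta>, of_real \<alpha>:])"

definition dulac_series :: "(nat \<Rightarrow> real) \<Rightarrow> (nat \<Rightarrow> complex poly) \<Rightarrow> transseries" where
  "dulac_series b Q = tsum (\<lambda>i. \<Sum>j\<le>degree (Q i).
     tmono (coeff (Q i) j) (Poly_Mapping.single 0 (b i) + Poly_Mapping.single 1 (- real j)))"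

definition at_Re_top :: "complex set \<Rightarrow> complex filter" where
  "at_Re_top D = inf (filtercomap Re at_top) (principal D)"

text \<open>
  The estimate is required for all sufficiently long partial sums. Asking for a single partial
  sum for each \<open>c\<close> would make, e.g., \<open>\<zeta> + e\<^bsup>-\<zeta>\<^esup>\<close> an expansion of the function \<open>\<zeta>\<close>.
\<close>

definition expands_on :: "(complex \<Rightarrow> complex) \<Rightarrow> complex set \<Rightarrow> transseries \<Rightarrow> bool" where
  "expands_on F D x \<longleftrightarrow>
     (\<exists>b Q. dulac_data b Q \<and> x = dulac_series b Q \<and>
        (\<forall>c>0. \<exists>N. \<forall>n\<ge>N.
           (\<lambda>\<zeta>. F \<zeta> - (\<Sum>i\<le>n. exp (- of_real (b i) * \<zeta>) * poly (Q i) \<zeta>))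
             \<in> o[at_Re_top D](\<lambda>\<zeta>. exp (- of_real c * \<zeta>))))"

definition has_expansion :: "germ \<Rightarrow> transseries \<Rightarrow> bool" where
  "has_expansion f x \<longleftrightarrow>
     (\<exists>F C. C > 0 \<and> f = germ_of F \<and> expands_on F (quadratic_domain C) x)"

definition dulac_germ :: "germ \<Rightarrow> bool" where
  "dulac_germ f \<longleftrightarrow>
     (\<exists>F C x. C > 0 \<and> f = germ_of F \<and> F analytic_on quadratic_domain C \<and>
        expands_on F (quadratic_domain C) x)"

definition real_dulac_germ :: "germ \<Rightarrow> bool" where
  "real_dulac_germ f \<longleftrightarrow> dulac_germ f \<and>
     (\<exists>F D. f = germ_of F \<and> spiraling_domain D \<and> (\<forall>\<zeta>\<in>D \<inter> \<real>. F \<zeta> \<in> \<real>))"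

definition germ_affine :: "germ \<Rightarrow> complex \<Rightarrow> complex \<Rightarrow> bool" where
  "germ_affine f \<alpha> \<beta> \<longleftrightarrow>
     (\<exists>F C. C > 0 \<and> f = germ_of F \<and>
        ((\<lambda>\<zeta>. F \<zeta> - (\<alpha> * \<zeta> + \<beta>)) \<longlongrightarrow> 0) (at_Re_top (quadratic_domain C)))"

definition parabolic_germ :: "germ \<Rightarrow> bool" where
  "parabolic_germ f \<longleftrightarrow> germ_affine f 1 0"

definition strongly_hyperbolic_germ :: "germ \<Rightarrow> bool" where
  "strongly_hyperbolic_germ f \<longleftrightarrow>
     (\<exists>\<alpha>::real. \<exists>\<beta>. \<alpha> > 0 \<and> \<alpha> \<noteq> 1 \<and> germ_affine f (of_real \<alpha>) \<beta>)"

definition normalizing_germ :: "real \<Rightarrow> germ \<Rightarrow> germ \<Rightarrow> bool" where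
  "normalizing_germ \<alpha> f \<phi> \<longleftrightarrow>
     dulac_germ \<phi> \<and> parabolic_germ \<phi> \<and> germ_comp \<phi> f = germ_scale (of_real \<alpha>) \<phi>"

definition normalizing_transseries :: "real \<Rightarrow> transseries \<Rightarrow> transseries \<Rightarrow> bool" where
  "normalizing_transseries \<alpha> fhat \<phi>hat \<longleftrightarrow>
     parabolic_transseries \<phi>hat \<and>
     tcomp (zeta_chart \<phi>hat) fhat = tconst (of_real \<alpha>) * zeta_chart \<phi>hat"

end

theory Submission
  imports Defs "HOL-Complex_Analysis.Complex_Analysis"
begin

text \<open>
  On the analytic side, \<open>\<phi>\<close> is the limit of \<open>\<alpha>\<^bsup>-n\<^esup> f\<^bsup>n\<^esup>(\<zeta>)\<close>. With \<open>\<rho> = f - \<alpha> \<zeta>\<close>, which is exponentially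
  small, this is \<open>\<zeta> + \<Sum>n. \<alpha>\<^bsup>-n-1\<^esup> \<rho>(f\<^bsup>n\<^esup>(\<zeta>))\<close>, and the convergence is uniform on a domain that \<open>f\<close>
  maps into itself. The functions with a Dulac expansion form an algebra that is closed under
  \<open>g \<mapsto> g \<circ> f\<close>, with \<open>tcomp\<close> describing the expansion of \<open>g \<circ> f\<close>. As \<open>\<rho> \<circ> f\<^bsup>n\<^esup>\<close> decays faster and
  faster, the series for \<open>\<phi>\<close> yields an expansion \<open>\<psi>\<close> of \<open>\<phi>\<close>, and the uniqueness of expansions turns
  \<open>\<phi> \<circ> f = \<alpha> \<phi>\<close> into the formal equation for \<open>\<psi>\<close>. So the formal solution is obtained from the
  analytic one. The difference of two formal solutions is an infinitesimal \<open>u\<close> with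
  \<open>u \<circ> f = \<alpha> u\<close>, which is impossible at the least monomial of \<open>u\<close>, since composition with \<open>f\<close>
  multiplies its coefficient by \<open>\<alpha>\<^bsup>-k\<^esup>\<close>, \<open>k \<ge> 0\<close>, or increases the exponent of \<open>z\<close>. Two analytic
  solutions differ by \<open>\<alpha>\<^bsup>-n\<^esup> d(f\<^bsup>n\<^esup>(\<zeta>))\<close> for a bounded \<open>d\<close>; since the equation is only given on a
  spiraling domain, it first has to be continued to a domain that is invariant under \<open>f\<close>.
\<close>

subsection \<open>Monomials\<close>

text \<open>Formal composition enters through three facts: its Taylor series is summable, it is
  additive in the outer series, and its support is controlled, in particular composition with
  \<open>fhat\<close> multiplies orders in z by \<alpha>. The formal uniqueness ranges over all
  parabolic transseries, with iterated logarithms of any depth, so these facts are established for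
  general supports by means of Neumann's lemma; the analytic side only meets the monomials
  e^(-\<beta> \<zeta>) \<zeta>^j. The second obstacle is that analyticity, expansion and
  parabolicity of a germ may be given for different representatives, which agree only on some
  spiraling domain. A uniform statement on a quadratic domain does not pass directly from one
  representative to another. The way around is the real axis: far out it lies in every spiraling
  domain, limits along it determine the coefficients of an expansion, and an expansion on a full
  domain gives the uniform statement back.\<close>

lemma less_monomial_iff:
  "(m :: monomial) < m' \<longleftrightarrow> (\<exists>k. expo m k < expo m' k \<and> (\<forall>j<k. expo m j = expo m' j))"
  by (simp add: less_poly_mapping.rep_eq less_fun_def)

lemma monomial_less_cases:
  assumes "(m :: monomial) \<le> m'"
  shows "expo m 0 < expo m' 0 \<or> (expo m 0 = expo m' 0 \<and> expo m 1 \<le> expo m' 1)"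
proof (cases "m = m'")
  case False
  then obtain k where k: "expo m k < expo m' k" "\<forall>j<k. expo m j = expo m' j"
    using assms less_monomial_iff by (meson order_le_less)
  consider "k = 0" | "k = 1" | "k > 1" by linarith
  thus ?thesis using k by cases auto
qed auto

lemma expo0_mono: "(m :: monomial) \<le> m' \<Longrightarrow> expo m 0 \<le> expo m' 0"
  using monomial_less_cases by fastforce

lemma tcoeff_simps [simp]:
  "tcoeff 0 m = 0" "tcoeff (x + y) m = tcoeff x m + tcoeff y m"
  "tcoeff (x - y) m = tcoeff x m - tcoeff y m" "tcoeff (- x) m = - tcoeff x m"
  by (simp_all add: zero_transseries.rep_eq plus_transseries.rep_eq
       minus_transseries.rep_eq uminus_transseries.rep_eq)

lemma tcoeff_one: "tcoeff 1 m = (if m = 0 then 1 else 0)"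
  by (simp add: one_transseries.rep_eq)

lemma tcoeff_sum: "tcoeff (sum f A) m = (\<Sum>i\<in>A. tcoeff (f i) m)"
  by (induction A rule: infinite_finite_induct) auto

text \<open>For other monomials \<open>tmono c m\<close> is in general an application of
  \<open>Abs_transseries\<close> outside its domain, so the lemmas on \<open>tmono\<close> carry
  this condition.\<close>

definition int_mono :: "monomial \<Rightarrow> bool" where
  "int_mono m \<longleftrightarrow> (\<forall>j\<ge>1. expo m j \<in> \<int>)"

lemma int_monoD: "m \<in> tsupp x \<Longrightarrow> int_mono m"
  using log_support_tsupp[of x] unfolding log_support_def int_mono_def by blast

lemma int_mono_add: "int_mono m \<Longrightarrow> int_mono m' \<Longrightarrow> int_mono (m + m')"
  by (auto simp: int_mono_def lookup_add)

lemma int_mono_0 [simp]: "int_mono 0"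
  by (simp add: int_mono_def)

lemma int_mono_single: "j = 0 \<or> a \<in> \<int> \<Longrightarrow> int_mono (Poly_Mapping.single j a)"
  by (auto simp: int_mono_def lookup_single when_def)

lemma tcoeff_tmono: "int_mono m0 \<Longrightarrow> tcoeff (tmono c m0) m = (if m = m0 then c else 0)"
  unfolding tmono_def
  by (subst Abs_transseries_inverse)
     (auto intro!: log_support_subset[OF log_support_single[of m0]] simp: int_mono_def)

lemma tcoeff_tmono_mult:
  assumes "int_mono m0"
  shows "tcoeff (tmono c m0 * y) m = c * tcoeff y (m - m0)"
proof -
  have "tcoeff (tmono c m0 * y) m = (\<Sum>(a, b)\<in>{(m0, m - m0)}. tcoeff (tmono c m0) a * tcoeff y b)"
    by (rule tcoeff_times_superset) (use assms in \<open>auto simp: tcoeff_tmono split: if_splits\<close>)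
  thus ?thesis using assms by (simp add: tcoeff_tmono)
qed

lemma tcoeff_tconst: "tcoeff (tconst c) m = (if m = 0 then c else 0)"
  by (simp add: tcoeff_tmono)

lemma tcoeff_tconst_mult [simp]: "tcoeff (tconst c * y) m = c * tcoeff y m"
  by (simp add: tcoeff_tmono_mult)

lemma tconst_add: "tconst (a + b) = tconst a + tconst b"
  by (rule transseries_eqI) (simp add: tcoeff_tconst)

lemma tconst_mult: "tconst (a * b) = tconst a * tconst b"
  by (rule transseries_eqI) (simp add: tcoeff_tconst)

lemma tconst_0 [simp]: "tconst 0 = 0"
  by (rule transseries_eqI) (simp add: tcoeff_tconst)

lemma tconst_1 [simp]: "tconst 1 = 1"
  by (rule transseries_eqI) (simp add: tcoeff_tconst tcoeff_one)

lemma tmono_mult: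
  "int_mono m \<Longrightarrow> int_mono m' \<Longrightarrow> tmono c m * tmono d m' = tmono (c * d) (m + m')"
  by (rule transseries_eqI) (auto simp: tcoeff_tmono_mult tcoeff_tmono int_mono_add)

lemma tsupp_add: "tsupp (x + y) \<subseteq> tsupp x \<union> tsupp y"
  by auto

lemma tsupp_mult: "tsupp (x * y) \<subseteq> {a + b | a b. a \<in> tsupp x \<and> b \<in> tsupp y}"
proof (intro subsetI, clarify)
  fix p assume "tcoeff (x * y) p \<noteq> 0"
  then obtain q where "q \<in> {(a, b). tcoeff x a \<noteq> 0 \<and> tcoeff y b \<noteq> 0 \<and> a + b = p}"
    unfolding times_transseries.rep_eq using sum.not_neutral_contains_not_neutral by blast
  thus "\<exists>a b. p = a + b \<and> a \<in> tsupp x \<and> b \<in> tsupp y" by auto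
qed

subsection \<open>Summable families\<close>

definition tsummable :: "('i \<Rightarrow> transseries) \<Rightarrow> bool" where
  "tsummable F \<longleftrightarrow> (\<forall>m. finite {i. tcoeff (F i) m \<noteq> 0}) \<and> log_support (\<Union>i. tsupp (F i))"

lemma tcoeff_tsum':
  assumes "tsummable F"
  shows "tcoeff (tsum F) m = (\<Sum>i | tcoeff (F i) m \<noteq> 0. tcoeff (F i) m)"
proof -
  have "{m. (\<Sum>i | tcoeff (F i) m \<noteq> 0. tcoeff (F i) m) \<noteq> 0} \<subseteq> (\<Union>i. tsupp (F i))"
  proof
    fix m assume "m \<in> {m. (\<Sum>i | tcoeff (F i) m \<noteq> 0. tcoeff (F i) m) \<noteq> 0}"
    then obtain i where "i \<in> {i. tcoeff (F i) m \<noteq> 0}"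
      using sum.not_neutral_contains_not_neutral by blast
    thus "m \<in> (\<Union>i. tsupp (F i))" by auto
  qed
  hence "log_support {m. (\<Sum>i | tcoeff (F i) m \<noteq> 0. tcoeff (F i) m) \<noteq> 0}"
    using assms log_support_subset unfolding tsummable_def by blast
  thus ?thesis unfolding tsum_def by (simp add: Abs_transseries_inverse)
qed

lemma tcoeff_tsum:
  assumes "tsummable F" "finite A" "{i. tcoeff (F i) m \<noteq> 0} \<subseteq> A"
  shows "tcoeff (tsum F) m = (\<Sum>i\<in>A. tcoeff (F i) m)"
  unfolding tcoeff_tsum'[OF assms(1)]
  by (rule sum.mono_neutral_left) (use assms in auto)

lemma tsummable_finite_fibre: "tsummable F \<Longrightarrow> finite {i. tcoeff (F i) m \<noteq> 0}"
  by (simp add: tsummable_def)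

lemma tsupp_tsum:
  assumes "tsummable F"
  shows "tsupp (tsum F) \<subseteq> (\<Union>i. tsupp (F i))"
proof
  fix m assume "m \<in> tsupp (tsum F)"
  hence "(\<Sum>i | tcoeff (F i) m \<noteq> 0. tcoeff (F i) m) \<noteq> 0"
    by (simp add: tcoeff_tsum'[OF assms])
  then obtain i where "i \<in> {i. tcoeff (F i) m \<noteq> 0}"
    using sum.not_neutral_contains_not_neutral by blast
  thus "m \<in> (\<Union>i. tsupp (F i))" by auto
qed

lemma tsummable_supp_subset:
  assumes "tsummable F" "\<And>i. tsupp (G i) \<subseteq> tsupp (F i)"
  shows "tsummable G"
  unfolding tsummable_def
proof (intro conjI allI)
  show "finite {i. tcoeff (G i) m \<noteq> 0}" for m
    by (rule finite_subset[OF _ tsummable_finite_fibre[OF assms(1), of m]]) (use assms(2) in blast)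
  show "log_support (\<Union>i. tsupp (G i))"
    by (rule log_support_subset[OF _ UN_mono[OF subset_refl assms(2)]])
       (use assms(1) in \<open>simp add: tsummable_def\<close>)
qed

lemma tsummable_add:
  assumes "tsummable F" "tsummable G"
  shows "tsummable (\<lambda>i. F i + G i)"
  unfolding tsummable_def
proof (intro conjI allI)
  show "finite {i. tcoeff (F i + G i) m \<noteq> 0}" for m
    by (rule finite_subset[of _ "{i. tcoeff (F i) m \<noteq> 0} \<union> {i. tcoeff (G i) m \<noteq> 0}"])
       (use assms in \<open>auto simp: tsummable_def\<close>)
  show "log_support (\<Union>i. tsupp (F i + G i))"
    by (rule log_support_subset[of "(\<Union>i. tsupp (F i)) \<union> (\<Union>i. tsupp (G i))"])
       (use assms in \<open>auto simp: tsummable_def intro: log_support_Un\<close>)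
qed

lemma tsum_add:
  assumes "tsummable F" "tsummable G"
  shows "tsum (\<lambda>i. F i + G i) = tsum F + tsum G"
proof (rule transseries_eqI)
  fix m
  let ?A = "{i. tcoeff (F i) m \<noteq> 0} \<union> {i. tcoeff (G i) m \<noteq> 0}"
  have "finite ?A" using assms by (simp add: tsummable_def)
  thus "tcoeff (tsum (\<lambda>i. F i + G i)) m = tcoeff (tsum F + tsum G) m"
    using tcoeff_tsum[of _ ?A m] assms tsummable_add[OF assms]
    by (subst tcoeff_tsum[of _ ?A m]) (auto simp: sum.distrib tcoeff_tsum[of _ ?A m])
qed

lemma tsum_finite:
  assumes "finite A" "\<And>i. i \<notin> A \<Longrightarrow> F i = 0"
  shows "tsummable F" and "tsum F = sum F A"
proof -
  have "log_support (\<Union>i\<in>A. tsupp (F i))" using assms(1)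
    by (induction A) (auto intro: log_support_Un log_support_tsupp)
  moreover have "(\<Union>i. tsupp (F i)) \<subseteq> (\<Union>i\<in>A. tsupp (F i))" using assms(2) by force
  moreover have "finite {i. tcoeff (F i) m \<noteq> 0}" for m
    by (rule finite_subset[OF _ assms(1)]) (use assms(2) in force)
  ultimately show *: "tsummable F" unfolding tsummable_def using log_support_subset by blast
  show "tsum F = sum F A"
    by (rule transseries_eqI, subst tcoeff_tsum[OF * assms(1)]) (use assms(2) in \<open>force simp: tcoeff_sum\<close>)+
qed

lemma tsummable_split:
  assumes "tsummable F" "finite A"
  shows "tsummable (\<lambda>i. if i \<in> A then 0 else F i)"
    and "tsum F = sum F A + tsum (\<lambda>i. if i \<in> A then 0 else F i)"
proof -
  show *: "tsummable (\<lambda>i. if i \<in> A then 0 else F i)"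
    by (rule tsummable_supp_subset[OF assms(1)]) auto
  have fin: "tsummable (\<lambda>i. if i \<in> A then F i else 0)"
      "tsum (\<lambda>i. if i \<in> A then F i else 0) = (\<Sum>i\<in>A. if i \<in> A then F i else 0)"
    by (rule tsum_finite[OF assms(2)]; simp)+
  have "F = (\<lambda>i. (if i \<in> A then F i else 0) + (if i \<in> A then 0 else F i))" by auto
  hence "tsum F = tsum (\<lambda>i. (if i \<in> A then F i else 0) + (if i \<in> A then 0 else F i))" by simp
  also have "\<dots> = sum F A + tsum (\<lambda>i. if i \<in> A then 0 else F i)"
    by (subst tsum_add[OF fin(1) *]) (simp add: fin(2))
  finally show "tsum F = sum F A + tsum (\<lambda>i. if i \<in> A then 0 else F i)" .
qed

lemma tsummable_shift:
  assumes "log_support (h ` S)" "inj_on h S" "log_support N"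
    and "\<And>m. m \<in> S \<Longrightarrow> tsupp (T m) \<subseteq> {h m + n | n. n \<in> N}"
    and "\<And>m. m \<notin> S \<Longrightarrow> T m = 0"
  shows "tsummable T"
  unfolding tsummable_def
proof (intro conjI allI)
  have "(\<Union>i. tsupp (T i)) \<subseteq> {a + b | a b. a \<in> h ` S \<and> b \<in> N}"
  proof
    fix p assume "p \<in> (\<Union>i. tsupp (T i))"
    then obtain i where i: "p \<in> tsupp (T i)" by blast
    hence "i \<in> S" using assms(5) by force
    thus "p \<in> {a + b | a b. a \<in> h ` S \<and> b \<in> N}" using i assms(4) by blast
  qed
  thus "log_support (\<Union>i. tsupp (T i))"
    using log_support_sumset[OF assms(1,3)] log_support_subset by blast
  fix m
  let ?X = "{(a, b). a \<in> h ` S \<and> b \<in> N \<and> a + b = m}"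
  have "finite ?X" using finite_sumset_fibre assms(1,3) unfolding log_support_def by blast
  hence "finite (fst ` ?X)" by blast
  moreover have sub: "h ` {i. tcoeff (T i) m \<noteq> 0} \<subseteq> fst ` ?X"
  proof
    fix p assume "p \<in> h ` {i. tcoeff (T i) m \<noteq> 0}"
    then obtain i where i: "p = h i" "tcoeff (T i) m \<noteq> 0" by blast
    hence "i \<in> S" using assms(5) by force
    then obtain n where "n \<in> N" "m = h i + n" using i assms(4) by blast
    hence "(h i, n) \<in> ?X" using \<open>i \<in> S\<close> by auto
    thus "p \<in> fst ` ?X" using i by force
  qed
  moreover have inj: "inj_on h {i. tcoeff (T i) m \<noteq> 0}"
    by (rule inj_on_subset[OF assms(2)]) (use assms(5) in force)
  ultimately show "finite {i. tcoeff (T i) m \<noteq> 0}" using inj_on_finite[OF inj sub] by simp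
qed

subsection \<open>Neumann's lemma for lexicographic monomials\<close>

fun nsums :: "monomial set \<Rightarrow> nat \<Rightarrow> monomial set" where
  "nsums S 0 = {0}"
| "nsums S (Suc n) = {a + b | a b. a \<in> S \<and> b \<in> nsums S n}"

lemma tsupp_power: "tsupp (x ^ n) \<subseteq> nsums (tsupp x) n"
proof (induction n)
  case (Suc n)
  thus ?case using tsupp_mult[of x "x ^ n"] by fastforce
qed (auto simp: tcoeff_one split: if_splits)

lemma log_support_0: "log_support {0}"
  by (rule log_support_single) auto

lemma log_support_nsums: "log_support S \<Longrightarrow> log_support (nsums S n)"
  by (induction n) (auto intro: log_support_0 log_support_sumset)

text \<open>Addition of monomials commutes, so the summands from \<open>A\<close> can be collected
  in front.\<close>

lemma nsums_Un_split:
  "m \<in> nsums (A \<union> B) n \<Longrightarrow>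
     \<exists>p q a b. p + q = n \<and> a \<in> nsums A p \<and> b \<in> nsums B q \<and> m = a + b"
proof (induction n arbitrary: m)
  case (Suc n)
  then obtain s m' where s: "m = s + m'" "s \<in> A \<union> B" "m' \<in> nsums (A \<union> B) n" by auto
  from Suc.IH[OF s(3)] obtain p q a b where
    *: "p + q = n" "a \<in> nsums A p" "b \<in> nsums B q" "m' = a + b" by blast
  show ?case
  proof (cases "s \<in> A")
    case True
    thus ?thesis using * s
      by (intro exI[of _ "Suc p"] exI[of _ q] exI[of _ "s + a"] exI[of _ b]) (auto simp: add.assoc)
  next
    case False
    hence "s + b \<in> nsums B (Suc q)" using * s by auto
    thus ?thesis using * s
      by (intro exI[of _ p] exI[of _ "Suc q"] exI[of _ a] exI[of _ "s + b"])
         (auto simp: add.assoc add.left_commute)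
  qed
qed auto

lemma nsums_expo_ge:
  assumes "\<And>a. a \<in> S \<Longrightarrow> expo a j \<ge> \<delta>" "m \<in> nsums S n"
  shows "expo m j \<ge> of_nat n * \<delta>"
  using assms(2)
proof (induction n arbitrary: m)
  case (Suc n)
  then obtain a b where "a \<in> S" "b \<in> nsums S n" "m = a + b" by auto
  thus ?case using assms(1)[of a] Suc.IH[of b] by (simp add: lookup_add algebra_simps)
qed auto

lemma nsums_expo_eq_0:
  assumes "\<And>a. a \<in> S \<Longrightarrow> expo a j = 0" "m \<in> nsums S n"
  shows "expo m j = 0"
  using assms(2) by (induction n arbitrary: m) (use assms(1) in \<open>auto simp: lookup_add\<close>)

lemma wfp_on_UN_finite:
  fixes A :: "'i \<Rightarrow> 'a :: linorder set"
  assumes "finite I" "\<And>i. i \<in> I \<Longrightarrow> wfp_on (A i) (<)"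
  shows "wfp_on (\<Union>i\<in>I. A i) (<)"
  using assms
proof (induction I)
  case (insert i I)
  thus ?case by (simp add: wfp_on_Un)
qed (simp add: wfp_on_def)

text \<open>The conclusion of Neumann's lemma: the monoid generated by \<open>S\<close> is
  well-ordered, and each of its elements is a sum of only finitely many lengths. The first part
  bounds the support of a power series, the second makes its coefficients finite sums.\<close>

definition neumann :: "monomial set \<Rightarrow> bool" where
  "neumann S \<longleftrightarrow> wfp_on (\<Union>n. nsums S n) (<) \<and> (\<forall>m. finite {n. m \<in> nsums S n})"

text \<open>
  The exponent at the first nonzero index is bounded below by some \<open>\<delta> > 0\<close>, so that
  elements below a given one use a bounded number of summands of this kind; the other
  summands start at a later index.
\<close>

lemma neumann_step:
  assumes wf: "wfp_on (A \<union> B) (<)" and B: "neumann B"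
    and A: "\<And>a. a \<in> A \<Longrightarrow> expo a j > 0" "\<And>a i. a \<in> A \<union> B \<Longrightarrow> i < j \<Longrightarrow> expo a i = 0"
    and Bj: "\<And>b. b \<in> B \<Longrightarrow> expo b j = 0"
    and ls: "log_support A"
  shows "neumann (A \<union> B)"
proof -
  \<comment> \<open>The lexicographically least element of \<open>A\<close> also has the least
    exponent at index \<open>j\<close>, because all exponents before \<open>j\<close>
    vanish.\<close>
  have "\<exists>\<delta>>0. \<forall>a\<in>A. expo a j \<ge> \<delta>"
  proof (cases "A = {}")
    case False
    have "wfp_on A (<)" using wf by (rule wfp_on_subset) auto
    hence "\<exists>z\<in>A. \<forall>y. y < z \<longrightarrow> y \<notin> A"
      using False unfolding wfp_on_iff_ex_minimal by (metis (no_types, lifting) subset_refl)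
    then obtain z where z: "z \<in> A" "\<And>y. y \<in> A \<Longrightarrow> z \<le> y" by (meson linorder_not_less)
    have "expo z j \<le> expo y j" if y: "y \<in> A" for y
    proof (rule ccontr)
      assume "\<not> ?thesis"
      hence "y < z" unfolding less_monomial_iff using A(2) z(1) y by (intro exI[of _ j]) auto
      thus False using z(2)[OF y] by simp
    qed
    thus ?thesis using z(1) A(1) by blast
  qed (auto intro: exI[of _ 1])
  then obtain \<delta> where \<delta>: "\<delta> > 0" "\<And>a. a \<in> A \<Longrightarrow> expo a j \<ge> \<delta>" by blast
  let ?U = "\<Union>n. nsums B n"
  have wfU: "wfp_on ?U (<)" and finU: "\<And>m. finite {n. m \<in> nsums B n}"
    using B by (auto simp: neumann_def)
  have wfA: "wfp_on (nsums A p) (<)" for p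
    using log_support_nsums[OF ls] by (auto simp: log_support_def)
  have bound: "of_nat p * \<delta> \<le> expo m j"
    if "m = a + b" "a \<in> nsums A p" "b \<in> nsums B q" for m a b p q
    using nsums_expo_ge[of A \<delta> j a p] nsums_expo_eq_0[of B j b q] \<delta> Bj that
    by (simp add: lookup_add)
  have zero: "expo m i = 0" if "m \<in> nsums (A \<union> B) n" "i < j" for m i n
    using nsums_expo_eq_0[of "A \<union> B" i m n] A(2) that by blast
  \<comment> \<open>Bound for the number of summands from \<open>A\<close> in an element whose
    exponent at \<open>j\<close> does not exceed that of \<open>m\<close>.\<close>
  let ?P = "\<lambda>m. nat \<lceil>expo m j / \<delta>\<rceil>"
  have P: "p \<le> ?P m" if "of_nat p * \<delta> \<le> expo m' j" "expo m' j \<le> expo m j" for p m m'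
  proof -
    have "of_nat p * \<delta> \<le> expo m j" using that by linarith
    hence "of_nat p \<le> expo m j / \<delta>" using \<delta>(1) by (simp add: field_simps)
    thus ?thesis by linarith
  qed
  have "wfp_on (\<Union>n. nsums (A \<union> B) n) (<)"
    unfolding wfp_on_iff_ex_minimal
  proof (intro allI impI)
    fix X assume X: "X \<subseteq> (\<Union>n. nsums (A \<union> B) n)" "X \<noteq> {}"
    then obtain x where x: "x \<in> X" by blast
    \<comment> \<open>A minimum of \<open>X\<close> may be sought below one fixed \<open>x\<close>.
      There the number of summands from \<open>A\<close> is bounded by \<open>?P x\<close>, which
      leaves a finite union of well-ordered sumsets.\<close>
    let ?Y = "{y \<in> X. y \<le> x}"
    let ?Z = "\<Union>p\<in>{..?P x}. {a + b | a b. a \<in> nsums A p \<and> b \<in> ?U}"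
    have "wfp_on ?Z (<)" by (intro wfp_on_UN_finite wfp_on_sumset wfA wfU) auto
    moreover have "?Y \<subseteq> ?Z"
    proof
      fix y assume y: "y \<in> ?Y"
      then obtain n where n: "y \<in> nsums (A \<union> B) n" using X by blast
      from nsums_Un_split[OF n] obtain p q a b where
        *: "a \<in> nsums A p" "b \<in> nsums B q" "y = a + b" by blast
      have "expo y j \<le> expo x j"
      proof (rule ccontr)
        assume less: "\<not> ?thesis"
        obtain n' where "x \<in> nsums (A \<union> B) n'" using X x by blast
        hence "x < y" unfolding less_monomial_iff using less zero n by (intro exI[of _ j]) auto
        thus False using y by (auto dest: leD)
      qed
      with bound[OF *(3,1,2)] have "p \<le> ?P x" by (rule P)
      thus "y \<in> ?Z" using * by blast
    qed
    moreover have "?Y \<noteq> {}" using x by blast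
    ultimately have "\<exists>z\<in>?Y. \<forall>y. y < z \<longrightarrow> y \<notin> ?Y"
      unfolding wfp_on_iff_ex_minimal by blast
    then obtain z where "z \<in> X" "z \<le> x" "\<And>y. y < z \<Longrightarrow> y \<notin> ?Y" by blast
    hence "y \<notin> X" if "y < z" for y using that less_imp_le[OF less_le_trans[OF that]] by blast
    thus "\<exists>z\<in>X. \<forall>y. y < z \<longrightarrow> y \<notin> X" using \<open>z \<in> X\<close> by blast
  qed
  moreover have "finite {n. m \<in> nsums (A \<union> B) n}" for m
  proof -
    let ?R = "\<lambda>p. {(a, b). a \<in> nsums A p \<and> b \<in> ?U \<and> a + b = m}"
    have fin: "finite (\<Union>p\<in>{..?P m}. \<Union>z\<in>?R p. (+) p ` {q. snd z \<in> nsums B q})"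
      by (intro finite_UN_I finite_atMost finite_imageI finU finite_sumset_fibre[OF wfA wfU])
    have "{n. m \<in> nsums (A \<union> B) n} \<subseteq> (\<Union>p\<in>{..?P m}. \<Union>z\<in>?R p. (+) p ` {q. snd z \<in> nsums B q})"
    proof
      fix n assume "n \<in> {n. m \<in> nsums (A \<union> B) n}"
      then obtain p q a b where *: "p + q = n" "a \<in> nsums A p" "b \<in> nsums B q" "m = a + b"
        using nsums_Un_split[of m A B n] by blast
      hence "p \<le> ?P m" using P[OF bound[OF *(4,2,3)]] by simp
      moreover have "(a, b) \<in> ?R p" using * by blast
      ultimately show "n \<in> (\<Union>p\<in>{..?P m}. \<Union>z\<in>?R p. (+) p ` {q. snd z \<in> nsums B q})"
        using *(1,3) by (intro UN_I[of p] UN_I[of "(a, b)"]) auto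
    qed
    thus ?thesis using fin finite_subset by blast
  qed
  ultimately show ?thesis by (simp add: neumann_def)
qed

lemma nsums_empty: "nsums {} n = (if n = 0 then {0} else {})"
  by (cases n) auto

text \<open>Descending induction on the number of leading zero exponents. With \<open>k\<close>
  bounding the indices, an element with \<open>k + 1\<close> leading zeros would be 0, so the
  induction starts at the empty set. Positivity says that the first nonzero exponent is positive, as
  \<open>neumann_step\<close> requires.\<close>

lemma neumann_positive:
  assumes "log_support S" "\<And>m. m \<in> S \<Longrightarrow> m > 0"
  shows "neumann S"
proof -
  obtain k where k: "\<forall>m\<in>S. Poly_Mapping.keys m \<subseteq> {..k}"
    using assms(1) unfolding log_support_def by blast
  define Sj where "Sj j = {m \<in> S. \<forall>i<j. expo m i = 0}" for j
  have *: "neumann (Sj (Suc k - d))" if "d \<le> Suc k" for d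
    using that
  proof (induction d)
    case 0
    have "Sj (Suc k) = {}"
    proof -
      have False if "m \<in> S" "\<forall>i<Suc k. expo m i = 0" for m
      proof -
        have "expo m i = 0" for i
        proof (cases "i < Suc k")
          case False
          hence "i \<notin> Poly_Mapping.keys m" using k that(1) by fastforce
          thus ?thesis by (simp add: in_keys_iff)
        qed (use that in auto)
        hence "m = 0" by (intro poly_mapping_eqI) simp
        thus False using assms(2)[OF that(1)] by simp
      qed
      thus ?thesis by (auto simp: Sj_def)
    qed
    moreover have "{n. m \<in> nsums {} n} \<subseteq> {0}" for m by (auto simp: nsums_empty split: if_splits)
    hence "finite {n. m \<in> nsums {} n}" for m using finite_subset by blast
    moreover have "(\<Union>n. nsums {} n) = {0}" by (auto simp: nsums_empty split: if_splits)
    ultimately show ?case using log_support_0 by (simp add: neumann_def log_support_def)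
  next
    case (Suc d)
    let ?j = "Suc k - Suc d"
    have j: "Suc k - d = Suc ?j" using Suc.prems by simp
    let ?A = "{m \<in> Sj ?j. expo m ?j > 0}"
    have un: "Sj ?j = ?A \<union> Sj (Suc ?j)"
    proof -
      have "m \<in> ?A \<union> Sj (Suc ?j)" if m: "m \<in> Sj ?j" for m
      proof (cases "expo m ?j = 0")
        case True
        thus ?thesis using m by (auto simp: Sj_def less_Suc_eq)
      next
        case False
        have "0 < m" using assms(2) m by (auto simp: Sj_def)
        then obtain i where i: "0 < expo m i" "\<forall>l<i. expo m l = 0"
          unfolding less_monomial_iff by auto
        have "\<not> ?j < i" using False i by blast
        moreover have "\<not> i < ?j" using m i by (auto simp: Sj_def)
        ultimately have "i = ?j" by simp
        thus ?thesis using m i by simp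
      qed
      thus ?thesis by (auto simp: Sj_def)
    qed
    have ls: "log_support (Sj j)" for j
      by (rule log_support_subset[OF assms(1)]) (auto simp: Sj_def)
    have "neumann (?A \<union> Sj (Suc ?j))"
    proof (rule neumann_step)
      show "wfp_on (?A \<union> Sj (Suc ?j)) (<)" using ls[of ?j] un by (simp add: log_support_def)
      show "neumann (Sj (Suc ?j))" using Suc j by simp
      show "log_support ?A" by (rule log_support_subset[OF ls[of ?j]]) auto
    qed (auto simp: Sj_def)
    thus ?case using un by simp
  qed
  have "Sj 0 = S" by (auto simp: Sj_def)
  thus ?thesis using *[of "Suc k"] by simp
qed

subsection \<open>Power series in infinitesimals\<close>

lemma nsums_keys_int:
  assumes "\<And>m. m \<in> S \<Longrightarrow> Poly_Mapping.keys m \<subseteq> {..k}" "\<And>m. m \<in> S \<Longrightarrow> int_mono m" "m \<in> nsums S n"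
  shows "Poly_Mapping.keys m \<subseteq> {..k}" "int_mono m"
proof -
  have "Poly_Mapping.keys m \<subseteq> {..k} \<and> int_mono m" using assms(3)
  proof (induction n arbitrary: m)
    case (Suc n)
    then obtain a b where ab: "a \<in> S" "b \<in> nsums S n" "m = a + b" by auto
    have "Poly_Mapping.keys (a + b) \<subseteq> {..k}"
      using Poly_Mapping.keys_add[of a b] assms(1)[OF ab(1)] Suc.IH[OF ab(2)] by blast
    thus ?case using ab Suc.IH[OF ab(2)] assms(2) int_mono_add by blast
  qed auto
  thus "Poly_Mapping.keys m \<subseteq> {..k}" "int_mono m" by auto
qed

lemma log_support_UN_nsums:
  assumes "log_support S" "\<And>m. m \<in> S \<Longrightarrow> m > 0"
  shows "log_support (\<Union>n. nsums S n)"
proof -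
  obtain k where k: "\<forall>m\<in>S. Poly_Mapping.keys m \<subseteq> {..k}"
    using assms(1) unfolding log_support_def by blast
  have int: "\<And>m. m \<in> S \<Longrightarrow> int_mono m"
    using assms(1) by (simp add: log_support_def int_mono_def)
  show ?thesis unfolding log_support_def
  proof (intro conjI)
    show "wfp_on (\<Union>n. nsums S n) (<)"
      using neumann_positive[OF assms] by (simp add: neumann_def)
    show "\<exists>k. \<forall>m\<in>\<Union>n. nsums S n. Poly_Mapping.keys m \<subseteq> {..k}"
      by (intro exI[of _ k]) (use nsums_keys_int(1)[of S k] k int in blast)
    show "\<forall>m\<in>\<Union>n. nsums S n. \<forall>j\<ge>1. expo m j \<in> \<int>"
      using nsums_keys_int(2)[of S k] k int by (force simp: int_mono_def)
  qed
qed

lemma nsums_nonneg: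
  assumes "\<And>m. m \<in> S \<Longrightarrow> m > 0" "m \<in> nsums S n"
  shows "m \<ge> 0"
  using assms(2)
proof (induction n arbitrary: m)
  case (Suc n)
  then obtain a b where ab: "a \<in> S" "b \<in> nsums S n" "m = a + b" by auto
  show ?case unfolding ab(3)
    by (rule add_nonneg_nonneg) (use Suc.IH[OF ab(2)] assms(1)[OF ab(1)] in auto)
qed auto

lemma nsums_Suc_pos:
  assumes "\<And>m. m \<in> S \<Longrightarrow> m > 0" "m \<in> nsums S (Suc n)"
  shows "m > 0"
proof -
  obtain a b where ab: "a \<in> S" "b \<in> nsums S n" "m = a + b" using assms(2) by auto
  show ?thesis unfolding ab(3)
    by (rule add_pos_nonneg) (use nsums_nonneg[OF assms(1) ab(2)] assms(1)[OF ab(1)] in auto)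
qed

lemma infinitesimal_pos: "infinitesimal x \<Longrightarrow> m \<in> tsupp x \<Longrightarrow> m > 0"
  by (auto simp: infinitesimal_def)

text \<open>Truncation: at the finitely many monomials of \<open>M\<close>, every power series in
  \<open>x\<close> has the same coefficients as its partial sum of degree \<open>K\<close>.\<close>

lemma infinitesimal_nsums_bound:
  assumes "infinitesimal x" "finite M"
  shows "\<exists>K. \<forall>m\<in>M. \<forall>n>K. m \<notin> nsums (tsupp x) n"
proof -
  have "neumann (tsupp x)"
    by (rule neumann_positive[OF log_support_tsupp infinitesimal_pos[OF assms(1)]])
  hence "finite (\<Union>m\<in>M. {n. m \<in> nsums (tsupp x) n})" (is "finite ?X")
    using assms(2) by (auto simp: neumann_def)
  hence "\<forall>n\<in>?X. n \<le> Max (insert 0 ?X)" by simp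
  hence "\<forall>m\<in>M. \<forall>n>Max (insert 0 ?X). m \<notin> nsums (tsupp x) n" by fastforce
  thus ?thesis by blast
qed

lemma tcoeff_power_eq_0: "m \<notin> nsums (tsupp x) n \<Longrightarrow> tcoeff (x ^ n) m = 0"
  using tsupp_power[of x n] by blast

lemma tsummable_powers:
  assumes "infinitesimal x"
  shows "tsummable (\<lambda>k. tconst (c k) * x ^ k)"
  unfolding tsummable_def
proof (intro conjI allI)
  fix m
  obtain K where "\<forall>n>K. m \<notin> nsums (tsupp x) n"
    using infinitesimal_nsums_bound[OF assms, of "{m}"] by auto
  hence "{i. tcoeff (tconst (c i) * x ^ i) m \<noteq> 0} \<subseteq> {..K}"
    using tcoeff_power_eq_0 by (force simp: not_less[symmetric])
  thus "finite {i. tcoeff (tconst (c i) * x ^ i) m \<noteq> 0}" using finite_subset by blast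
next
  have "(\<Union>i. tsupp (tconst (c i) * x ^ i)) \<subseteq> (\<Union>n. nsums (tsupp x) n)"
    using tsupp_power[of x] by fastforce
  thus "log_support (\<Union>i. tsupp (tconst (c i) * x ^ i))"
    using log_support_UN_nsums[OF log_support_tsupp infinitesimal_pos[OF assms]]
      log_support_subset by blast
qed

lemma tcoeff_tpowser:
  assumes "infinitesimal x" "\<forall>n>K. m \<notin> nsums (tsupp x) n"
  shows "tcoeff (tpowser c x) m = (\<Sum>n\<le>K. c n * tcoeff (x ^ n) m)"
proof -
  have sub: "{i. tcoeff (tconst (c i) * x ^ i) m \<noteq> 0} \<subseteq> {..K}"
    using assms(2) tcoeff_power_eq_0 by (force simp: not_less[symmetric])
  show ?thesis unfolding tpowser_def
    by (subst tcoeff_tsum[OF tsummable_powers[OF assms(1)] _ sub]) auto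
qed

lemma tsupp_tpowser:
  assumes "infinitesimal x"
  shows "tsupp (tpowser c x) \<subseteq> (\<Union>n\<in>{n. c n \<noteq> 0}. nsums (tsupp x) n)"
proof -
  have "tsupp (tpowser c x) \<subseteq> (\<Union>i. tsupp (tconst (c i) * x ^ i))"
    unfolding tpowser_def by (rule tsupp_tsum[OF tsummable_powers[OF assms]])
  also have "\<dots> \<subseteq> (\<Union>n\<in>{n. c n \<noteq> 0}. nsums (tsupp x) n)"
    using tsupp_power[of x] by force
  finally show ?thesis .
qed

lemma infinitesimal_tpowser:
  assumes "infinitesimal x" "c 0 = 0"
  shows "infinitesimal (tpowser c x)"
  unfolding infinitesimal_def
proof
  fix m assume "m \<in> tsupp (tpowser c x)"
  then obtain n where n: "c n \<noteq> 0" "m \<in> nsums (tsupp x) n" using tsupp_tpowser[OF assms(1)] by blast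
  then obtain k where "n = Suc k" using assms(2) not0_implies_Suc by metis
  thus "m > 0" using nsums_Suc_pos infinitesimal_pos[OF assms(1)] n(2) by blast
qed

text \<open>Allows a factor to be replaced by a truncation that is correct only at the monomials
  occurring in a decomposition of \<open>m\<close> over \<open>A\<close> and
  \<open>B\<close>.\<close>

lemma tcoeff_mult_cong:
  assumes "\<And>a b. a \<in> A \<Longrightarrow> b \<in> B \<Longrightarrow> a + b = m \<Longrightarrow> tcoeff x a = tcoeff x' a \<and> tcoeff y b = tcoeff y' b"
    and "tsupp x \<subseteq> A" "tsupp x' \<subseteq> A" "tsupp y \<subseteq> B" "tsupp y' \<subseteq> B"
  shows "tcoeff (x * y) m = tcoeff (x' * y') m"
proof -
  let ?X = "{(a, b). a \<in> tsupp x \<and> b \<in> tsupp y \<and> a + b = m} \<union>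
            {(a, b). a \<in> tsupp x' \<and> b \<in> tsupp y' \<and> a + b = m}"
  have fin: "finite ?X" using finite_tfibre[of x y m] finite_tfibre[of x' y' m] by simp
  have "tcoeff (x * y) m = (\<Sum>(a, b)\<in>?X. tcoeff x a * tcoeff y b)"
    by (rule tcoeff_times_superset[OF fin]) auto
  also have "\<dots> = (\<Sum>(a, b)\<in>?X. tcoeff x' a * tcoeff y' b)"
  proof (rule sum.cong[OF refl])
    fix p assume p: "p \<in> ?X"
    obtain a b where ab: "p = (a, b)" by (cases p)
    have "a \<in> A" "b \<in> B" "a + b = m" using p assms(2-5) unfolding ab by blast+
    thus "(case p of (a, b) \<Rightarrow> tcoeff x a * tcoeff y b) = (case p of (a, b) \<Rightarrow> tcoeff x' a * tcoeff y' b)"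
      using assms(1) unfolding ab by simp
  qed
  also have "\<dots> = tcoeff (x' * y') m"
    by (rule tcoeff_times_superset[OF fin, symmetric]) auto
  finally show ?thesis .
qed

text \<open>For a fixed \<open>m\<close> there are finitely many decompositions within the monoid of
  \<open>x\<close>, so one truncation degree works for both factors, and the claim becomes an
  identity of polynomials in \<open>x\<close>.\<close>

lemma tpowser_mult:
  assumes inf: "infinitesimal x"
  shows "tpowser (fps_nth C) x * tpowser (fps_nth D) x = tpowser (fps_nth (C * D)) x"
proof (rule transseries_eqI)
  fix m
  let ?U = "\<Union>n. nsums (tsupp x) n"
  have lsU: "log_support ?U"
    using log_support_UN_nsums[OF log_support_tsupp infinitesimal_pos[OF inf]] .
  let ?P = "{(a, b). a \<in> ?U \<and> b \<in> ?U \<and> a + b = m}"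
  have "finite ?P" using lsU by (intro finite_sumset_fibre) (auto simp: log_support_def)
  \<comment> \<open>Including \<open>m\<close> itself ensures that the terms
    \<open>x ^ (i + j)\<close> with \<open>i + j > K\<close> of the product of the truncations
    contribute nothing at \<open>m\<close>.\<close>
  hence "finite (insert m (fst ` ?P \<union> snd ` ?P))" by blast
  then obtain K where K: "\<forall>a\<in>insert m (fst ` ?P \<union> snd ` ?P). \<forall>n>K. a \<notin> nsums (tsupp x) n"
    using infinitesimal_nsums_bound[OF inf] by meson
  have K': "\<forall>n>K. a \<notin> nsums (tsupp x) n" "\<forall>n>K. b \<notin> nsums (tsupp x) n"
    if "a \<in> ?U" "b \<in> ?U" "a + b = m" for a b
  proof -
    have "(a, b) \<in> ?P" using that by blast
    hence "a \<in> fst ` ?P" "b \<in> snd ` ?P" by force+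
    thus "\<forall>n>K. a \<notin> nsums (tsupp x) n" "\<forall>n>K. b \<notin> nsums (tsupp x) n" using K by blast+
  qed
  let ?t = "\<lambda>C. \<Sum>n\<le>K. tconst (fps_nth C n) * x ^ n"
  have supp: "tsupp (tpowser (fps_nth C) x) \<subseteq> ?U" for C
    using tsupp_tpowser[OF inf, of "fps_nth C"] by blast
  have supp': "tsupp (?t C) \<subseteq> ?U" for C
  proof
    fix p assume "p \<in> tsupp (?t C)"
    hence "(\<Sum>n\<le>K. fps_nth C n * tcoeff (x ^ n) p) \<noteq> 0" by (simp add: tcoeff_sum)
    then obtain n where "tcoeff (x ^ n) p \<noteq> 0" using sum.not_neutral_contains_not_neutral
      by (metis (no_types, lifting) mult_zero_right)
    thus "p \<in> ?U" using tsupp_power[of x n] by blast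
  qed
  have t: "tcoeff (tpowser (fps_nth C) x) a = tcoeff (?t C) a" if "\<forall>n>K. a \<notin> nsums (tsupp x) n" for C a
    by (subst tcoeff_tpowser[OF inf that]) (simp add: tcoeff_sum)
  have "tcoeff (tpowser (fps_nth C) x * tpowser (fps_nth D) x) m = tcoeff (?t C * ?t D) m"
  proof (rule tcoeff_mult_cong[OF _ supp supp' supp supp'])
    fix a b assume "a \<in> ?U" "b \<in> ?U" "a + b = m"
    from K'[OF this] show "tcoeff (tpowser (fps_nth C) x) a = tcoeff (?t C) a \<and>
        tcoeff (tpowser (fps_nth D) x) b = tcoeff (?t D) b" using t by blast
  qed
  also have "?t C * ?t D = (\<Sum>i\<le>K. \<Sum>j\<le>K. tconst (fps_nth C i * fps_nth D j) * x ^ (i + j))"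
    by (simp add: sum_product tconst_mult power_add mult_ac)
  also have "tcoeff \<dots> m = (\<Sum>i\<le>K. \<Sum>j\<le>K. fps_nth C i * fps_nth D j * tcoeff (x ^ (i + j)) m)"
    by (simp add: tcoeff_sum)
  also have "\<dots> = (\<Sum>(i, j)\<in>{..K} \<times> {..K}. fps_nth C i * fps_nth D j * tcoeff (x ^ (i + j)) m)"
    by (simp add: sum.cartesian_product)
  also have "\<dots> = (\<Sum>(i, j)\<in>{(i, j). i + j \<le> K}. fps_nth C i * fps_nth D j * tcoeff (x ^ (i + j)) m)"
  proof (rule sum.mono_neutral_right)
    show "\<forall>p\<in>{..K} \<times> {..K} - {(i, j). i + j \<le> K}.
       (case p of (i, j) \<Rightarrow> fps_nth C i * fps_nth D j * tcoeff (x ^ (i + j)) m) = 0"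
    proof
      fix p assume "p \<in> {..K} \<times> {..K} - {(i, j). i + j \<le> K}"
      then obtain i j where p: "p = (i, j)" "i + j > K" by force
      have "tcoeff (x ^ (i + j)) m = 0" by (rule tcoeff_power_eq_0) (use K p in blast)
      thus "(case p of (i, j) \<Rightarrow> fps_nth C i * fps_nth D j * tcoeff (x ^ (i + j)) m) = 0"
        by (simp add: p)
    qed
  qed auto
  also have "\<dots> = (\<Sum>n\<le>K. \<Sum>i\<le>n. fps_nth C i * fps_nth D (n - i) * tcoeff (x ^ (i + (n - i))) m)"
    by (rule sum.triangle_reindex_eq)
  also have "\<dots> = (\<Sum>n\<le>K. fps_nth (C * D) n * tcoeff (x ^ n) m)"
    by (intro sum.cong refl) (auto simp: fps_mult_nth sum_distrib_right atLeast0AtMost)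
  also have "\<dots> = tcoeff (tpowser (fps_nth (C * D)) x) m"
    by (rule tcoeff_tpowser[OF inf, symmetric]) (use K in blast)
  finally show "tcoeff (tpowser (fps_nth C) x * tpowser (fps_nth D) x) m =
    tcoeff (tpowser (fps_nth (C * D)) x) m" .
qed

lemma tpowser_1: "infinitesimal x \<Longrightarrow> tpowser (fps_nth 1) x = 1"
proof (rule transseries_eqI)
  fix m assume inf: "infinitesimal x"
  obtain K where K: "\<forall>n>K. m \<notin> nsums (tsupp x) n"
    using infinitesimal_nsums_bound[OF inf, of "{m}"] by auto
  have "(\<Sum>n\<le>K. fps_nth 1 n * tcoeff (x ^ n) m) = (\<Sum>n\<in>{0}. fps_nth 1 n * tcoeff (x ^ n) m)"
    by (rule sum.mono_neutral_right) auto
  thus "tcoeff (tpowser (fps_nth 1) x) m = tcoeff 1 m"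
    by (simp add: tcoeff_tpowser[OF inf K])
qed

lemma tpowser_X:
  assumes inf: "infinitesimal x"
  shows "tpowser (fps_nth fps_X) x = x"
proof (rule transseries_eqI)
  fix m
  obtain K where K: "\<forall>n>K. m \<notin> nsums (tsupp x) n"
    using infinitesimal_nsums_bound[OF inf, of "{m}"] by auto
  hence K': "\<forall>n>Suc K. m \<notin> nsums (tsupp x) n" by auto
  have "(\<Sum>n\<le>Suc K. fps_nth fps_X n * tcoeff (x ^ n) m) = (\<Sum>n\<in>{1}. fps_nth fps_X n * tcoeff (x ^ n) m)"
    by (rule sum.mono_neutral_right) auto
  thus "tcoeff (tpowser (fps_nth fps_X) x) m = tcoeff x m"
    using tcoeff_tpowser[OF inf K', of "fps_nth fps_X"] by simp
qed

lemma tpowser_power: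
  "infinitesimal x \<Longrightarrow> tpowser (fps_nth D) x ^ k = tpowser (fps_nth (D ^ k)) x"
  by (induction k) (simp_all add: tpowser_1 tpowser_mult)

text \<open>Transfers identities between formal power series to transseries; it is applied to the
  exponential and the logarithm.\<close>

lemma tpowser_compose:
  assumes inf: "infinitesimal x" and D: "fps_nth D 0 = 0"
  shows "tpowser (fps_nth C) (tpowser (fps_nth D) x) = tpowser (fps_nth (C oo D)) x"
proof (rule transseries_eqI)
  fix m
  let ?y = "tpowser (fps_nth D) x"
  have infy: "infinitesimal ?y" using infinitesimal_tpowser[of x "fps_nth D"] inf D by blast
  obtain K where K: "\<forall>n>K. m \<notin> nsums (tsupp x) n"
    using infinitesimal_nsums_bound[OF inf, of "{m}"] by auto
  obtain L where L: "\<forall>n>L. m \<notin> nsums (tsupp ?y) n"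
    using infinitesimal_nsums_bound[OF infy, of "{m}"] by auto
  have pw: "tcoeff (?y ^ k) m = (\<Sum>n\<le>K. fps_nth (D ^ k) n * tcoeff (x ^ n) m)" for k
    by (simp add: tpowser_power[OF inf] tcoeff_tpowser[OF inf K])
  \<comment> \<open>The upper limit \<open>K + L\<close> is at least \<open>L\<close>, which
    truncates the outer series correctly, and at least \<open>K\<close>, which keeps all
    \<open>k \<le> n\<close> in the coefficients of \<open>C oo D\<close> of degree
    \<open>n \<le> K\<close>.\<close>
  have "tcoeff (tpowser (fps_nth C) ?y) m =
        (\<Sum>k\<le>K + L. fps_nth C k * tcoeff (?y ^ k) m)"
    by (rule tcoeff_tpowser[OF infy]) (use L trans_le_add2 not_less in blast)
  also have "\<dots> = (\<Sum>k\<le>K + L. \<Sum>n\<le>K. fps_nth C k * fps_nth (D ^ k) n * tcoeff (x ^ n) m)"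
    by (simp add: pw sum_distrib_left mult.assoc)
  also have "\<dots> = (\<Sum>n\<le>K. \<Sum>k\<le>K + L. fps_nth C k * fps_nth (D ^ k) n * tcoeff (x ^ n) m)"
    by (rule sum.swap)
  also have "\<dots> = (\<Sum>n\<le>K. fps_nth (C oo D) n * tcoeff (x ^ n) m)"
  proof (rule sum.cong[OF refl])
    fix n assume n: "n \<in> {..K}"
    have "(\<Sum>k\<le>K + L. fps_nth C k * fps_nth (D ^ k) n * tcoeff (x ^ n) m) =
          (\<Sum>k\<le>n. fps_nth C k * fps_nth (D ^ k) n * tcoeff (x ^ n) m)"
    proof (rule sum.mono_neutral_right)
      show "\<forall>i\<in>{..K + L} - {..n}. fps_nth C i * fps_nth (D ^ i) n * tcoeff (x ^ n) m = 0"
        using startsby_zero_power_prefix[OF D] by auto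
    qed (use n in auto)
    thus "(\<Sum>k\<le>K + L. fps_nth C k * fps_nth (D ^ k) n * tcoeff (x ^ n) m) =
          fps_nth (C oo D) n * tcoeff (x ^ n) m"
      by (simp add: fps_compose_nth atLeast0AtMost sum_distrib_right)
  qed
  also have "\<dots> = tcoeff (tpowser (fps_nth (C oo D)) x) m"
    by (rule tcoeff_tpowser[OF inf K, symmetric])
  finally show "tcoeff (tpowser (fps_nth C) ?y) m = tcoeff (tpowser (fps_nth (C oo D)) x) m" .
qed

subsection \<open>The chart of parabolic transseries\<close>

text \<open>The series e^x - 1, inverse to \<open>tlog1p\<close> on infinitesimals; it is used to
  invert the chart.\<close>

definition texpm1 :: "transseries \<Rightarrow> transseries" where
  "texpm1 = tpowser (fps_nth (fps_exp 1 - 1))"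

lemma tlog1p_eq: "tlog1p = tpowser (fps_nth (fps_ln 1))"
proof -
  have "(\<lambda>k. if k = 0 then 0 else (-1) ^ (k + 1) / of_nat k) = fps_nth (fps_ln (1 :: complex))"
  proof
    fix k :: nat
    show "(if k = 0 then 0 else (-1) ^ (k + 1) / of_nat k) = fps_nth (fps_ln (1 :: complex)) k"
      by (cases k) (auto simp: fps_ln_def)
  qed
  thus ?thesis by (simp add: tlog1p_def)
qed

lemma infinitesimal_tlog1p: "infinitesimal x \<Longrightarrow> infinitesimal (tlog1p x)"
  unfolding tlog1p_eq by (rule infinitesimal_tpowser) (auto simp: fps_ln_def)

lemma infinitesimal_texpm1: "infinitesimal x \<Longrightarrow> infinitesimal (texpm1 x)"
  unfolding texpm1_def by (rule infinitesimal_tpowser) auto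

lemma texpm1_tlog1p: "infinitesimal x \<Longrightarrow> texpm1 (tlog1p x) = x"
  unfolding texpm1_def tlog1p_eq
  by (subst tpowser_compose)
     (simp_all add: fps_ln_fps_exp_inv fps_inv_right tpowser_X del: fps_inv_def, simp add: fps_inv_def)

lemma tlog1p_texpm1: "infinitesimal x \<Longrightarrow> tlog1p (texpm1 x) = x"
  unfolding texpm1_def tlog1p_eq
  by (subst tpowser_compose) (auto simp: fps_ln_fps_exp_inv fps_inv tpowser_X)

lemma infinitesimal_uminus: "infinitesimal x \<Longrightarrow> infinitesimal (- x)"
  by (simp add: infinitesimal_def)

lemma int_mono_zmon [simp]: "int_mono zmon" "int_mono (- zmon)"
  by (auto simp: zmon_def int_mono_def lookup_single when_def simp del: single_one)

lemma infinitesimal_parabolic: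
  assumes "parabolic_transseries x"
  shows "infinitesimal (tmono 1 (- zmon) * x - 1)"
  unfolding infinitesimal_def
proof
  fix m assume "m \<in> tsupp (tmono 1 (- zmon) * x - 1)"
  hence m: "tcoeff x (m + zmon) - tcoeff 1 m \<noteq> 0" by (simp add: tcoeff_tmono_mult)
  have "m \<noteq> 0" using m assms by (auto simp: tcoeff_one parabolic_transseries_def)
  hence "m + zmon \<in> tsupp x" using m by (simp add: tcoeff_one)
  hence "0 + zmon \<le> m + zmon"
    unfolding add_0 using assms unfolding parabolic_transseries_def by blast
  hence "0 \<le> m" using add_le_cancel_right[of 0 zmon m] by blast
  thus "0 < m" using \<open>m \<noteq> 0\<close> by (simp add: order_less_le)
qed

lemma infinitesimal_zeta_chart:
  assumes "parabolic_transseries x"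
  shows "infinitesimal (zeta_chart x - tzeta)"
  unfolding zeta_chart_def
  using infinitesimal_uminus[OF infinitesimal_tlog1p[OF infinitesimal_parabolic[OF assms]]] by simp

lemma zeta_chart_inj:
  assumes "parabolic_transseries x" "parabolic_transseries y" "zeta_chart x = zeta_chart y"
  shows "x = y"
proof -
  have "texpm1 (tlog1p (tmono 1 (- zmon) * x - 1)) = texpm1 (tlog1p (tmono 1 (- zmon) * y - 1))"
    using assms(3) by (simp add: zeta_chart_def)
  hence eq: "tmono 1 (- zmon) * x = tmono 1 (- zmon) * y"
    using infinitesimal_parabolic assms by (simp add: texpm1_tlog1p)
  show ?thesis
  proof (rule transseries_eqI)
    fix m
    have "tcoeff (tmono 1 (- zmon) * x) (m - zmon) = tcoeff (tmono 1 (- zmon) * y) (m - zmon)"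
      using eq by simp
    thus "tcoeff x m = tcoeff y m" by (simp add: tcoeff_tmono_mult)
  qed
qed

text \<open>Solving \<zeta> - log (1 + \<epsilon>) = \<psi> gives \<epsilon> = e^(\<zeta> - \<psi>)
  - 1. With \<open>zeta_chart_inj\<close>, the parabolic transseries correspond exactly to the
  series \<zeta> plus an infinitesimal, so the normalization equation can be treated in the chart
  alone.\<close>

lemma zeta_chart_surj:
  assumes "infinitesimal (\<psi> - tzeta)"
  shows "\<exists>x. parabolic_transseries x \<and> zeta_chart x = \<psi>"
proof -
  define \<epsilon> where "\<epsilon> = texpm1 (tzeta - \<psi>)"
  have inf: "infinitesimal (tzeta - \<psi>)" using infinitesimal_uminus[OF assms] by simp
  have \<epsilon>: "infinitesimal \<epsilon>" unfolding \<epsilon>_def by (rule infinitesimal_texpm1[OF inf])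
  define x where "x = tmono 1 zmon * (1 + \<epsilon>)"
  have "tcoeff x m = tcoeff (1 + \<epsilon>) (m - zmon)" for m by (simp add: x_def tcoeff_tmono_mult)
  moreover have "tcoeff \<epsilon> 0 = 0" using \<epsilon> by (auto simp: infinitesimal_def)
  moreover have "zmon \<le> m" if "tcoeff (1 + \<epsilon>) (m - zmon) \<noteq> 0" for m
  proof -
    have "m - zmon \<ge> 0"
      using that \<epsilon> by (cases "m - zmon = 0") (auto simp: infinitesimal_def tcoeff_one order_less_imp_le)
    thus ?thesis by simp
  qed
  ultimately have "parabolic_transseries x" by (auto simp: parabolic_transseries_def tcoeff_one)
  moreover have "tmono 1 (- zmon) * x = 1 + \<epsilon>"
    by (simp add: x_def tmono_mult flip: mult.assoc)
  hence "zeta_chart x = \<psi>" by (simp add: zeta_chart_def \<epsilon>_def tlog1p_texpm1[OF inf])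
  ultimately show ?thesis by blast
qed

subsection \<open>Composition of logarithmic transseries\<close>

text \<open>
  The derivation and the substitution \<open>\<zeta> \<mapsto> a \<zeta>\<close> send a monomial \<open>m\<close> with indices up to \<open>k\<close> to series
  supported in the translate by \<open>m\<close>, rescaled at index \<open>0\<close>, of the fixed set \<open>natmon k\<close> below. This
  makes their strongly linear extensions well-defined.
\<close>

definition natgen :: "nat \<Rightarrow> monomial set" where
  "natgen k = (\<lambda>i. Poly_Mapping.single i 1) ` {1..k}"

text \<open>The products of nonnegative integer powers of the monomials of \<open>tell 1\<close>,
  ..., \<open>tell k\<close>.\<close>

definition natmon :: "nat \<Rightarrow> monomial set" where
  "natmon k = (\<Union>n. nsums (natgen k) n)"

lemma lookup_single_one [simp]: "expo (Poly_Mapping.single i 1) j = (if i = j then 1 else 0)"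
  by (simp add: lookup_single when_def del: single_one)

lemma natgenE:
  assumes "m \<in> natgen k"
  obtains i where "m = Poly_Mapping.single i 1" "1 \<le> i" "i \<le> k"
  using assms unfolding natgen_def by auto

lemma natgen_pos: "m \<in> natgen k \<Longrightarrow> m > 0"
proof (elim natgenE)
  fix i assume m: "m = Poly_Mapping.single i 1"
  show "m > 0" unfolding less_monomial_iff m by (rule exI[of _ i]) (simp del: single_one)
qed

lemma natgen_expo: "m \<in> natgen k \<Longrightarrow> expo m j \<ge> 0" "m \<in> natgen k \<Longrightarrow> expo m 0 = 0"
  by (auto elim!: natgenE simp del: single_one)

lemma natgen_int: "m \<in> natgen k \<Longrightarrow> int_mono m"
  by (auto elim!: natgenE intro: int_mono_single simp del: single_one)

lemma natgen_keys: "m \<in> natgen k \<Longrightarrow> Poly_Mapping.keys m \<subseteq> {..k}"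
  by (auto elim!: natgenE simp del: single_one)

lemma log_support_natmon: "log_support (natmon k)"
  unfolding natmon_def
proof (rule log_support_UN_nsums[OF _ natgen_pos])
  have *: "finite S \<Longrightarrow> (\<And>m. m \<in> S \<Longrightarrow> int_mono m) \<Longrightarrow> log_support S" for S :: "monomial set"
  proof (induction S rule: finite_induct)
    case (insert x S)
    have "log_support ({x} \<union> S)"
      by (rule log_support_Un[OF log_support_single]) (use insert in \<open>auto simp: int_mono_def\<close>)
    thus ?case by simp
  qed auto
  show "log_support (natgen k)"
    by (rule * [OF _ natgen_int]) (auto simp: natgen_def)
qed

lemma natmon_0 [simp]: "0 \<in> natmon k"
  unfolding natmon_def by (rule UN_I[of 0]) auto

lemma nsums_add: "a \<in> nsums S p \<Longrightarrow> b \<in> nsums S q \<Longrightarrow> a + b \<in> nsums S (p + q)"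
proof (induction p arbitrary: a)
  case (Suc p)
  then obtain s a' where "s \<in> S" "a' \<in> nsums S p" "a = s + a'" by auto
  thus ?case using Suc by (auto simp: add.assoc)
qed auto

lemma natmon_add: "a \<in> natmon k \<Longrightarrow> b \<in> natmon k \<Longrightarrow> a + b \<in> natmon k"
  unfolding natmon_def using nsums_add by (meson UN_iff UNIV_I)

lemma natmon_single: "1 \<le> i \<Longrightarrow> i \<le> k \<Longrightarrow> Poly_Mapping.single i 1 \<in> natmon k"
  unfolding natmon_def by (rule UN_I[of 1]) (auto simp: natgen_def simp del: single_one)

lemma natmon_mono: "k \<le> l \<Longrightarrow> natmon k \<subseteq> natmon l"
proof -
  assume kl: "k \<le> l"
  have "m \<in> nsums (natgen l) n" if "m \<in> nsums (natgen k) n" for m n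
    using that
  proof (induction n arbitrary: m)
    case (Suc n)
    have "natgen k \<subseteq> natgen l" using kl by (auto simp: natgen_def)
    thus ?case using Suc by auto
  qed auto
  thus ?thesis unfolding natmon_def by blast
qed

lemma natmonE:
  assumes "m \<in> natmon k"
  obtains n where "m \<in> nsums (natgen k) n"
  using assms unfolding natmon_def by blast

lemma natmon_nonneg: "m \<in> natmon k \<Longrightarrow> m \<ge> 0"
  by (elim natmonE) (rule nsums_nonneg[OF natgen_pos])

lemma natmon_expo_nonneg: "m \<in> natmon k \<Longrightarrow> expo m j \<ge> 0"
proof (elim natmonE)
  fix n assume "m \<in> nsums (natgen k) n"
  from nsums_expo_ge[OF natgen_expo(1) this] have "of_nat n * 0 \<le> expo m j" .
  thus "expo m j \<ge> 0" by simp
qed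

lemma natmon_expo_0: "m \<in> natmon k \<Longrightarrow> expo m 0 = 0"
  by (elim natmonE) (rule nsums_expo_eq_0[OF natgen_expo(2)])

lemma natmon_keys: "m \<in> natmon k \<Longrightarrow> Poly_Mapping.keys m \<subseteq> {..k}"
  by (elim natmonE) (rule nsums_keys_int(1)[OF natgen_keys natgen_int])

lemma natmon_mult: "tsupp x \<subseteq> natmon k \<Longrightarrow> tsupp y \<subseteq> natmon k \<Longrightarrow> tsupp (x * y) \<subseteq> natmon k"
  using tsupp_mult[of x y] natmon_add by blast

lemma natmon_one: "tsupp 1 \<subseteq> natmon k"
  by (auto simp: tcoeff_one)

lemma natmon_prod:
  "(\<And>i. i \<in> A \<Longrightarrow> tsupp (f i) \<subseteq> natmon k) \<Longrightarrow> tsupp (prod f A) \<subseteq> natmon k"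
proof (induction A rule: infinite_finite_induct)
  case (insert x F)
  thus ?case using natmon_mult by simp
qed (use natmon_one in auto)

lemma nsums_natmon: "S \<subseteq> natmon k \<Longrightarrow> nsums S n \<subseteq> natmon k"
proof (induction n)
  case (Suc n)
  thus ?case using natmon_add by fastforce
qed auto

lemma natmon_tpowser:
  "infinitesimal x \<Longrightarrow> tsupp x \<subseteq> natmon k \<Longrightarrow> tsupp (tpowser c x) \<subseteq> natmon k"
  using tsupp_tpowser nsums_natmon by blast

section \<open>Supports of the logarithmic shifts\<close>

lemma int_mono_single_one [simp]: "int_mono (Poly_Mapping.single i 1)"
  by (rule int_mono_single) auto

lemma tcoeff_tell: "tcoeff (tell i) m = (if m = Poly_Mapping.single i 1 then 1 else 0)"
  unfolding tell_def by (rule tcoeff_tmono) (rule int_mono_single_one)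

lemma tsupp_tell: "1 \<le> i \<Longrightarrow> i \<le> k \<Longrightarrow> tsupp (tell i) \<subseteq> natmon k"
  using natmon_single by (auto simp: tcoeff_tell simp del: single_one)

text \<open>The factor \<open>tell i\<close> makes the exponent at \<open>i\<close> at least 1 and
  so excludes the monomial 1. This legitimates \<open>tlog1p\<close> and \<open>tpow1p\<close> at
  arguments \<open>tell (j + 2) * log_shift a j\<close>, where \<open>log_shift a 0\<close> is a
  mere constant.\<close>

lemma infinitesimal_tell_mult:
  assumes "1 \<le> i" "i \<le> k" "tsupp x \<subseteq> natmon k"
  shows "infinitesimal (tell i * x)"
  unfolding infinitesimal_def
proof
  fix m assume m: "m \<in> tsupp (tell i * x)"
  then obtain a where a: "a \<in> natmon k" "m = Poly_Mapping.single i 1 + a"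
    using tsupp_mult[of "tell i" x] assms(3) by (auto simp: tcoeff_tell split: if_splits)
  have "expo m i \<noteq> 0" using natmon_expo_nonneg[OF a(1), of i] unfolding a(2) lookup_add by simp
  hence "m \<noteq> 0" by auto
  moreover have "m \<ge> 0"
    using natmon_nonneg natmon_mult[OF tsupp_tell[OF assms(1,2)] assms(3)] m by blast
  ultimately show "m > 0" by simp
qed

text \<open>The lag in the index matters: \<open>log_shift a j\<close> belongs to index
  \<open>j + 2\<close> but involves only indices up to \<open>j + 1\<close>. Scaling a monomial
  therefore introduces no index above those it already has.\<close>

lemma tsupp_log_shift: "tsupp (log_shift a j) \<subseteq> natmon (j + 1)"
proof (induction j)
  case (Suc j)
  have sub: "tsupp (log_shift a j) \<subseteq> natmon (j + 2)" using Suc natmon_mono[of "j + 1" "j + 2"] by auto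
  show ?case unfolding log_shift.simps tlog1p_def
    using natmon_tpowser[OF infinitesimal_tell_mult[OF _ _ sub] natmon_mult[OF tsupp_tell sub]] by simp
qed (auto simp: tcoeff_tconst)

text \<open>The leading effect of \<zeta> \<mapsto> a \<zeta> on a monomial: z^\<beta> becomes z^(a
  \<beta>), and the logarithmic factors keep their exponents. With \<open>a = 1\<close> it is the
  identity, which covers the derivation.\<close>

definition hmon :: "real \<Rightarrow> monomial \<Rightarrow> monomial" where
  "hmon a m = Poly_Mapping.update 0 (a * expo m 0) m"

lemma expo_hmon: "expo (hmon a m) i = (if i = 0 then a * expo m 0 else expo m i)"
  by (simp add: hmon_def lookup_update)

lemma hmon_less: "a > 0 \<Longrightarrow> m < m' \<Longrightarrow> hmon a m < hmon a m'"
proof -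
  assume a: "a > 0" and "m < m'"
  then obtain k where "expo m k < expo m' k" "\<forall>j<k. expo m j = expo m' j"
    unfolding less_monomial_iff by blast
  thus ?thesis unfolding less_monomial_iff using a by (intro exI[of _ k]) (auto simp: expo_hmon)
qed

lemma hmon_add: "n \<in> natmon k \<Longrightarrow> hmon a (m + n) = hmon a m + n"
  by (rule poly_mapping_eqI) (auto simp: expo_hmon lookup_add natmon_expo_0)

lemma hmon_1 [simp]: "hmon 1 m = m"
  by (rule poly_mapping_eqI) (auto simp: expo_hmon)

lemma hmon_expo_0: "expo m 0 = 0 \<Longrightarrow> hmon a m = m"
  by (rule poly_mapping_eqI) (auto simp: expo_hmon)

lemma int_mono_hmon: "int_mono m \<Longrightarrow> int_mono (hmon a m)"
  by (auto simp: int_mono_def expo_hmon)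

lemma keys_hmon: "Poly_Mapping.keys m \<subseteq> {..k} \<Longrightarrow> Poly_Mapping.keys (hmon a m) \<subseteq> {..k}"
  by (auto simp: in_keys_iff expo_hmon subset_iff split: if_splits)

lemma log_support_hmon:
  assumes "log_support S" "a > 0"
  shows "log_support (hmon a ` S)" "inj_on (hmon a) S"
proof -
  show "inj_on (hmon a) S"
    by (rule inj_onI) (metis assms(2) hmon_less less_irrefl linorder_neqE)
  obtain k where k: "\<forall>m\<in>S. Poly_Mapping.keys m \<subseteq> {..k}"
    using assms(1) unfolding log_support_def by blast
  have int: "\<And>m. m \<in> S \<Longrightarrow> int_mono m"
    using assms(1) by (simp add: log_support_def int_mono_def)
  show "log_support (hmon a ` S)" unfolding log_support_def
  proof (intro conjI)
    show "wfp_on (hmon a ` S) (<)" unfolding wfp_on_iff_ex_minimal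
    proof (intro allI impI)
      fix B assume B: "B \<subseteq> hmon a ` S" "B \<noteq> {}"
      let ?C = "{m \<in> S. hmon a m \<in> B}"
      have "?C \<subseteq> S" "?C \<noteq> {}" using B by auto
      then obtain z where z: "z \<in> ?C" "\<And>y. y < z \<Longrightarrow> y \<notin> ?C"
        using assms(1) unfolding log_support_def wfp_on_iff_ex_minimal by meson
      have "y \<notin> B" if "y < hmon a z" for y
      proof
        assume "y \<in> B"
        then obtain m where m: "m \<in> ?C" "y = hmon a m" using B(1) by blast
        hence "z \<le> m" using z(2) by (meson not_le)
        hence "hmon a z \<le> hmon a m" using hmon_less[OF assms(2)] by (metis order_le_less)
        thus False using that m(2) by simp
      qed
      thus "\<exists>z\<in>B. \<forall>y. y < z \<longrightarrow> y \<notin> B" using z(1) by blast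
    qed
    show "\<forall>m\<in>hmon a ` S. \<forall>j\<ge>1. expo m j \<in> \<int>"
      using int_mono_hmon[OF int] by (auto simp: int_mono_def)
    show "\<exists>k. \<forall>m\<in>hmon a ` S. Poly_Mapping.keys m \<subseteq> {..k}"
      using keys_hmon k by blast
  qed
qed

text \<open>The bound is required for every \<open>k\<close> above the indices of \<open>m\<close>,
  so that a single \<open>natmon k\<close> serves all monomials of a series at once.\<close>

definition shiftop :: "real \<Rightarrow> (monomial \<Rightarrow> transseries) \<Rightarrow> bool" where
  "shiftop a T \<longleftrightarrow> a > 0 \<and> (\<forall>m k. int_mono m \<longrightarrow> Poly_Mapping.keys m \<subseteq> {..k} \<longrightarrow>
     tsupp (T m) \<subseteq> {hmon a m + n | n. n \<in> natmon k})"

abbreviation keys_below :: "nat \<Rightarrow> transseries \<Rightarrow> bool" where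
  "keys_below k x \<equiv> (\<forall>m\<in>tsupp x. Poly_Mapping.keys m \<subseteq> {..k})"

lemma ex_keys_below: "\<exists>k. keys_below k x"
  using log_support_tsupp[of x] unfolding log_support_def by blast

lemma shiftop_term:
  assumes "shiftop a T" "keys_below k x" "m \<in> tsupp x"
  shows "tsupp (tconst (tcoeff x m) * T m) \<subseteq> {hmon a m + n | n. n \<in> natmon k}"
proof -
  have "tsupp (T m) \<subseteq> {hmon a m + n | n. n \<in> natmon k}"
    using assms int_monoD[OF assms(3)] unfolding shiftop_def by blast
  moreover have "tsupp (tconst (tcoeff x m) * T m) \<subseteq> tsupp (T m)" by auto
  ultimately show ?thesis by blast
qed

lemma tsummable_tlinear:
  assumes "shiftop a T"
  shows "tsummable (\<lambda>m. tconst (tcoeff x m) * T m)"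
proof -
  obtain k where k: "keys_below k x" using ex_keys_below by blast
  show ?thesis
  proof (rule tsummable_shift[OF log_support_hmon log_support_natmon shiftop_term[OF assms k]])
    show "log_support (tsupp x)" by (rule log_support_tsupp)
    show "log_support (tsupp x)" by (rule log_support_tsupp)
  qed (use assms in \<open>auto simp: shiftop_def\<close>)
qed

lemma tsupp_tlinear:
  assumes "shiftop a T" "keys_below k x"
  shows "tsupp (tlinear T x) \<subseteq> {hmon a m + n | m n. m \<in> tsupp x \<and> n \<in> natmon k}"
proof
  fix p assume "p \<in> tsupp (tlinear T x)"
  then obtain m where m: "p \<in> tsupp (tconst (tcoeff x m) * T m)"
    using tsupp_tsum[OF tsummable_tlinear[OF assms(1), of x]] unfolding tlinear_def by blast
  hence "m \<in> tsupp x" by auto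
  with m shiftop_term[OF assms this]
  show "p \<in> {hmon a m + n | m n. m \<in> tsupp x \<and> n \<in> natmon k}" by blast
qed

lemma tlinear_add:
  assumes "shiftop a T"
  shows "tlinear T (x + y) = tlinear T x + tlinear T y"
  unfolding tlinear_def
  by (subst tsum_add[OF tsummable_tlinear[OF assms] tsummable_tlinear[OF assms], symmetric])
     (simp add: tconst_add ring_distribs)

lemma tlinear_tmono:
  assumes "int_mono m"
  shows "tlinear T (tmono c m) = tconst c * T m"
proof -
  have "tlinear T (tmono c m) = (\<Sum>m'\<in>{m}. tconst (tcoeff (tmono c m) m') * T m')"
    unfolding tlinear_def by (rule tsum_finite(2)) (use assms in \<open>auto simp: tcoeff_tmono\<close>)
  thus ?thesis using assms by (simp add: tcoeff_tmono)
qed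

section \<open>The derivation and the scaling as operators of this kind\<close>

definition tderiv_mon :: "monomial \<Rightarrow> transseries" where
  "tderiv_mon m = - (tmono (of_real (expo m 0)) m
     + (\<Sum>j\<in>Poly_Mapping.keys m - {0}. tmono (of_real (expo m j)) m * (\<Prod>i\<in>{1..j}. tell i)))"

definition tscale_mon :: "real \<Rightarrow> monomial \<Rightarrow> transseries" where
  "tscale_mon a m = tmono (of_real (a powr (- expo m 1))) (hmon a m)
     * (\<Prod>j | j + 2 \<in> Poly_Mapping.keys m.
          tpow1p (- expo m (j + 2)) (tell (j + 2) * log_shift a j))"

lemma tderiv_eq: "tderiv = tlinear tderiv_mon"
  by (simp add: tderiv_def tderiv_mon_def[abs_def])

lemma tscale_eq: "tscale a = tlinear (tscale_mon a)"
  by (simp add: tscale_def tscale_mon_def[abs_def] hmon_def)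

lemma tsupp_tmono_mult_natmon:
  assumes "int_mono m" "tsupp y \<subseteq> natmon k"
  shows "tsupp (tmono c m * y) \<subseteq> {m + n | n. n \<in> natmon k}"
proof
  fix p assume "p \<in> tsupp (tmono c m * y)"
  hence "p - m \<in> natmon k" using assms by (auto simp: tcoeff_tmono_mult)
  thus "p \<in> {m + n | n. n \<in> natmon k}" by (intro CollectI exI[of _ "p - m"]) simp
qed

lemma shiftop_tderiv: "shiftop 1 tderiv_mon"
  unfolding shiftop_def
proof (intro conjI allI impI)
  fix m :: monomial and k
  assume m: "int_mono m" "Poly_Mapping.keys m \<subseteq> {..k}"
  show "tsupp (tderiv_mon m) \<subseteq> {hmon 1 m + n | n. n \<in> natmon k}"
  proof
    fix p assume "p \<in> tsupp (tderiv_mon m)"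
    hence "tcoeff (tmono (of_real (expo m 0)) m) p +
       (\<Sum>j\<in>Poly_Mapping.keys m - {0}.
          tcoeff (tmono (of_real (expo m j)) m * (\<Prod>i\<in>{1..j}. tell i)) p) \<noteq> 0"
      by (simp add: tderiv_mon_def tcoeff_sum add_eq_0_iff2 neg_eq_iff_add_eq_0)
    then consider "tcoeff (tmono (of_real (expo m 0)) m) p \<noteq> 0"
      | "(\<Sum>j\<in>Poly_Mapping.keys m - {0}.
          tcoeff (tmono (of_real (expo m j)) m * (\<Prod>i\<in>{1..j}. tell i)) p) \<noteq> 0" by fastforce
    thus "p \<in> {hmon 1 m + n | n. n \<in> natmon k}"
    proof cases
      case 1
      hence "p = m" using m(1) by (simp add: tcoeff_tmono split: if_splits)
      thus ?thesis using natmon_0[of k] by (intro CollectI exI[of _ 0]) simp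
    next
      case 2
      then obtain j where j: "j \<in> Poly_Mapping.keys m - {0}"
          "tcoeff (tmono (of_real (expo m j)) m * (\<Prod>i\<in>{1..j}. tell i)) p \<noteq> 0"
        using sum.not_neutral_contains_not_neutral by blast
      have "tsupp (\<Prod>i\<in>{1..j}. tell i) \<subseteq> natmon k"
      proof (rule natmon_prod, rule tsupp_tell)
        show "i \<le> k" if "i \<in> {1..j}" for i
        proof -
          have "j \<le> k" using m(2) j(1) by auto
          thus ?thesis using that by simp
        qed
      qed auto
      from tsupp_tmono_mult_natmon[OF m(1) this] j(2) show ?thesis by auto
    qed
  qed
qed simp

lemma tell_log_shift:
  assumes "j + 2 \<le> k"
  shows "infinitesimal (tell (j + 2) * log_shift a j)" "tsupp (tell (j + 2) * log_shift a j) \<subseteq> natmon k"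
proof -
  have sub: "tsupp (log_shift a j) \<subseteq> natmon k"
    using tsupp_log_shift[of a j] natmon_mono[of "j + 1" k] assms by auto
  show "infinitesimal (tell (j + 2) * log_shift a j)"
    by (rule infinitesimal_tell_mult[OF _ assms sub]) simp
  show "tsupp (tell (j + 2) * log_shift a j) \<subseteq> natmon k"
    by (rule natmon_mult[OF tsupp_tell sub]) (use assms in auto)
qed

lemma shiftop_tscale:
  assumes "a > 0"
  shows "shiftop a (tscale_mon a)"
  unfolding shiftop_def
proof (intro conjI allI impI)
  fix m :: monomial and k
  assume m: "int_mono m" "Poly_Mapping.keys m \<subseteq> {..k}"
  have "tsupp (\<Prod>j | j + 2 \<in> Poly_Mapping.keys m.
          tpow1p (- expo m (j + 2)) (tell (j + 2) * log_shift a j)) \<subseteq> natmon k"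
  proof (rule natmon_prod)
    fix j assume "j \<in> {j. j + 2 \<in> Poly_Mapping.keys m}"
    hence "j + 2 \<le> k" using m(2) by auto
    from natmon_tpowser[OF tell_log_shift[OF this]]
    show "tsupp (tpow1p (- expo m (j + 2)) (tell (j + 2) * log_shift a j)) \<subseteq> natmon k"
      unfolding tpow1p_def by blast
  qed
  thus "tsupp (tscale_mon a m) \<subseteq> {hmon a m + n | n. n \<in> natmon k}"
    unfolding tscale_mon_def by (rule tsupp_tmono_mult_natmon[OF int_mono_hmon[OF m(1)]])
qed (rule assms)

lemma tcoeff_0_mult:
  assumes "\<forall>m\<in>tsupp x. m \<ge> 0" "\<forall>m\<in>tsupp y. m \<ge> 0"
  shows "tcoeff (x * y) 0 = tcoeff x 0 * tcoeff y 0"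
proof -
  have "a = 0 \<and> b = 0" if "a \<in> tsupp x" "b \<in> tsupp y" "a + b = 0" for a b
  proof -
    have "0 \<le> a" "0 \<le> b" using that assms by blast+
    thus ?thesis using that(3) add_nonneg_eq_0_iff by blast
  qed
  hence "tcoeff (x * y) 0 = (\<Sum>(a, b)\<in>{(0, 0)}. tcoeff x a * tcoeff y b)"
    by (intro tcoeff_times_superset) auto
  thus ?thesis by simp
qed

lemma tcoeff_tpowser_0:
  assumes "infinitesimal x"
  shows "tcoeff (tpowser c x) 0 = c 0"
proof -
  have "0 \<notin> nsums (tsupp x) n" if "n > 0" for n
    using nsums_Suc_pos[OF infinitesimal_pos[OF assms], where m = 0 and n = "n - 1"] that by force
  hence "tcoeff (tpowser c x) 0 = (\<Sum>n\<le>0. c n * tcoeff (x ^ n) 0)"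
    by (intro tcoeff_tpowser[OF assms]) blast
  thus ?thesis by (simp add: tcoeff_one)
qed

text \<open>The binomial factors have constant term 1 and no monomial below 1, so at the leading
  monomial only the power of \<open>a\<close> coming from \<open>tell 1\<close> survives. This is
  the coefficient that decides \<open>homogeneous_solution_0\<close>.\<close>

lemma tcoeff_tscale_mon:
  assumes "int_mono m"
  shows "tcoeff (tscale_mon a m) (hmon a m) = of_real (a powr (- expo m 1))"
proof -
  obtain k where k: "Poly_Mapping.keys m \<subseteq> {..k}"
    using finite_nat_set_iff_bounded_le[of "Poly_Mapping.keys m"] by auto
  let ?f = "\<lambda>j. tpow1p (- expo m (j + 2)) (tell (j + 2) * log_shift a j)"
  have "A \<subseteq> {j. j + 2 \<in> Poly_Mapping.keys m} \<Longrightarrow> tcoeff (prod ?f A) 0 = 1" for A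
  proof (induction A rule: infinite_finite_induct)
    case (insert j A)
    have le: "i + 2 \<le> k" if "i \<in> insert j A" for i using insert.prems k that by auto
    have supp: "tsupp (?f i) \<subseteq> natmon k" if "i \<in> insert j A" for i
      using natmon_tpowser[OF tell_log_shift[OF le[OF that]]] unfolding tpow1p_def by blast
    have suppA: "tsupp (prod ?f A) \<subseteq> natmon k" by (rule natmon_prod, rule supp) simp
    have "tcoeff (?f j * prod ?f A) 0 = tcoeff (?f j) 0 * tcoeff (prod ?f A) 0"
    proof (rule tcoeff_0_mult; intro ballI)
      fix m assume "m \<in> tsupp (?f j)"
      thus "m \<ge> 0" using supp[of j] natmon_nonneg by blast
    next
      fix m assume "m \<in> tsupp (prod ?f A)"
      thus "m \<ge> 0" using suppA natmon_nonneg by blast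
    qed
    moreover have "tcoeff (?f j) 0 = 1"
      unfolding tpow1p_def by (subst tcoeff_tpowser_0[OF tell_log_shift(1)[OF le]]) simp_all
    ultimately show ?case using insert by simp
  qed (auto simp: tcoeff_one)
  thus ?thesis unfolding tscale_mon_def
    by (simp add: tcoeff_tmono_mult[OF int_mono_hmon[OF assms]])
qed

lemma keys_add_natmon:
  "Poly_Mapping.keys m \<subseteq> {..k} \<Longrightarrow> n \<in> natmon k \<Longrightarrow> Poly_Mapping.keys (m + n) \<subseteq> {..k}"
  using Poly_Mapping.keys_add[of m n] natmon_keys[of n k] by blast

text \<open>As \<open>natmon k\<close> is closed under addition and contains no index above
  \<open>k\<close>, the set of corrections does not grow with the number of derivatives. This
  uniformity makes the Taylor series summable.\<close>

lemma tsupp_tderiv_iter: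
  assumes "keys_below k x"
  shows "tsupp ((tderiv ^^ i) x) \<subseteq> {m + n | m n. m \<in> tsupp x \<and> n \<in> natmon k} \<and>
    keys_below k ((tderiv ^^ i) x)"
proof (induction i)
  case 0
  have "m \<in> {m + n | m n. m \<in> tsupp x \<and> n \<in> natmon k}" if "m \<in> tsupp x" for m
    using that natmon_0[of k] by (intro CollectI exI[of _ m] exI[of _ 0]) simp
  thus ?case using assms by auto
next
  case (Suc i)
  let ?y = "(tderiv ^^ i) x"
  have *: "tsupp (tderiv ?y) \<subseteq> {m + n | m n. m \<in> tsupp ?y \<and> n \<in> natmon k}"
    using tsupp_tlinear[OF shiftop_tderiv, where k = k and x = "?y"] Suc by (simp add: tderiv_eq)
  have "p \<in> {m + n | m n. m \<in> tsupp x \<and> n \<in> natmon k} \<and> Poly_Mapping.keys p \<subseteq> {..k}"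
    if p: "p \<in> tsupp (tderiv ?y)" for p
  proof -
    obtain m n where mn: "p = m + n" "m \<in> tsupp ?y" "n \<in> natmon k" using * p by blast
    obtain m' n' where m': "m = m' + n'" "m' \<in> tsupp x" "n' \<in> natmon k" using Suc mn(2) by blast
    have "p = m' + (n' + n)" using mn m' by (simp add: add.assoc)
    moreover have "n' + n \<in> natmon k" using natmon_add mn m' by blast
    moreover have "Poly_Mapping.keys p \<subseteq> {..k}" using keys_add_natmon Suc mn by blast
    ultimately show ?thesis using m'(2) by blast
  qed
  thus ?case by auto
qed

lemma tsupp_tscale_tderiv:
  assumes "keys_below k x" "a > 0"
  shows "tsupp (tscale a ((tderiv ^^ i) x)) \<subseteq> {hmon a m + n | m n. m \<in> tsupp x \<and> n \<in> natmon k}"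
proof
  fix p assume "p \<in> tsupp (tscale a ((tderiv ^^ i) x))"
  then obtain m n where mn: "p = hmon a m + n" "m \<in> tsupp ((tderiv ^^ i) x)" "n \<in> natmon k"
    using tsupp_tlinear[OF shiftop_tscale[OF assms(2)]] tsupp_tderiv_iter[OF assms(1), of i]
    unfolding tscale_eq by blast
  obtain m' n' where m': "m = m' + n'" "m' \<in> tsupp x" "n' \<in> natmon k"
    using tsupp_tderiv_iter[OF assms(1), of i] mn(2) by blast
  have "p = hmon a m' + (n' + n)" using mn m' hmon_add by (simp add: add.assoc)
  moreover have "n' + n \<in> natmon k" using natmon_add mn m' by blast
  ultimately show "p \<in> {hmon a m + n | m n. m \<in> tsupp x \<and> n \<in> natmon k}" using m'(2) by blast
qed

section \<open>Taylor expansion around the leading term\<close>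

definition tcomp_term :: "real \<Rightarrow> transseries \<Rightarrow> transseries \<Rightarrow> nat \<Rightarrow> transseries" where
  "tcomp_term a \<eta> g k = tconst (1 / fact k) * tscale a ((tderiv ^^ k) g) * \<eta> ^ k"

lemma tcomp_eq:
  assumes "tcoeff \<eta> zetamon = 0"
  shows "tcomp g (tconst (of_real a) * tzeta + \<eta>) = tsum (tcomp_term a \<eta> g)"
proof -
  have "tcoeff tzeta zetamon = 1"
    by (simp add: tzeta_def zetamon_def tcoeff_tmono int_mono_single)
  thus ?thesis using assms by (simp add: tcomp_def tcomp_term_def[abs_def] Let_def)
qed

text \<open>The three sources of a monomial in the Taylor term of degree \<open>k\<close>: a
  rescaled monomial of \<open>g\<close>, a correction from differentiation and scaling, and a
  product of \<open>k\<close> monomials of \<eta>. The orders of compositions are read off this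
  decomposition.\<close>

lemma tsupp_tcomp_term:
  assumes "keys_below K g" "a > 0" "p \<in> tsupp (tcomp_term a \<eta> g k)"
  shows "\<exists>m n e. p = hmon a m + n + e \<and> m \<in> tsupp g \<and> n \<in> natmon K \<and> e \<in> nsums (tsupp \<eta>) k"
proof -
  have "p \<in> tsupp (tscale a ((tderiv ^^ k) g) * \<eta> ^ k)"
    using assms(3) by (simp add: tcomp_term_def mult.assoc)
  then obtain q e where *: "p = q + e" "q \<in> tsupp (tscale a ((tderiv ^^ k) g))" "e \<in> tsupp (\<eta> ^ k)"
    using tsupp_mult by blast
  have "e \<in> nsums (tsupp \<eta>) k" using tsupp_power[of \<eta> k] *(3) by blast
  thus ?thesis using tsupp_tscale_tderiv[OF assms(1,2), of k] * by blast
qed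

text \<open>A given monomial splits in finitely many ways into a part from the scaled derivatives of
  \<open>g\<close> and a part \<open>e\<close> from powers of \<eta>, and by Neumann's lemma each
  \<open>e\<close> occurs in finitely many of these powers.\<close>

lemma tsummable_tcomp:
  assumes "a > 0" "infinitesimal \<eta>"
  shows "tsummable (tcomp_term a \<eta> g)"
proof -
  obtain K where K: "keys_below K g" using ex_keys_below by blast
  define A where "A = {p + q | p q. p \<in> hmon a ` tsupp g \<and> q \<in> natmon K}"
  define E where "E = (\<Union>k. nsums (tsupp \<eta>) k)"
  have A: "log_support A" unfolding A_def
    by (intro log_support_sumset log_support_hmon log_support_natmon log_support_tsupp assms)
  have E: "log_support E" unfolding E_def
    by (rule log_support_UN_nsums[OF log_support_tsupp infinitesimal_pos[OF assms(2)]])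
  have mem: "\<exists>q e. p = q + e \<and> q \<in> A \<and> e \<in> nsums (tsupp \<eta>) k"
    if "p \<in> tsupp (tcomp_term a \<eta> g k)" for p k
    using tsupp_tcomp_term[OF K assms(1) that] unfolding A_def by blast
  have memE: "e \<in> E" if "e \<in> nsums (tsupp \<eta>) k" for e k using that unfolding E_def by blast
  show ?thesis unfolding tsummable_def
  proof (intro conjI allI)
    have "(\<Union>i. tsupp (tcomp_term a \<eta> g i)) \<subseteq> {q + e | q e. q \<in> A \<and> e \<in> E}"
      using mem memE by blast
    thus "log_support (\<Union>i. tsupp (tcomp_term a \<eta> g i))"
      using log_support_subset[OF log_support_sumset[OF A E]] by blast
    fix m
    let ?X = "{(q, e). q \<in> A \<and> e \<in> E \<and> q + e = m}"
    have "finite ?X" by (rule finite_sumset_fibre) (use A E in \<open>auto simp: log_support_def\<close>)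
    moreover have "neumann (tsupp \<eta>)"
      by (rule neumann_positive[OF log_support_tsupp infinitesimal_pos[OF assms(2)]])
    hence "finite {k. m \<in> nsums (tsupp \<eta>) k}" for m by (simp add: neumann_def)
    ultimately have "finite (\<Union>z\<in>?X. {k. snd z \<in> nsums (tsupp \<eta>) k})" by (intro finite_UN_I)
    moreover have "{i. tcoeff (tcomp_term a \<eta> g i) m \<noteq> 0} \<subseteq> (\<Union>z\<in>?X. {k. snd z \<in> nsums (tsupp \<eta>) k})"
    proof
      fix k assume "k \<in> {i. tcoeff (tcomp_term a \<eta> g i) m \<noteq> 0}"
      then obtain q e where "m = q + e" "q \<in> A" "e \<in> nsums (tsupp \<eta>) k" using mem[of m k] by blast
      hence "(q, e) \<in> ?X" "k \<in> {k. snd (q, e) \<in> nsums (tsupp \<eta>) k}" using memE by auto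
      thus "k \<in> (\<Union>z\<in>?X. {k. snd z \<in> nsums (tsupp \<eta>) k})" by blast
    qed
    ultimately show "finite {i. tcoeff (tcomp_term a \<eta> g i) m \<noteq> 0}" using finite_subset by blast
  qed
qed

lemma tderiv_iter_add: "(tderiv ^^ i) (x + y) = (tderiv ^^ i) x + (tderiv ^^ i) y"
  by (induction i) (simp_all add: tderiv_eq tlinear_add[OF shiftop_tderiv])

lemma tcomp_term_add:
  "a > 0 \<Longrightarrow> tcomp_term a \<eta> (x + y) k = tcomp_term a \<eta> x k + tcomp_term a \<eta> y k"
  by (simp add: tcomp_term_def tderiv_iter_add tscale_eq tlinear_add[OF shiftop_tscale] ring_distribs)

lemma tsum_tcomp_add:
  assumes "a > 0" "infinitesimal \<eta>"
  shows "tsum (tcomp_term a \<eta> (x + y)) = tsum (tcomp_term a \<eta> x) + tsum (tcomp_term a \<eta> y)"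
  unfolding tsum_add[OF tsummable_tcomp[OF assms] tsummable_tcomp[OF assms], symmetric]
  by (simp add: tcomp_term_add[OF assms(1), abs_def])

lemma tsum_tcomp_diff:
  assumes "a > 0" "infinitesimal \<eta>"
  shows "tsum (tcomp_term a \<eta> (x - y)) = tsum (tcomp_term a \<eta> x) - tsum (tcomp_term a \<eta> y)"
  using tsum_tcomp_add[OF assms, of "x - y" y] by (simp add: algebra_simps)

text \<open>Repeated composition lets the order in z grow like \<open>a ^ n\<close>, which makes the
  formal counterpart of the series for \<phi> summable in \<open>phi_expands\<close>.\<close>

lemma tsum_tcomp_expo_0_gt:
  assumes "a > 0" "infinitesimal \<eta>" "\<forall>m\<in>tsupp g. expo m 0 > c"
  shows "\<forall>m\<in>tsupp (tsum (tcomp_term a \<eta> g)). expo m 0 > a * c"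
proof
  fix p assume "p \<in> tsupp (tsum (tcomp_term a \<eta> g))"
  then obtain k where "p \<in> tsupp (tcomp_term a \<eta> g k)"
    using tsupp_tsum[OF tsummable_tcomp[of a \<eta> g]] assms by auto
  moreover obtain K where K: "keys_below K g" using ex_keys_below by blast
  ultimately obtain m n e where *: "p = hmon a m + n + e" "m \<in> tsupp g" "n \<in> natmon K"
      "e \<in> nsums (tsupp \<eta>) k"
    using tsupp_tcomp_term[OF K, where p = p and k = k and \<eta> = \<eta> and a = a] assms(1) by auto
  have "expo e 0 \<ge> 0"
    using expo0_mono[OF nsums_nonneg[OF infinitesimal_pos[OF assms(2)] *(4)]] by simp
  moreover have "a * expo m 0 > a * c" using assms(1,3) *(2) by simp
  ultimately show "expo p 0 > a * c"
    using *(1) natmon_expo_0[OF *(3)] by (simp add: lookup_add expo_hmon)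
qed

text \<open>
  At its least monomial \<open>m\<close>, a solution \<open>u\<close> would satisfy \<open>a\<^bsup>- n\<^esup> u\<^sub>m = a u\<^sub>m\<close>, where \<open>n \<ge> 0\<close> is
  the exponent of \<open>\<ell>\<^sub>1\<close> in \<open>m\<close>, or \<open>0 = a u\<^sub>m\<close> if \<open>m\<close> involves \<open>z\<close>.
\<close>

lemma homogeneous_solution_0:
  assumes a: "a > 1" and \<eta>: "\<forall>m\<in>tsupp \<eta>. expo m 0 > 0" "infinitesimal \<eta>" and u: "infinitesimal u"
    and eq: "tsum (tcomp_term a \<eta> u) = tconst (of_real a) * u"
  shows "u = 0"
proof (rule ccontr)
  assume "u \<noteq> 0"
  hence "tsupp u \<noteq> {}" using transseries_eqI[of u 0] by auto
  hence "\<exists>z\<in>tsupp u. \<forall>y. y < z \<longrightarrow> y \<notin> tsupp u"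
    using log_support_tsupp[of u] unfolding log_support_def wfp_on_iff_ex_minimal
    by (meson subset_refl)
  then obtain m where m: "m \<in> tsupp u" "\<And>y. y \<in> tsupp u \<Longrightarrow> m \<le> y" by (meson not_less)
  obtain K where K: "keys_below K u" using ex_keys_below by blast
  have nn: "expo y 0 \<ge> 0" if "y \<in> tsupp u" for y
    using expo0_mono[OF less_imp_le[OF infinitesimal_pos[OF u that]]] by simp
  \<comment> \<open>Minimality gives \<open>m \<le> m'\<close>, while rescaling multiplies the
    exponent of z by \<open>a > 1\<close>; comparing exponents of z leaves none in \<open>m'\<close>
    and \<open>e\<close>. Each factor from \<eta> would contribute a positive one, hence
    \<open>k = 0\<close>, and then \<open>m = m' + n\<close> with \<open>n \<ge> 0\<close> forces
    \<open>m' = m\<close>.\<close>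
  have key: "expo m 0 = 0 \<and> e = 0 \<and> k = 0 \<and> m' = m"
    if *: "m = hmon a m' + n + e" "m' \<in> tsupp u" "n \<in> natmon K" "e \<in> nsums (tsupp \<eta>) k"
    for m' n e k
  proof -
    have le: "expo m 0 \<le> expo m' 0" by (rule expo0_mono[OF m(2)[OF *(2)]])
    have eq0: "expo m 0 = a * expo m' 0 + expo e 0"
      using arg_cong[OF *(1), of "\<lambda>m. expo m 0"] natmon_expo_0[OF *(3)]
      by (simp add: lookup_add expo_hmon)
    have e0: "expo e 0 \<ge> 0"
      using expo0_mono[OF nsums_nonneg[OF infinitesimal_pos[OF \<eta>(2)] *(4)]] by simp
    have m'0: "expo m' 0 = 0"
    proof (rule ccontr)
      assume "expo m' 0 \<noteq> 0"
      hence "expo m' 0 > 0" using nn[OF *(2)] by simp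
      hence "a * expo m' 0 > expo m' 0" using a by simp
      thus False using le eq0 e0 by linarith
    qed
    hence "expo m 0 = 0" "expo e 0 = 0" using eq0 e0 le nn[OF m(1)] by auto
    have "k = 0"
    proof (rule ccontr)
      assume "k \<noteq> 0"
      then obtain k' s e' where s: "s \<in> tsupp \<eta>" "e' \<in> nsums (tsupp \<eta>) k'" "e = s + e'"
        using *(4) by (cases k) auto
      have "expo e' 0 \<ge> 0"
        using expo0_mono[OF nsums_nonneg[OF infinitesimal_pos[OF \<eta>(2)] s(2)]] by simp
      moreover have "expo s 0 > 0" using \<eta>(1) s(1) by blast
      ultimately show False using \<open>expo e 0 = 0\<close> unfolding s(3) lookup_add by simp
    qed
    hence "e = 0" using *(4) by simp
    have "m = m' + n" using *(1) \<open>e = 0\<close> hmon_expo_0[OF m'0] by simp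
    hence "m' \<le> m" using natmon_nonneg[OF *(3)] by simp
    thus ?thesis using m(2)[OF *(2)] \<open>expo m 0 = 0\<close> \<open>e = 0\<close> \<open>k = 0\<close> by simp
  qed
  have key0: "expo m 0 = 0 \<and> m' = m" if "m = hmon a m' + n" "m' \<in> tsupp u" "n \<in> natmon K" for m' n
    using key[of m' n 0 0] that by (metis add.right_neutral insertI1 nsums.simps(1))
  have a0: "a > 0" using a by simp
  have sub: "{k. tcoeff (tcomp_term a \<eta> u k) m \<noteq> 0} \<subseteq> {0}"
  proof
    fix k assume "k \<in> {k. tcoeff (tcomp_term a \<eta> u k) m \<noteq> 0}"
    hence "m \<in> tsupp (tcomp_term a \<eta> u k)" by simp
    thus "k \<in> {0}" using tsupp_tcomp_term[OF K a0, where p = m and \<eta> = \<eta> and k = k] key by blast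
  qed
  have "of_real a * tcoeff u m = tcoeff (tcomp_term a \<eta> u 0) m"
    using arg_cong[OF eq, of "\<lambda>x. tcoeff x m"] tcoeff_tsum[OF tsummable_tcomp[OF a0 \<eta>(2)] _ sub]
    by simp
  also have "\<dots> = tcoeff (tlinear (tscale_mon a) u) m" by (simp add: tcomp_term_def tscale_eq)
  finally have main: "of_real a * tcoeff u m = tcoeff (tlinear (tscale_mon a) u) m" .
  have "tcoeff (tlinear (tscale_mon a) u) m \<noteq> 0" using main m(1) a by auto
  hence "m \<in> tsupp (tlinear (tscale_mon a) u)" by simp
  then obtain m' n where "m = hmon a m' + n" "m' \<in> tsupp u" "n \<in> natmon K"
    using tsupp_tlinear[OF shiftop_tscale[OF a0] K] by blast
  hence m0: "expo m 0 = 0" using key0 by blast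
  have hm: "hmon a m = m" by (rule hmon_expo_0[OF m0])
  have "{m'. tcoeff (tconst (tcoeff u m') * tscale_mon a m') m \<noteq> 0} \<subseteq> {m}"
  proof
    fix m' assume "m' \<in> {m'. tcoeff (tconst (tcoeff u m') * tscale_mon a m') m \<noteq> 0}"
    hence m': "m' \<in> tsupp u" "m \<in> tsupp (tconst (tcoeff u m') * tscale_mon a m')" by auto
    then obtain n where "m = hmon a m' + n" "n \<in> natmon K"
      using shiftop_term[OF shiftop_tscale[OF a0] K m'(1)] by blast
    thus "m' \<in> {m}" using key0 m'(1) by blast
  qed
  hence "tcoeff (tlinear (tscale_mon a) u) m = tcoeff u m * tcoeff (tscale_mon a m) m"
    unfolding tlinear_def
    by (subst tcoeff_tsum[OF tsummable_tlinear[OF shiftop_tscale[OF a0]], of "{m}"]) auto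
  also have "tcoeff (tscale_mon a m) m = of_real (a powr (- expo m 1))"
    using tcoeff_tscale_mon[OF int_monoD[OF m(1)], of a] hm by simp
  finally have "complex_of_real a * tcoeff u m = of_real (a powr (- expo m 1)) * tcoeff u m"
    using main by simp
  hence "complex_of_real a = of_real (a powr (- expo m 1))" using m(1) by simp
  hence aeq: "a = a powr (- expo m 1)" by (simp only: of_real_eq_iff)
  have "expo m 1 \<ge> 0" using monomial_less_cases[OF less_imp_le[OF infinitesimal_pos[OF u m(1)]]] m0 by simp
  hence "a powr (- expo m 1) \<le> a powr 0" using a by (intro powr_mono) auto
  thus False using aeq a by simp
qed

subsection \<open>Dulac monomials\<close>

text \<open>The monomial e^(-\<beta> \<zeta>) \<zeta>^j, since \<zeta> is the inverse of
  \<open>tell 1\<close>.\<close>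

definition dmon :: "real \<Rightarrow> nat \<Rightarrow> monomial" where
  "dmon \<beta> j = Poly_Mapping.single 0 \<beta> + Poly_Mapping.single 1 (- real j)"

lemma expo_dmon: "expo (dmon \<beta> j) i = (if i = 0 then \<beta> else if i = 1 then - real j else 0)"
  by (simp add: dmon_def lookup_add lookup_single when_def)

lemma int_mono_dmon [simp]: "int_mono (dmon \<beta> j)"
  by (simp add: int_mono_def expo_dmon)

lemma dmon_eq_iff [simp]: "dmon \<beta> j = dmon \<beta>' j' \<longleftrightarrow> \<beta> = \<beta>' \<and> j = j'"
proof
  assume eq: "dmon \<beta> j = dmon \<beta>' j'"
  show "\<beta> = \<beta>' \<and> j = j'"
    using arg_cong[OF eq, of "\<lambda>m. expo m 0"] arg_cong[OF eq, of "\<lambda>m. expo m 1"] by (simp add: expo_dmon)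
qed auto

lemma dmon_add: "dmon \<beta> j + dmon \<beta>' j' = dmon (\<beta> + \<beta>') (j + j')"
  by (rule poly_mapping_eqI) (simp add: lookup_add expo_dmon)

lemma hmon_dmon: "hmon a (dmon \<beta> j) = dmon (a * \<beta>) j"
  by (rule poly_mapping_eqI) (simp add: expo_hmon expo_dmon)

lemma dmon_0_0: "dmon 0 0 = 0"
  by (rule poly_mapping_eqI) (simp add: expo_dmon)

lemma zetamon_eq: "zetamon = dmon 0 1"
  by (rule poly_mapping_eqI) (simp add: expo_dmon zetamon_def lookup_single when_def)

lemma keys_dmon: "Poly_Mapping.keys (dmon \<beta> j) \<subseteq> {0, 1}"
  by (auto simp: in_keys_iff expo_dmon split: if_splits)

lemma dmon_less_iff: "dmon \<beta> j < dmon \<beta>' j' \<longleftrightarrow> \<beta> < \<beta>' \<or> (\<beta> = \<beta>' \<and> j' < j)"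
proof
  assume less: "dmon \<beta> j < dmon \<beta>' j'"
  hence "dmon \<beta> j \<noteq> dmon \<beta>' j'" by auto
  thus "\<beta> < \<beta>' \<or> (\<beta> = \<beta>' \<and> j' < j)"
    using monomial_less_cases[OF less_imp_le[OF less]] by (auto simp: expo_dmon)
next
  assume "\<beta> < \<beta>' \<or> (\<beta> = \<beta>' \<and> j' < j)"
  thus "dmon \<beta> j < dmon \<beta>' j'" unfolding less_monomial_iff
  proof
    assume "\<beta> < \<beta>'"
    thus "\<exists>k. expo (dmon \<beta> j) k < expo (dmon \<beta>' j') k \<and> (\<forall>l<k. expo (dmon \<beta> j) l = expo (dmon \<beta>' j') l)"
      by (intro exI[of _ 0]) (simp add: expo_dmon)
  next
    assume "\<beta> = \<beta>' \<and> j' < j"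
    thus "\<exists>k. expo (dmon \<beta> j) k < expo (dmon \<beta>' j') k \<and> (\<forall>l<k. expo (dmon \<beta> j) l = expo (dmon \<beta>' j') l)"
      by (intro exI[of _ 1]) (simp add: expo_dmon)
  qed
qed

text \<open>For \<open>j = 0\<close> the truncated difference \<open>j - 1\<close> does no harm,
  since its coefficient vanishes.\<close>

lemma tderiv_dmon:
  "tderiv (tmono c (dmon \<beta> j)) = tmono (- of_real \<beta> * c) (dmon \<beta> j) + tmono (of_nat j * c) (dmon \<beta> (j - 1))"
proof -
  have tell1: "tell 1 = tmono 1 (Poly_Mapping.single 1 1)" by (simp add: tell_def)
  have add: "dmon \<beta> (Suc i) + Poly_Mapping.single 1 1 = dmon \<beta> i" for i
    by (rule poly_mapping_eqI) (simp add: lookup_add expo_dmon del: single_one)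
  have "tderiv (tmono c (dmon \<beta> j)) = tconst c * tderiv_mon (dmon \<beta> j)"
    unfolding tderiv_eq by (rule tlinear_tmono) simp
  also have "tderiv_mon (dmon \<beta> j) =
      tmono (- of_real \<beta>) (dmon \<beta> j) + tmono (of_nat j) (dmon \<beta> (j - 1))"
  proof (cases j)
    case 0
    have none: "Poly_Mapping.keys (dmon \<beta> j) - {0} = {}" using 0 keys_dmon[of \<beta> j]
      by (auto simp: in_keys_iff expo_dmon split: if_splits)
    have "tderiv_mon (dmon \<beta> j) = - tmono (of_real \<beta>) (dmon \<beta> j)"
      unfolding tderiv_mon_def none by (simp add: expo_dmon)
    thus ?thesis using 0 by (intro transseries_eqI) (simp add: tcoeff_tmono)
  next
    case (Suc i)
    have one: "Poly_Mapping.keys (dmon \<beta> j) - {0} = {1}" using Suc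
      by (auto simp: in_keys_iff expo_dmon split: if_splits)
    have "tderiv_mon (dmon \<beta> j) =
       - (tmono (of_real \<beta>) (dmon \<beta> j) + tmono (- of_nat j) (dmon \<beta> j) * tell 1)"
      unfolding tderiv_mon_def one by (simp add: expo_dmon)
    also have "tmono (- of_nat j) (dmon \<beta> j) * tell 1 = tmono (- of_nat j) (dmon \<beta> i)"
      unfolding tell1 tmono_mult[OF int_mono_dmon int_mono_single_one] Suc add by simp
    finally show ?thesis using Suc by (intro transseries_eqI) (simp add: tcoeff_tmono)
  qed
  finally show ?thesis by (intro transseries_eqI) (simp add: tcoeff_tmono ring_distribs)
qed

lemma tscale_dmon:
  assumes "a > 0"
  shows "tscale a (tmono c (dmon \<beta> j)) = tmono (of_real a ^ j * c) (dmon (a * \<beta>) j)"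
proof -
  have none: "{i. i + 2 \<in> Poly_Mapping.keys (dmon \<beta> j)} = {}" using keys_dmon[of \<beta> j] by fastforce
  have "tscale a (tmono c (dmon \<beta> j)) = tconst c * tscale_mon a (dmon \<beta> j)"
    unfolding tscale_eq by (rule tlinear_tmono) simp
  also have "tscale_mon a (dmon \<beta> j) = tmono (of_real a ^ j) (dmon (a * \<beta>) j)"
    unfolding tscale_mon_def none using assms by (simp add: hmon_dmon expo_dmon powr_realpow)
  finally show ?thesis by (intro transseries_eqI) (simp add: tcoeff_tmono)
qed

subsection \<open>Exponential polynomials\<close>

text \<open>Couples a finite sum of terms c e^(-\<beta> \<zeta>) \<zeta>^j with its formal
  counterpart. Terms are added one at a time and may repeat, so closure under the operations follows
  by induction without normal forms. With \<beta> \<ge> 0 the growth on the right half-plane is at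
  most polynomial.\<close>

inductive expoly :: "(complex \<Rightarrow> complex) \<Rightarrow> transseries \<Rightarrow> bool" where
  expoly_0: "expoly (\<lambda>_. 0) 0"
| expoly_step: "expoly h p \<Longrightarrow> \<beta> \<ge> 0 \<Longrightarrow>
    expoly (\<lambda>\<zeta>. h \<zeta> + c * exp (- of_real \<beta> * \<zeta>) * \<zeta> ^ j) (p + tmono c (dmon \<beta> j))"

lemma expoly_mono: "\<beta> \<ge> 0 \<Longrightarrow> expoly (\<lambda>\<zeta>. c * exp (- of_real \<beta> * \<zeta>) * \<zeta> ^ j) (tmono c (dmon \<beta> j))"
  using expoly_step[OF expoly_0] by fastforce

lemma expoly_add:
  assumes "expoly g q" "expoly h p"
  shows "expoly (\<lambda>\<zeta>. h \<zeta> + g \<zeta>) (p + q)"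
  using assms
proof (induction rule: expoly.induct)
  case (expoly_step g q \<beta> c j)
  have "expoly (\<lambda>\<zeta>. (h \<zeta> + g \<zeta>) + c * exp (- of_real \<beta> * \<zeta>) * \<zeta> ^ j) ((p + q) + tmono c (dmon \<beta> j))"
    by (rule expoly.expoly_step) (use expoly_step in auto)
  thus ?case by (simp only: add.assoc)
qed auto

lemma expoly_mono_mult:
  assumes "expoly h p" "\<gamma> \<ge> 0"
  shows "expoly (\<lambda>\<zeta>. d * exp (- of_real \<gamma> * \<zeta>) * \<zeta> ^ i * h \<zeta>) (tmono d (dmon \<gamma> i) * p)"
  using assms(1)
proof (induction rule: expoly.induct)
  case expoly_0
  thus ?case using expoly.expoly_0 by simp
next
  case (expoly_step h p \<beta> c j)
  have "expoly (\<lambda>\<zeta>. d * exp (- of_real \<gamma> * \<zeta>) * \<zeta> ^ i * h \<zeta> +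
     (d * c) * exp (- of_real (\<gamma> + \<beta>) * \<zeta>) * \<zeta> ^ (i + j))
     (tmono d (dmon \<gamma> i) * p + tmono (d * c) (dmon (\<gamma> + \<beta>) (i + j)))"
    by (rule expoly.expoly_step) (use expoly_step assms in auto)
  also have "(\<lambda>\<zeta>. d * exp (- of_real \<gamma> * \<zeta>) * \<zeta> ^ i * h \<zeta> +
     (d * c) * exp (- of_real (\<gamma> + \<beta>) * \<zeta>) * \<zeta> ^ (i + j)) =
     (\<lambda>\<zeta>. d * exp (- of_real \<gamma> * \<zeta>) * \<zeta> ^ i * (h \<zeta> + c * exp (- of_real \<beta> * \<zeta>) * \<zeta> ^ j))"
    by (simp add: fun_eq_iff algebra_simps power_add exp_add exp_diff exp_minus field_simps)
  also have "tmono d (dmon \<gamma> i) * p + tmono (d * c) (dmon (\<gamma> + \<beta>) (i + j)) =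
     tmono d (dmon \<gamma> i) * (p + tmono c (dmon \<beta> j))"
    by (simp add: ring_distribs tmono_mult dmon_add)
  finally show ?case .
qed

lemma expoly_mult:
  assumes "expoly g q" "expoly h p"
  shows "expoly (\<lambda>\<zeta>. g \<zeta> * h \<zeta>) (q * p)"
  using assms
proof (induction rule: expoly.induct)
  case expoly_0
  thus ?case using expoly.expoly_0 by simp
next
  case (expoly_step g q \<beta> c j)
  show ?case
    using expoly_add[OF expoly_mono_mult[OF expoly_step.prems expoly_step.hyps(2), of c j]
        expoly_step.IH[OF expoly_step.prems]]
    by (simp add: ring_distribs)
qed

lemma expoly_const: "expoly (\<lambda>_. c) (tconst c)"
  using expoly_mono[of 0 c 0] by (simp add: dmon_0_0)

lemma expoly_uminus: "expoly h p \<Longrightarrow> expoly (\<lambda>\<zeta>. - h \<zeta>) (- p)"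
proof -
  assume "expoly h p"
  from expoly_mult[OF expoly_const[of "-1"] this] have "expoly (\<lambda>\<zeta>. - h \<zeta>) (tconst (-1) * p)" by simp
  also have "tconst (-1) * p = - p" by (rule transseries_eqI) simp
  finally show ?thesis .
qed

lemma expoly_diff: "expoly h p \<Longrightarrow> expoly g q \<Longrightarrow> expoly (\<lambda>\<zeta>. h \<zeta> - g \<zeta>) (p - q)"
  using expoly_add[OF expoly_uminus[of g q], of h p] by simp

lemma expoly_sum:
  assumes "\<And>i. i \<in> A \<Longrightarrow> expoly (h i) (p i)"
  shows "expoly (\<lambda>\<zeta>. \<Sum>i\<in>A. h i \<zeta>) (\<Sum>i\<in>A. p i)"
  using assms by (induction A rule: infinite_finite_induct) (auto intro: expoly_add expoly_0)

lemma expoly_deriv: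
  assumes "expoly h p"
  shows "(h has_field_derivative deriv h \<zeta>) (at \<zeta>)" "expoly (deriv h) (tderiv p)"
proof -
  have "\<exists>h'. (\<forall>\<zeta>. (h has_field_derivative h' \<zeta>) (at \<zeta>)) \<and> expoly h' (tderiv p)"
    using assms
  proof (induction rule: expoly.induct)
    case expoly_0
    have "tderiv 0 = 0" using tderiv_dmon[of 0 0 0] by (simp add: dmon_0_0)
    thus ?case using expoly.expoly_0 by (intro exI[of _ "\<lambda>_. 0"]) auto
  next
    case (expoly_step h p \<beta> c j)
    then obtain h' where h': "\<And>\<zeta>. (h has_field_derivative h' \<zeta>) (at \<zeta>)" "expoly h' (tderiv p)"
      by blast
    have "tderiv (p + tmono c (dmon \<beta> j)) =
        tderiv p + tmono (- of_real \<beta> * c) (dmon \<beta> j) + tmono (of_nat j * c) (dmon \<beta> (j - 1))"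
      using tderiv_dmon[of c \<beta> j] by (simp add: tderiv_eq tlinear_add[OF shiftop_tderiv] add.assoc)
    moreover have "expoly (\<lambda>\<zeta>. (h' \<zeta> + (- of_real \<beta> * c) * exp (- of_real \<beta> * \<zeta>) * \<zeta> ^ j) +
        (of_nat j * c) * exp (- of_real \<beta> * \<zeta>) * \<zeta> ^ (j - 1))
        (tderiv p + tmono (- of_real \<beta> * c) (dmon \<beta> j) + tmono (of_nat j * c) (dmon \<beta> (j - 1)))"
      by (intro expoly.expoly_step h'(2) expoly_step.hyps)
    moreover have "((\<lambda>\<zeta>. h \<zeta> + c * exp (- of_real \<beta> * \<zeta>) * \<zeta> ^ j) has_field_derivative
        (h' \<zeta> + (- of_real \<beta> * c) * exp (- of_real \<beta> * \<zeta>) * \<zeta> ^ j) +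
        (of_nat j * c) * exp (- of_real \<beta> * \<zeta>) * \<zeta> ^ (j - 1)) (at \<zeta>)" for \<zeta>
      by (rule derivative_eq_intros h'(1) refl | simp add: algebra_simps)+
    ultimately show ?case by (intro exI conjI allI) auto
  qed
  then obtain h' where h': "\<And>\<zeta>. (h has_field_derivative h' \<zeta>) (at \<zeta>)" "expoly h' (tderiv p)"
    by blast
  have "deriv h = h'" using h'(1) DERIV_imp_deriv by blast
  thus "(h has_field_derivative deriv h \<zeta>) (at \<zeta>)" "expoly (deriv h) (tderiv p)" using h' by auto
qed

lemma expoly_higher_deriv: "expoly h p \<Longrightarrow> expoly ((deriv ^^ k) h) ((tderiv ^^ k) p)"
  by (induction k) (auto intro: expoly_deriv)

lemma expoly_scale:
  assumes "expoly h p" "a > 0"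
  shows "expoly (\<lambda>\<zeta>. h (of_real a * \<zeta>)) (tscale a p)"
  using assms(1)
proof (induction rule: expoly.induct)
  case expoly_0
  have "tscale a 0 = 0" using tscale_dmon[OF assms(2), of 0 0 0] by (simp add: dmon_0_0)
  thus ?case using expoly.expoly_0 by simp
next
  case (expoly_step h p \<beta> c j)
  have "expoly (\<lambda>\<zeta>. h (of_real a * \<zeta>) + (of_real a ^ j * c) * exp (- of_real (a * \<beta>) * \<zeta>) * \<zeta> ^ j)
     (tscale a p + tmono (of_real a ^ j * c) (dmon (a * \<beta>) j))"
    by (rule expoly.expoly_step) (use expoly_step assms in auto)
  thus ?case using tscale_dmon[OF assms(2), of c \<beta> j]
    by (simp add: tscale_eq tlinear_add[OF shiftop_tscale[OF assms(2)]] power_mult_distrib mult_ac)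
qed

lemma expoly_supp: "expoly h p \<Longrightarrow> m \<in> tsupp p \<Longrightarrow> \<exists>\<beta> j. m = dmon \<beta> j \<and> \<beta> \<ge> 0"
  by (induction rule: expoly.induct) (auto simp: tcoeff_tmono split: if_splits)

text \<open>Intended for the monomials \<open>dmon \<beta> j\<close>; rounding down only recovers
  the natural number \<open>j\<close> from the real exponent.\<close>

definition meval :: "monomial \<Rightarrow> complex \<Rightarrow> complex" where
  "meval m \<zeta> = exp (- of_real (expo m 0) * \<zeta>) * \<zeta> ^ nat \<lfloor>- expo m 1\<rfloor>"

lemma meval_dmon: "meval (dmon \<beta> j) \<zeta> = exp (- of_real \<beta> * \<zeta>) * \<zeta> ^ j"
  by (simp add: meval_def expo_dmon)

text \<open>Collects repeated terms: cancellation in \<open>p\<close> is matched by cancellation in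
  \<open>h\<close>. Admitting a superset \<open>A\<close> of the support lets the sum be extended by
  one monomial in the induction.\<close>

lemma expoly_eval:
  assumes "expoly h p"
  shows "\<exists>A. finite A \<and> tsupp p \<subseteq> A \<and> (\<forall>\<zeta>. h \<zeta> = (\<Sum>m\<in>A. tcoeff p m * meval m \<zeta>))"
  using assms
proof (induction rule: expoly.induct)
  case expoly_0
  show ?case by (rule exI[of _ "{}"]) auto
next
  case (expoly_step h p \<beta> c j)
  then obtain A where A: "finite A" "tsupp p \<subseteq> A" "\<And>\<zeta>. h \<zeta> = (\<Sum>m\<in>A. tcoeff p m * meval m \<zeta>)"
    by blast
  let ?B = "insert (dmon \<beta> j) A"
  have "h \<zeta> = (\<Sum>m\<in>?B. tcoeff p m * meval m \<zeta>)" for \<zeta>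
    unfolding A(3) by (rule sum.mono_neutral_left) (use A in auto)
  moreover have "(\<Sum>m\<in>?B. tcoeff (tmono c (dmon \<beta> j)) m * meval m \<zeta>) = c * exp (- of_real \<beta> * \<zeta>) * \<zeta> ^ j" for \<zeta>
  proof -
    have "(\<Sum>m\<in>?B. tcoeff (tmono c (dmon \<beta> j)) m * meval m \<zeta>) =
          (\<Sum>m\<in>{dmon \<beta> j}. tcoeff (tmono c (dmon \<beta> j)) m * meval m \<zeta>)"
      by (rule sum.mono_neutral_right) (use A in \<open>auto simp: tcoeff_tmono\<close>)
    thus ?thesis by (simp add: tcoeff_tmono meval_dmon)
  qed
  ultimately have "h \<zeta> + c * exp (- of_real \<beta> * \<zeta>) * \<zeta> ^ j =
      (\<Sum>m\<in>?B. tcoeff (p + tmono c (dmon \<beta> j)) m * meval m \<zeta>)" for \<zeta>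
    by (simp add: ring_distribs sum.distrib del: sum.insert)
  moreover have "tsupp (p + tmono c (dmon \<beta> j)) \<subseteq> ?B"
    using A(2) by (auto simp: tcoeff_tmono split: if_splits)
  ultimately show ?case using A(1) by (intro exI[of _ ?B]) auto
qed

text \<open>Applied to derivatives, this bounds the remainder of Taylor's formula in
  \<open>expoly_taylor\<close>.\<close>

lemma expoly_growth:
  assumes "expoly h p"
  shows "\<exists>M J. M \<ge> 0 \<and> (\<forall>w. Re w \<ge> 0 \<longrightarrow> norm (h w) \<le> M * (1 + norm w) ^ J)"
  using assms
proof (induction rule: expoly.induct)
  case (expoly_step h p \<beta> c j)
  then obtain M J where MJ: "M \<ge> 0" "\<And>w. Re w \<ge> 0 \<Longrightarrow> norm (h w) \<le> M * (1 + norm w) ^ J" by blast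
  have "norm (h w + c * exp (- of_real \<beta> * w) * w ^ j) \<le> (M + norm c) * (1 + norm w) ^ (J + j)"
    if w: "Re w \<ge> 0" for w
  proof -
    have e: "norm (exp (- of_real \<beta> * w)) \<le> 1" using expoly_step.hyps w by simp
    have "(1 + norm w) ^ J \<le> (1 + norm w) ^ (J + j)" by (rule power_increasing) auto
    hence 1: "norm (h w) \<le> M * (1 + norm w) ^ (J + j)"
      using MJ(2)[OF w] MJ(1) by (meson mult_left_mono order_trans)
    have "norm w ^ j \<le> (1 + norm w) ^ j" by (rule power_mono) auto
    also have "\<dots> \<le> (1 + norm w) ^ (J + j)" by (rule power_increasing) auto
    finally have "norm c * (norm (exp (- of_real \<beta> * w)) * norm w ^ j) \<le> norm c * (1 * (1 + norm w) ^ (J + j))"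
      by (intro mult_left_mono mult_mono e) auto
    hence "norm (c * exp (- of_real \<beta> * w) * w ^ j) \<le> norm c * (1 + norm w) ^ (J + j)"
      by (simp add: norm_mult norm_power mult.assoc)
    with 1 show ?thesis
      using norm_triangle_ineq[of "h w" "c * exp (- of_real \<beta> * w) * w ^ j"]
      by (simp add: ring_distribs)
  qed
  thus ?case using MJ(1) by (intro exI[of _ "M + norm c"] exI[of _ "J + j"]) auto
qed (auto intro: exI[of _ 0])

subsection \<open>Expansions along tame filters\<close>

text \<open>
  Along a tame filter, every power of \<open>\<zeta>\<close> is dominated by \<open>e\<^bsup>\<epsilon> \<zeta>\<^esup>\<close> for all \<open>\<epsilon> > 0\<close>.
\<close>

definition tame :: "complex filter \<Rightarrow> bool" where
  "tame F \<longleftrightarrow> F \<le> at_Re_top {\<zeta>. norm \<zeta> \<le> 2 * (Re \<zeta>)\<^sup>2}"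

abbreviation expf :: "real \<Rightarrow> complex \<Rightarrow> complex" where
  "expf c \<equiv> (\<lambda>\<zeta>. exp (- of_real c * \<zeta>))"

lemma expf_mult: "expf a \<zeta> * expf b \<zeta> = expf (a + b) \<zeta>"
  by (simp add: exp_add[symmetric] algebra_simps)

lemma eventually_at_Re_top:
  "eventually P (at_Re_top D) \<longleftrightarrow> (\<exists>X. \<forall>\<zeta>\<in>D. Re \<zeta> \<ge> X \<longrightarrow> P \<zeta>)"
proof
  assume "eventually P (at_Re_top D)"
  then obtain Q where Q: "eventually Q (at_top :: real filter)" "\<And>\<zeta>. Q (Re \<zeta>) \<Longrightarrow> \<zeta> \<in> D \<Longrightarrow> P \<zeta>"
    unfolding at_Re_top_def eventually_inf_principal eventually_filtercomap by blast
  thus "\<exists>X. \<forall>\<zeta>\<in>D. Re \<zeta> \<ge> X \<longrightarrow> P \<zeta>" unfolding eventually_at_top_linorder by blast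
next
  assume "\<exists>X. \<forall>\<zeta>\<in>D. Re \<zeta> \<ge> X \<longrightarrow> P \<zeta>"
  then obtain X where "\<forall>\<zeta>\<in>D. Re \<zeta> \<ge> X \<longrightarrow> P \<zeta>" by blast
  thus "eventually P (at_Re_top D)"
    unfolding at_Re_top_def eventually_inf_principal eventually_filtercomap
    by (intro exI[of _ "\<lambda>x. x \<ge> X"]) (auto simp: eventually_ge_at_top)
qed

lemma at_Re_top_mono: "D \<subseteq> E \<Longrightarrow> at_Re_top D \<le> at_Re_top E"
  unfolding at_Re_top_def by (intro inf_mono) auto

lemma tame_Re_ge:
  assumes "tame F"
  shows "eventually (\<lambda>\<zeta>. Re \<zeta> \<ge> X) F"
  by (rule filter_leD[OF assms[unfolded tame_def]]) (auto simp: eventually_at_Re_top)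

lemma tame_Re_lim: "tame F \<Longrightarrow> filterlim Re at_top F"
  using tame_Re_ge by (simp add: filterlim_at_top)

lemma tame_norm:
  assumes "tame F"
  shows "eventually (\<lambda>\<zeta>. norm \<zeta> \<le> 2 * (Re \<zeta>)\<^sup>2) F"
  by (rule filter_leD[OF assms[unfolded tame_def]]) (auto simp: eventually_at_Re_top)

lemma tame_norm_ge:
  assumes "tame F"
  shows "eventually (\<lambda>\<zeta>. norm \<zeta> \<ge> X) F"
  using tame_Re_ge[OF assms, of X]
  by eventually_elim (use complex_Re_le_cmod order_trans in blast)

lemma expf_bigo:
  assumes "tame F" "c \<le> c'"
  shows "expf c' \<in> O[F](expf c)"
proof (rule bigoI[where c = 1])
  show "\<forall>\<^sub>F \<zeta> in F. norm (expf c' \<zeta>) \<le> 1 * norm (expf c \<zeta>)"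
    using tame_Re_ge[OF assms(1), of 0]
    by eventually_elim (use assms(2) in \<open>simp add: mult_right_mono\<close>)
qed

lemma expf_smallo:
  assumes "tame F" "c < c'"
  shows "expf c' \<in> o[F](expf c)"
proof (rule smalloI_tendsto)
  have lim: "((\<lambda>\<zeta>. exp (- ((c' - c) * Re \<zeta>))) \<longlongrightarrow> 0) F"
  proof -
    have "filterlim (\<lambda>\<zeta>. (c' - c) * Re \<zeta>) at_top F"
      by (rule filterlim_tendsto_pos_mult_at_top[OF tendsto_const _ tame_Re_lim[OF assms(1)]])
         (use assms(2) in auto)
    hence "filterlim (\<lambda>\<zeta>. - ((c' - c) * Re \<zeta>)) at_bot F" by (simp add: filterlim_uminus_at_bot)
    thus ?thesis by (rule filterlim_compose[OF exp_at_bot])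
  qed
  have "norm (expf c' \<zeta> / expf c \<zeta>) = exp (- ((c' - c) * Re \<zeta>))" for \<zeta>
    by (simp add: norm_divide exp_diff[symmetric] algebra_simps)
  thus "((\<lambda>\<zeta>. expf c' \<zeta> / expf c \<zeta>) \<longlongrightarrow> 0) F"
    using lim by (subst tendsto_norm_zero_iff[symmetric]) simp
qed auto

lemma ident_bigo_expf:
  assumes "tame F" "\<epsilon> > 0"
  shows "(\<lambda>\<zeta>. \<zeta>) \<in> O[F](expf (- \<epsilon>))"
proof -
  have "((\<lambda>x. x ^ 2 / exp x) \<longlongrightarrow> (0 :: real)) at_top" by (rule tendsto_power_div_exp_0)
  moreover have "filterlim (\<lambda>\<zeta>. \<epsilon> * Re \<zeta>) at_top F"
    by (rule filterlim_tendsto_pos_mult_at_top[OF tendsto_const assms(2) tame_Re_lim[OF assms(1)]])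
  ultimately have "((\<lambda>\<zeta>. (\<epsilon> * Re \<zeta>) ^ 2 / exp (\<epsilon> * Re \<zeta>)) \<longlongrightarrow> 0) F"
    by (rule filterlim_compose)
  hence "eventually (\<lambda>\<zeta>. (\<epsilon> * Re \<zeta>) ^ 2 / exp (\<epsilon> * Re \<zeta>) < 1) F"
    by (rule order_tendstoD) simp
  hence "eventually (\<lambda>\<zeta>. norm \<zeta> \<le> 2 / \<epsilon>\<^sup>2 * norm (expf (- \<epsilon>) \<zeta>)) F"
    using tame_norm[OF assms(1)]
  proof eventually_elim
    case (elim \<zeta>)
    have "(\<epsilon> * Re \<zeta>) ^ 2 \<le> exp (\<epsilon> * Re \<zeta>)" using elim(1) by (simp add: field_simps)
    hence "(Re \<zeta>)\<^sup>2 \<le> exp (\<epsilon> * Re \<zeta>) / \<epsilon>\<^sup>2" using assms(2) by (simp add: field_simps power_mult_distrib)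
    thus ?case using elim(2) by simp
  qed
  thus ?thesis by (rule bigoI)
qed

lemma power_bigo_expf:
  assumes "tame F" "\<epsilon> > 0" "(\<lambda>\<zeta>. g \<zeta>) \<in> O[F](\<lambda>\<zeta>. \<zeta>)"
  shows "(\<lambda>\<zeta>. g \<zeta> ^ j) \<in> O[F](expf (- \<epsilon>))"
proof -
  \<comment> \<open>Each of the \<open>j\<close> factors may spend \<delta>, in total at most
    \<epsilon>; adding 1 avoids a division by zero for \<open>j = 0\<close>.\<close>
  define \<delta> where "\<delta> = \<epsilon> / (of_nat j + 1)"
  have \<delta>: "\<delta> > 0" "of_nat j * \<delta> \<le> \<epsilon>"
    using assms(2) by (auto simp: \<delta>_def field_simps)
  have "(\<lambda>\<zeta>. g \<zeta> ^ j) \<in> O[F](\<lambda>\<zeta>. expf (- \<delta>) \<zeta> ^ j)"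
    by (intro landau_o.big_power landau_o.big_trans[OF assms(3)] ident_bigo_expf assms \<delta>)
  also have "(\<lambda>\<zeta>. expf (- \<delta>) \<zeta> ^ j) = expf (- (of_nat j * \<delta>))"
    by (simp add: fun_eq_iff exp_of_nat_mult[symmetric] mult_ac)
  also have "\<dots> \<in> O[F](expf (- \<epsilon>))" using \<delta> by (intro expf_bigo assms) auto
  finally show ?thesis .
qed

section \<open>The lexicographic order as the asymptotic order\<close>

lemma meval_bigo:
  assumes "tame F" "\<beta> > c"
  shows "meval (dmon \<beta> j) \<in> O[F](expf c)"
proof -
  have "(\<lambda>\<zeta>. expf \<beta> \<zeta> * \<zeta> ^ j) \<in> O[F](\<lambda>\<zeta>. expf \<beta> \<zeta> * expf (- (\<beta> - c)) \<zeta>)"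
    using assms by (intro landau_o.big.mult landau_o.big_refl power_bigo_expf) auto
  also have "(\<lambda>\<zeta>. expf \<beta> \<zeta> * expf (- (\<beta> - c)) \<zeta>) = expf c"
    by (simp only: expf_mult) simp
  finally show ?thesis by (simp add: meval_dmon[abs_def])
qed

lemma expoly_bigo:
  assumes "tame F" "expoly h p" "\<forall>m\<in>tsupp p. expo m 0 > c"
  shows "h \<in> O[F](expf c)"
proof -
  obtain A where A: "finite A" "tsupp p \<subseteq> A" "\<And>\<zeta>. h \<zeta> = (\<Sum>m\<in>A. tcoeff p m * meval m \<zeta>)"
    using expoly_eval[OF assms(2)] by blast
  have "(\<lambda>\<zeta>. \<Sum>m\<in>A. tcoeff p m * meval m \<zeta>) \<in> O[F](expf c)"
  proof (rule big_sum_in_bigo)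
    fix m assume "m \<in> A"
    show "(\<lambda>\<zeta>. tcoeff p m * meval m \<zeta>) \<in> O[F](expf c)"
    proof (cases "m \<in> tsupp p")
      case True
      then obtain \<beta> j where m: "m = dmon \<beta> j" using expoly_supp[OF assms(2)] by blast
      have "\<beta> > c" using assms(3) True m by (auto simp: expo_dmon)
      from meval_bigo[OF assms(1) this, of j] show ?thesis unfolding m by simp
    qed auto
  qed
  thus ?thesis using A(3) by presburger
qed

text \<open>If the exponents of z differ, one half of the gap absorbs the power of \<zeta> and the
  other half yields the decay, hence the midpoint in the proof. If they agree, a negative power of
  \<zeta> remains.\<close>

lemma meval_smallo:
  assumes "tame F" "dmon \<beta> j < dmon \<beta>' j'"
  shows "meval (dmon \<beta>' j') \<in> o[F](meval (dmon \<beta> j))"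
proof (cases "\<beta> < \<beta>'")
  case True
  have "meval (dmon \<beta>' j') \<in> O[F](expf ((\<beta> + \<beta>') / 2))"
    by (rule meval_bigo) (use assms True in auto)
  also have "expf ((\<beta> + \<beta>') / 2) \<in> o[F](expf \<beta>)" by (rule expf_smallo) (use assms True in auto)
  also have "expf \<beta> \<in> O[F](meval (dmon \<beta> j))"
  proof (rule bigoI[where c = 1])
    show "\<forall>\<^sub>F \<zeta> in F. norm (expf \<beta> \<zeta>) \<le> 1 * norm (meval (dmon \<beta> j) \<zeta>)"
      using tame_norm_ge[OF assms(1), of 1]
    proof eventually_elim
      case (elim \<zeta>)
      thus ?case using one_le_power[OF elim, of j]
        by (simp add: meval_dmon norm_mult norm_power)
    qed
  qed
  finally show ?thesis .
next
  case False
  hence eq: "\<beta>' = \<beta>" "j' < j" using assms(2) by (auto simp: dmon_less_iff)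
  have "((\<lambda>\<zeta>. inverse \<zeta>) \<longlongrightarrow> 0) F"
  proof (rule tendsto_norm_zero_cancel)
    have "filterlim (\<lambda>\<zeta>. norm \<zeta>) at_top F" using tame_norm_ge[OF assms(1)] by (simp add: filterlim_at_top)
    from tendsto_inverse_0_at_top[OF this]
    show "((\<lambda>\<zeta>. norm (inverse \<zeta>)) \<longlongrightarrow> 0) F" by (simp add: norm_inverse)
  qed
  hence inv: "((\<lambda>\<zeta>. inverse \<zeta> ^ (j - j')) \<longlongrightarrow> 0) F"
    using tendsto_power[of inverse 0 F "j - j'"] eq(2) by (simp add: power_0_left)
  have nz: "eventually (\<lambda>\<zeta>. \<zeta> \<noteq> 0) F"
    using tame_norm_ge[OF assms(1), of 1] by eventually_elim auto
  show ?thesis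
  proof (rule smalloI_tendsto)
    show "\<forall>\<^sub>F \<zeta> in F. meval (dmon \<beta> j) \<zeta> \<noteq> 0" using nz by eventually_elim (simp add: meval_dmon)
    have "\<forall>\<^sub>F \<zeta> in F. inverse \<zeta> ^ (j - j') = meval (dmon \<beta>' j') \<zeta> / meval (dmon \<beta> j) \<zeta>"
      using nz
    proof eventually_elim
      case (elim \<zeta>)
      have "\<zeta> ^ j = \<zeta> ^ j' * \<zeta> ^ (j - j')" using eq(2) by (simp add: power_add[symmetric])
      thus ?case using elim by (simp add: meval_dmon eq(1) field_simps)
    qed
    thus "((\<lambda>\<zeta>. meval (dmon \<beta>' j') \<zeta> / meval (dmon \<beta> j) \<zeta>) \<longlongrightarrow> 0) F"
      using inv by (rule Lim_transform_eventually[rotated])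
  qed
qed

text \<open>All other terms are small compared with the least monomial, so the leading term would be
  small compared with itself and hence eventually zero. The uniqueness of expansions rests on
  this.\<close>

lemma expoly_not_smallo:
  assumes "tame F" "F \<noteq> bot" "expoly h p" and m0: "m0 \<in> tsupp p" "\<And>m. m \<in> tsupp p \<Longrightarrow> m0 \<le> m"
  shows "h \<notin> o[F](meval m0)"
proof
  assume small: "h \<in> o[F](meval m0)"
  obtain A where A: "finite A" "tsupp p \<subseteq> A" "\<And>\<zeta>. h \<zeta> = (\<Sum>m\<in>A. tcoeff p m * meval m \<zeta>)"
    using expoly_eval[OF assms(3)] by blast
  obtain \<beta> j where m0': "m0 = dmon \<beta> j" using expoly_supp[OF assms(3) m0(1)] by blast
  have "(\<lambda>\<zeta>. \<Sum>m\<in>A - {m0}. tcoeff p m * meval m \<zeta>) \<in> o[F](meval m0)"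
  proof (rule big_sum_in_smallo)
    fix m assume m: "m \<in> A - {m0}"
    show "(\<lambda>\<zeta>. tcoeff p m * meval m \<zeta>) \<in> o[F](meval m0)"
    proof (cases "m \<in> tsupp p")
      case True
      then obtain \<beta>' j' where m': "m = dmon \<beta>' j'" using expoly_supp[OF assms(3)] by blast
      have "m0 < m" using m0(2)[OF True] m by auto
      from meval_smallo[OF assms(1) this[unfolded m' m0']] show ?thesis
        unfolding m' m0' by simp
    qed auto
  qed
  with small have "(\<lambda>\<zeta>. h \<zeta> - (\<Sum>m\<in>A - {m0}. tcoeff p m * meval m \<zeta>)) \<in> o[F](meval m0)"
    by (rule sum_in_smallo)
  moreover have "h \<zeta> - (\<Sum>m\<in>A - {m0}. tcoeff p m * meval m \<zeta>) = tcoeff p m0 * meval m0 \<zeta>" for \<zeta>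
    unfolding A(3) using A(1,2) m0(1) by (subst sum.remove[of A m0]) auto
  ultimately have "(\<lambda>\<zeta>. tcoeff p m0 * meval m0 \<zeta>) \<in> o[F](meval m0)" by simp
  hence "meval m0 \<in> o[F](meval m0)" using m0(1) by simp
  hence "eventually (\<lambda>\<zeta>. meval m0 \<zeta> = 0) F" by (simp add: landau_o.small_refl_iff)
  hence "eventually (\<lambda>\<zeta>. False) F" using tame_norm_ge[OF assms(1), of 1]
    by eventually_elim (auto simp: m0' meval_dmon)
  thus False using assms(2) by (simp add: trivial_limit_def)
qed

lemma expoly_min_monomial:
  assumes "expoly h p" "m \<in> tsupp p"
  obtains m0 where "m0 \<in> tsupp p" "\<And>m. m \<in> tsupp p \<Longrightarrow> m0 \<le> m"
proof
  have fin: "finite (tsupp p)" using expoly_eval[OF assms(1)] finite_subset by blast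
  show "Min (tsupp p) \<in> tsupp p" by (rule Min_in[OF fin]) (use assms(2) in blast)
  show "Min (tsupp p) \<le> m" if "m \<in> tsupp p" for m by (rule Min_le[OF fin that])
qed

lemma expoly_bigo_imp:
  assumes "tame F" "F \<noteq> bot" "expoly h p" "h \<in> O[F](expf c)" "m \<in> tsupp p"
  shows "expo m 0 \<ge> c"
proof (rule ccontr)
  assume less: "\<not> ?thesis"
  obtain m0 where m0: "m0 \<in> tsupp p" "\<And>m. m \<in> tsupp p \<Longrightarrow> m0 \<le> m"
    using expoly_min_monomial[OF assms(3,5)] by blast
  have "expo m0 0 < c" using expo0_mono[OF m0(2)[OF assms(5)]] less by simp
  obtain \<beta> j where m0': "m0 = dmon \<beta> j" using expoly_supp[OF assms(3) m0(1)] by blast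
  hence \<beta>: "\<beta> < c" using \<open>expo m0 0 < c\<close> by (simp add: expo_dmon)
  have "h \<in> O[F](expf c)" by (rule assms)
  also have "expf c = meval (dmon c 0)" by (simp add: meval_dmon[abs_def])
  also have "\<dots> \<in> o[F](meval m0)" unfolding m0'
    by (rule meval_smallo[OF assms(1)]) (use \<beta> in \<open>simp add: dmon_less_iff\<close>)
  finally show False using expoly_not_smallo[OF assms(1-3) m0] by blast
qed

text \<open>A least monomial without z would be a power \<zeta>^j with \<open>j \<ge> 0\<close>,
  whose modulus is eventually at least 1.\<close>

lemma expoly_tendsto_0_imp:
  assumes "tame F" "F \<noteq> bot" "expoly h p" "(h \<longlongrightarrow> 0) F" "m \<in> tsupp p"
  shows "expo m 0 > 0"
proof (rule ccontr)
  assume "\<not> ?thesis"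
  obtain m0 where m0: "m0 \<in> tsupp p" "\<And>m. m \<in> tsupp p \<Longrightarrow> m0 \<le> m"
    using expoly_min_monomial[OF assms(3,5)] by blast
  obtain \<beta> j where m0': "m0 = dmon \<beta> j" "\<beta> \<ge> 0" using expoly_supp[OF assms(3) m0(1)] by blast
  have "\<beta> \<le> expo m 0" using expo0_mono[OF m0(2)[OF assms(5)]] by (simp add: m0' expo_dmon)
  hence \<beta>: "\<beta> = 0" using \<open>\<not> expo m 0 > 0\<close> m0'(2) by simp
  have "h \<in> o[F](\<lambda>_. 1)" using assms(4) by (simp add: smalloI_tendsto)
  also have "(\<lambda>_. 1) \<in> O[F](meval m0)"
  proof (rule bigoI[where c = 1])
    show "\<forall>\<^sub>F \<zeta> in F. norm (1 :: complex) \<le> 1 * norm (meval m0 \<zeta>)"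
      using tame_norm_ge[OF assms(1), of 1]
      by eventually_elim (simp add: m0' \<beta> meval_dmon norm_power one_le_power)
  qed
  finally show False using expoly_not_smallo[OF assms(1-3) m0] by blast
qed

abbreviation expo0_gt :: "real \<Rightarrow> transseries \<Rightarrow> bool" where
  "expo0_gt c x \<equiv> (\<forall>m\<in>tsupp x. expo m 0 > c)"

lemma infinitesimal_expo0:
  assumes "expo0_gt c x" "c \<ge> 0"
  shows "infinitesimal x"
  unfolding infinitesimal_def less_monomial_iff
  using assms by (intro ballI exI[of _ 0]) force

lemma expo0_gt_add: "expo0_gt c x \<Longrightarrow> expo0_gt c y \<Longrightarrow> expo0_gt c (x + y)"
  using tsupp_add[of x y] by blast

lemma expo0_gt_diff: "expo0_gt c x \<Longrightarrow> expo0_gt c y \<Longrightarrow> expo0_gt c (x - y)"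
  by force

lemma expo0_gt_mult:
  assumes "expo0_gt c x" "\<forall>m\<in>tsupp y. expo m 0 \<ge> 0"
  shows "expo0_gt c (x * y)"
proof
  fix m assume "m \<in> tsupp (x * y)"
  then obtain a b where ab: "m = a + b" "a \<in> tsupp x" "b \<in> tsupp y" using tsupp_mult by blast
  have "expo a 0 > c" "expo b 0 \<ge> 0" using assms ab by blast+
  thus "expo m 0 > c" unfolding ab(1) lookup_add by simp
qed

text \<open>
  In contrast to \<^const>\<open>expands_on\<close>, the approximating exponential polynomials need not be partial sums
  of the expansion, so that sums, products and compositions of approximants are admissible again.
\<close>

definition expands :: "complex filter \<Rightarrow> (complex \<Rightarrow> complex) \<Rightarrow> transseries \<Rightarrow> bool" where
  "expands F g x \<longleftrightarrow>
     (\<forall>c. \<exists>h p. expoly h p \<and> expo0_gt c (x - p) \<and> (\<lambda>\<zeta>. g \<zeta> - h \<zeta>) \<in> O[F](expf c))"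

lemma expandsE:
  assumes "expands F g x"
  obtains h p where "expoly h p" "expo0_gt c (x - p)" "(\<lambda>\<zeta>. g \<zeta> - h \<zeta>) \<in> O[F](expf c)"
  using assms unfolding expands_def by blast

text \<open>An approximant for a large \<open>c\<close> also serves all smaller ones, so attention
  may be restricted to \<open>c\<close> above a convenient bound.\<close>

lemma expandsI:
  assumes "tame F"
    and "\<And>c. c \<ge> c0 \<Longrightarrow> \<exists>h p. expoly h p \<and> expo0_gt c (x - p) \<and> (\<lambda>\<zeta>. g \<zeta> - h \<zeta>) \<in> O[F](expf c)"
  shows "expands F g x"
  unfolding expands_def
proof
  fix c
  obtain h p where *: "expoly h p" "expo0_gt (max c c0) (x - p)" "(\<lambda>\<zeta>. g \<zeta> - h \<zeta>) \<in> O[F](expf (max c c0))"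
    using assms(2)[of "max c c0"] by auto
  have "(\<lambda>\<zeta>. g \<zeta> - h \<zeta>) \<in> O[F](expf c)"
    using landau_o.big_trans[OF *(3) expf_bigo[OF assms(1), of c "max c c0"]] by simp
  thus "\<exists>h p. expoly h p \<and> expo0_gt c (x - p) \<and> (\<lambda>\<zeta>. g \<zeta> - h \<zeta>) \<in> O[F](expf c)"
    using *(1,2) by (intro exI[of _ h] exI[of _ p]) auto
qed

lemma expands_filter_mono: "expands F g x \<Longrightarrow> F' \<le> F \<Longrightarrow> expands F' g x"
  unfolding expands_def by (meson landau_o.big.filter_mono)

lemma expands_cong:
  assumes "expands F g x" "eventually (\<lambda>\<zeta>. g \<zeta> = g' \<zeta>) F"
  shows "expands F g' x"
  unfolding expands_def
proof
  fix c
  obtain h p where *: "expoly h p" "expo0_gt c (x - p)" "(\<lambda>\<zeta>. g \<zeta> - h \<zeta>) \<in> O[F](expf c)"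
    using expandsE[OF assms(1)] .
  have "\<forall>\<^sub>F \<zeta> in F. g \<zeta> - h \<zeta> = g' \<zeta> - h \<zeta>" using assms(2) by eventually_elim simp
  from landau_o.big.in_cong[OF this] *(3) have "(\<lambda>\<zeta>. g' \<zeta> - h \<zeta>) \<in> O[F](expf c)" by blast
  thus "\<exists>h p. expoly h p \<and> expo0_gt c (x - p) \<and> (\<lambda>\<zeta>. g' \<zeta> - h \<zeta>) \<in> O[F](expf c)" using * by blast
qed

lemma expands_expoly: "expoly h p \<Longrightarrow> expands F h p"
  unfolding expands_def by (intro allI exI[of _ h] exI[of _ p]) auto

lemma expands_supp:
  assumes "expands F g x" "m \<in> tsupp x"
  shows "\<exists>\<beta> j. m = dmon \<beta> j \<and> \<beta> \<ge> 0"
proof -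
  obtain h p where *: "expoly h p" "expo0_gt (expo m 0) (x - p)"
    using expandsE[OF assms(1)] .
  have "m \<in> tsupp p" using *(2) assms(2) by force
  thus ?thesis using expoly_supp[OF *(1)] by blast
qed

lemma expands_supp_nonneg: "expands F g x \<Longrightarrow> m \<in> tsupp x \<Longrightarrow> expo m 0 \<ge> 0"
  by (drule (1) expands_supp) (auto simp: expo_dmon)

lemma expoly_supp_nonneg: "expoly h p \<Longrightarrow> m \<in> tsupp p \<Longrightarrow> expo m 0 \<ge> 0"
  by (drule (1) expoly_supp) (auto simp: expo_dmon)

lemma expands_finite:
  assumes "expands F g x"
  shows "finite {m \<in> tsupp x. expo m 0 \<le> c}"
proof -
  obtain h p where *: "expoly h p" "expo0_gt c (x - p)"
    using expandsE[OF assms] .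
  have "finite (tsupp p)" using expoly_eval[OF *(1)] finite_subset by blast
  moreover have "m \<in> tsupp p" if "m \<in> tsupp x" "expo m 0 \<le> c" for m
  proof (rule ccontr)
    assume "m \<notin> tsupp p"
    hence "m \<in> tsupp (x - p)" using that(1) by simp
    thus False using *(2) that(2) by fastforce
  qed
  hence "{m \<in> tsupp x. expo m 0 \<le> c} \<subseteq> tsupp p" by blast
  ultimately show ?thesis using finite_subset by blast
qed

lemma expands_add:
  assumes "expands F g x" "expands F g' y"
  shows "expands F (\<lambda>\<zeta>. g \<zeta> + g' \<zeta>) (x + y)"
  unfolding expands_def
proof
  fix c
  obtain h p where *: "expoly h p" "expo0_gt c (x - p)" "(\<lambda>\<zeta>. g \<zeta> - h \<zeta>) \<in> O[F](expf c)"
    using expandsE[OF assms(1)] .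
  obtain h' p' where **: "expoly h' p'" "expo0_gt c (y - p')" "(\<lambda>\<zeta>. g' \<zeta> - h' \<zeta>) \<in> O[F](expf c)"
    using expandsE[OF assms(2)] .
  have "(\<lambda>\<zeta>. (g \<zeta> - h \<zeta>) + (g' \<zeta> - h' \<zeta>)) \<in> O[F](expf c)" by (rule sum_in_bigo(1)[OF *(3) **(3)])
  moreover have "expo0_gt c ((x - p) + (y - p'))" by (rule expo0_gt_add[OF *(2) **(2)])
  ultimately show "\<exists>h p. expoly h p \<and> expo0_gt c (x + y - p) \<and> (\<lambda>\<zeta>. g \<zeta> + g' \<zeta> - h \<zeta>) \<in> O[F](expf c)"
    by (intro exI[of _ "\<lambda>\<zeta>. h \<zeta> + h' \<zeta>"] exI[of _ "p + p'"] conjI expoly_add[OF **(1) *(1)])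
       (simp_all add: algebra_simps)
qed

lemma expands_bigo:
  assumes "tame F" "expands F g x" "expo0_gt c x"
  shows "g \<in> O[F](expf c)"
proof -
  obtain h p where *: "expoly h p" "expo0_gt c (x - p)" "(\<lambda>\<zeta>. g \<zeta> - h \<zeta>) \<in> O[F](expf c)"
    using expandsE[OF assms(2)] .
  have "expo0_gt c p" using expo0_gt_diff[OF assms(3) *(2)] by simp
  hence "h \<in> O[F](expf c)" by (rule expoly_bigo[OF assms(1) *(1)])
  from sum_in_bigo(1)[OF *(3) this] show ?thesis by simp
qed

lemma expands_mult:
  assumes "tame F" "expands F g x" "expands F g' y"
  shows "expands F (\<lambda>\<zeta>. g \<zeta> * g' \<zeta>) (x * y)"
proof (rule expandsI[OF assms(1), of 0])
  fix c :: real assume c: "c \<ge> 0"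
  obtain h p where *: "expoly h p" "expo0_gt (c + 1) (x - p)" "(\<lambda>\<zeta>. g \<zeta> - h \<zeta>) \<in> O[F](expf (c + 1))"
    \<comment> \<open>Working with \<open>c + 1\<close> leaves room for the other factor, which is
      only known to be O(e^\<zeta>) because it may contain powers of \<zeta>.\<close>
    using expandsE[OF assms(2)] .
  obtain h' p' where **: "expoly h' p'" "expo0_gt (c + 1) (y - p')" "(\<lambda>\<zeta>. g' \<zeta> - h' \<zeta>) \<in> O[F](expf (c + 1))"
    using expandsE[OF assms(3)] .
  have g: "g \<in> O[F](expf (-1))"
    by (rule expands_bigo[OF assms(1,2)]) (use expands_supp_nonneg[OF assms(2)] in force)
  have h': "h' \<in> O[F](expf (-1))"
    by (rule expoly_bigo[OF assms(1) **(1)]) (use expoly_supp_nonneg[OF **(1)] in force)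
  have E: "(\<lambda>\<zeta>. expf (-1) \<zeta> * expf (c + 1) \<zeta>) = expf c" "(\<lambda>\<zeta>. expf (c + 1) \<zeta> * expf (-1) \<zeta>) = expf c"
    by (simp_all only: expf_mult) simp_all
  have "(\<lambda>\<zeta>. g \<zeta> * (g' \<zeta> - h' \<zeta>) + (g \<zeta> - h \<zeta>) * h' \<zeta>) \<in> O[F](expf c)"
    using landau_o.big.mult[OF g **(3)] landau_o.big.mult[OF *(3) h'] unfolding E
    by (rule sum_in_bigo(1))
  hence 1: "(\<lambda>\<zeta>. g \<zeta> * g' \<zeta> - h \<zeta> * h' \<zeta>) \<in> O[F](expf c)" by (simp add: algebra_simps)
  have "expo0_gt (c + 1) ((y - p') * x + (x - p) * p')"
    using expands_supp_nonneg[OF assms(2)] expoly_supp_nonneg[OF **(1)]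
    by (intro expo0_gt_add expo0_gt_mult *(2) **(2)) blast+
  also have "(y - p') * x + (x - p) * p' = x * y - p * p'" by (simp add: algebra_simps)
  finally have "expo0_gt c (x * y - p * p')" by force
  thus "\<exists>h p. expoly h p \<and> expo0_gt c (x * y - p) \<and> (\<lambda>\<zeta>. g \<zeta> * g' \<zeta> - h \<zeta>) \<in> O[F](expf c)"
    using 1 expoly_mult[OF *(1) **(1)] by (intro exI[of _ "\<lambda>\<zeta>. h \<zeta> * h' \<zeta>"] exI[of _ "p * p'"]) blast
qed

lemma expands_const_mult:
  "tame F \<Longrightarrow> expands F g x \<Longrightarrow> expands F (\<lambda>\<zeta>. c * g \<zeta>) (tconst c * x)"
  by (rule expands_mult[OF _ expands_expoly[OF expoly_const]])

lemma expands_power: "tame F \<Longrightarrow> expands F g x \<Longrightarrow> expands F (\<lambda>\<zeta>. g \<zeta> ^ k) (x ^ k)"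
  by (induction k) (use expands_expoly[OF expoly_const[of 1]] in \<open>auto intro: expands_mult\<close>)

lemma expands_sum:
  "(\<And>i. i \<in> A \<Longrightarrow> expands F (g i) (x i)) \<Longrightarrow> expands F (\<lambda>\<zeta>. \<Sum>i\<in>A. g i \<zeta>) (\<Sum>i\<in>A. x i)"
  by (induction A rule: infinite_finite_induct)
     (auto intro: expands_add expands_expoly expoly_0)

text \<open>Approximants that are precise beyond the exponent of \<open>m\<close> differ by an
  exponential polynomial too small to contain \<open>m\<close>. Any nontrivial tame filter will do,
  in particular one along the real axis.\<close>

lemma expands_unique:
  assumes "tame F" "F \<noteq> bot" "expands F g x" "expands F g y"
  shows "x = y"
proof (rule transseries_eqI, rule ccontr)
  fix m assume neq: "tcoeff x m \<noteq> tcoeff y m"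
  define c where "c = expo m 0 + 1"
  obtain h p where *: "expoly h p" "expo0_gt c (x - p)" "(\<lambda>\<zeta>. g \<zeta> - h \<zeta>) \<in> O[F](expf c)"
    using expandsE[OF assms(3)] .
  obtain h' p' where **: "expoly h' p'" "expo0_gt c (y - p')" "(\<lambda>\<zeta>. g \<zeta> - h' \<zeta>) \<in> O[F](expf c)"
    using expandsE[OF assms(4)] .
  have "(\<lambda>\<zeta>. (g \<zeta> - h' \<zeta>) - (g \<zeta> - h \<zeta>)) \<in> O[F](expf c)" by (rule sum_in_bigo(2)[OF **(3) *(3)])
  hence "(\<lambda>\<zeta>. h \<zeta> - h' \<zeta>) \<in> O[F](expf c)" by simp
  from expoly_bigo_imp[OF assms(1,2) expoly_diff[OF *(1) **(1)] this, of m]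
  have "tcoeff p m = tcoeff p' m" by (auto simp: c_def)
  moreover have "tcoeff x m = tcoeff p m" using *(2) by (force simp: c_def)
  moreover have "tcoeff y m = tcoeff p' m" using **(2) by (force simp: c_def)
  ultimately show False using neq by simp
qed

lemma expands_tendsto_0_imp:
  assumes "tame F" "F \<noteq> bot" "expands F g x" "(g \<longlongrightarrow> 0) F"
  shows "expo0_gt 0 x"
proof
  fix m assume m: "m \<in> tsupp x"
  obtain h p where *: "expoly h p" "expo0_gt 1 (x - p)" "(\<lambda>\<zeta>. g \<zeta> - h \<zeta>) \<in> O[F](expf 1)"
    using expandsE[OF assms(3)] .
  have "(\<lambda>\<zeta>. g \<zeta> - h \<zeta>) \<in> o[F](expf 0)"
    by (rule landau_o.big_small_trans[OF *(3) expf_smallo[OF assms(1)]]) simp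
  hence "((\<lambda>\<zeta>. g \<zeta> - h \<zeta>) \<longlongrightarrow> 0) F" by (auto dest: smalloD_tendsto)
  from tendsto_diff[OF assms(4) this] have "(h \<longlongrightarrow> 0) F" by simp
  note pos = expoly_tendsto_0_imp[OF assms(1,2) *(1) this]
  show "expo m 0 > 0"
  proof (cases "m \<in> tsupp p")
    case False
    hence "m \<in> tsupp (x - p)" using m by simp
    thus ?thesis using *(2) by fastforce
  qed (rule pos)
qed

text \<open>Only finitely many exponents are at most 1, so positive exponents stay away from 0; half
  of their minimum makes the inequality strict. The gap supplies the exponential rate
  \<open>b\<close> of the hyperbolic map.\<close>

lemma expands_gap:
  assumes "expands F g x" "expo0_gt 0 x"
  shows "\<exists>b>0. expo0_gt b x"
proof -
  let ?A = "insert 1 ((\<lambda>m. expo m 0) ` {m \<in> tsupp x. expo m 0 \<le> 1})"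
  have fin: "finite ?A" using expands_finite[OF assms(1)] by blast
  have pos: "\<forall>y\<in>?A. y > 0" using assms(2) by auto
  have "Min ?A \<in> ?A" by (rule Min_in[OF fin]) auto
  hence b: "Min ?A > 0" using pos by blast
  have "expo m 0 > Min ?A / 2" if m: "m \<in> tsupp x" for m
  proof (cases "expo m 0 \<le> 1")
    case True
    hence "Min ?A \<le> expo m 0" using m fin by (intro Min_le) auto
    thus ?thesis using b by linarith
  next
    case False
    have "Min ?A \<le> 1" using fin by (intro Min_le) auto
    thus ?thesis using False by linarith
  qed
  thus ?thesis using b by (intro exI[of _ "Min ?A / 2"]) auto
qed

subsection \<open>Expansion of a composition\<close>

text \<open>The map moves points to the right, which can only improve a nonnegative decay
  rate.\<close>

lemma bigo_compose_self:
  assumes "r \<in> O[F](expf c)" "filterlim f F F" "eventually (\<lambda>\<zeta>. Re (f \<zeta>) \<ge> Re \<zeta>) F" "c \<ge> 0"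
  shows "(\<lambda>\<zeta>. r (f \<zeta>)) \<in> O[F](expf c)"
proof -
  have "r \<in> O[filtermap f F](expf c)"
    by (rule landau_o.big.filter_mono[OF _ assms(1)]) (use assms(2) in \<open>simp add: filterlim_def\<close>)
  hence "(\<lambda>\<zeta>. r (f \<zeta>)) \<in> O[F](\<lambda>\<zeta>. expf c (f \<zeta>))" by (simp add: landau_o.big.in_filtermap_iff)
  also have "(\<lambda>\<zeta>. expf c (f \<zeta>)) \<in> O[F](expf c)"
  proof (rule bigoI[where c = 1])
    show "\<forall>\<^sub>F \<zeta> in F. norm (expf c (f \<zeta>)) \<le> 1 * norm (expf c \<zeta>)"
      using assms(3) by eventually_elim (use assms(4) in \<open>simp add: mult_left_mono\<close>)
  qed
  finally show ?thesis .
qed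

text \<open>Taylor's formula on the segment from a \<zeta> to f(\<zeta>), which eventually stays in
  the right half-plane, where the derivatives grow polynomially. This polynomial factor costs the 1
  that is subtracted in the exponent.\<close>

lemma expoly_taylor:
  assumes tame: "tame F" and h: "expoly h p" and a: "a \<ge> 1" and b: "b > 0"
    and \<rho>: "\<rho> \<in> O[F](expf b)"
    and f: "\<And>\<zeta>. f \<zeta> = of_real a * \<zeta> + \<rho> \<zeta>" "eventually (\<lambda>\<zeta>. Re (f \<zeta>) \<ge> Re \<zeta>) F"
  shows "(\<lambda>\<zeta>. h (f \<zeta>) - (\<Sum>k\<le>K. (deriv ^^ k) h (of_real a * \<zeta>) * \<rho> \<zeta> ^ k / fact k))
           \<in> O[F](expf ((of_nat K + 1) * b - 1))"
proof -
  obtain M J where MJ: "M \<ge> 0" "\<And>w. Re w \<ge> 0 \<Longrightarrow> norm ((deriv ^^ Suc K) h w) \<le> M * (1 + norm w) ^ J"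
    using expoly_growth[OF expoly_higher_deriv[OF h, of "Suc K"]] by blast
  have \<rho>0: "eventually (\<lambda>\<zeta>. norm (\<rho> \<zeta>) \<le> 1) F"
  proof -
    have "\<rho> \<in> o[F](expf 0)"
      by (rule landau_o.big_small_trans[OF \<rho> expf_smallo[OF tame b]])
    from landau_o.smallD[OF this, of 1] show ?thesis by simp
  qed
  \<comment> \<open>On the segment \<open>norm w \<le> a * norm \<zeta> + 1\<close>, so
    \<open>2 + a * norm \<zeta>\<close> bounds \<open>1 + norm w\<close>.\<close>
  define B where "B \<zeta> = M * (2 + a * norm \<zeta>) ^ J" for \<zeta> :: complex
  have "eventually (\<lambda>\<zeta>. norm (h (f \<zeta>) - (\<Sum>k\<le>K. (deriv ^^ k) h (of_real a * \<zeta>) * \<rho> \<zeta> ^ k / fact k))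
      \<le> 1 / fact K * norm (of_real (B \<zeta>) * \<rho> \<zeta> ^ Suc K)) F"
    using \<rho>0 f(2) tame_Re_ge[OF tame, of 0]
  proof eventually_elim
    case (elim \<zeta>)
    let ?S = "closed_segment (of_real a * \<zeta>) (f \<zeta>)"
    have bound: "norm ((deriv ^^ Suc K) h w) \<le> B \<zeta>" if w: "w \<in> ?S" for w
    proof -
      have "?S \<subseteq> {w. Re w \<ge> 0} \<inter> cball (of_real a * \<zeta>) 1"
        by (rule closed_segment_subset)
           (use elim a f(1) in \<open>auto simp: convex_halfspace_Re_ge dist_norm intro!: convex_Int\<close>)
      hence w': "Re w \<ge> 0" "norm (of_real a * \<zeta> - w) \<le> 1" using w by (auto simp: dist_norm)
      have "norm w \<le> norm (of_real a * \<zeta>) + norm (w - of_real a * \<zeta>)" by norm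
      also have "\<dots> \<le> a * norm \<zeta> + 1" using w'(2) a by (simp add: norm_mult norm_minus_commute)
      finally have "(1 + norm w) ^ J \<le> (2 + a * norm \<zeta>) ^ J" by (intro power_mono) auto
      thus ?thesis using MJ(2)[OF w'(1)] MJ(1) unfolding B_def by (meson mult_left_mono order_trans)
    qed
    have "norm ((deriv ^^ 0) h (f \<zeta>) - (\<Sum>k\<le>K. (deriv ^^ k) h (of_real a * \<zeta>) * (f \<zeta> - of_real a * \<zeta>) ^ k / fact k))
          \<le> B \<zeta> * norm (f \<zeta> - of_real a * \<zeta>) ^ Suc K / fact K"
    proof (rule complex_Taylor[where S = ?S and f = "\<lambda>k. (deriv ^^ k) h"])
      show "((deriv ^^ i) h has_field_derivative (deriv ^^ Suc i) h x) (at x within ?S)" for i x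
        using expoly_deriv(1)[OF expoly_higher_deriv[OF h, of i], of x]
        by (simp add: has_field_derivative_at_within)
    qed (use bound in auto)
    moreover have "B \<zeta> \<ge> 0" using MJ(1) a by (simp add: B_def)
    ultimately show ?case by (simp add: f(1) norm_mult norm_power abs_mult)
  qed
  hence "(\<lambda>\<zeta>. h (f \<zeta>) - (\<Sum>k\<le>K. (deriv ^^ k) h (of_real a * \<zeta>) * \<rho> \<zeta> ^ k / fact k))
           \<in> O[F](\<lambda>\<zeta>. of_real (B \<zeta>) * \<rho> \<zeta> ^ Suc K)" by (rule bigoI)
  also have "(\<lambda>\<zeta>. of_real (B \<zeta>) * \<rho> \<zeta> ^ Suc K) \<in> O[F](\<lambda>\<zeta>. expf (-1) \<zeta> * expf b \<zeta> ^ Suc K)"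
  proof (intro landau_o.big.mult landau_o.big_power \<rho>)
    have "(\<lambda>\<zeta>. complex_of_real (2 + a * norm \<zeta>)) \<in> O[F](\<lambda>\<zeta>. \<zeta>)"
    proof (rule bigoI[where c = "2 + a"])
      show "\<forall>\<^sub>F \<zeta> in F. norm (complex_of_real (2 + a * norm \<zeta>)) \<le> (2 + a) * norm \<zeta>"
        using tame_norm_ge[OF tame, of 1]
      proof eventually_elim
        case (elim \<zeta>)
        have "norm (complex_of_real (2 + a * norm \<zeta>)) = 2 + a * norm \<zeta>"
          using a by (simp only: norm_of_real) simp
        thus ?case using elim by (simp add: ring_distribs)
      qed
    qed
    hence "(\<lambda>\<zeta>. complex_of_real M * complex_of_real (2 + a * norm \<zeta>) ^ J) \<in> O[F](\<lambda>\<zeta>. 1 * expf (-1) \<zeta>)"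
      by (intro landau_o.big.mult power_bigo_expf[OF tame]) auto
    thus "(\<lambda>\<zeta>. complex_of_real (B \<zeta>)) \<in> O[F](expf (-1))" by (simp add: B_def)
  qed
  also have "(\<lambda>\<zeta>. expf (-1) \<zeta> * expf b \<zeta> ^ Suc K) = expf ((of_nat K + 1) * b - 1)"
    by (simp only: exp_of_nat_mult[symmetric] exp_add[symmetric]) (simp add: algebra_simps)
  finally show ?thesis .
qed

text \<open>Three errors are controlled on both sides: \<open>g\<close> is replaced by an
  exponential polynomial \<open>h\<close>, the Taylor series of \<open>h\<close> is cut at degree
  \<open>K\<close>, and the powers of \<rho> in it are replaced by approximants. Because
  \<open>a \<ge> 1\<close>, composition does not lower the order of the first error.\<close>

lemma expands_compose:
  assumes tame: "tame F" and a: "a \<ge> 1" and b: "b > 0" and \<eta>: "expands F \<rho> \<eta>" "expo0_gt b \<eta>"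
    and f: "\<And>\<zeta>. f \<zeta> = of_real a * \<zeta> + \<rho> \<zeta>" "eventually (\<lambda>\<zeta>. Re (f \<zeta>) \<ge> Re \<zeta>) F" "filterlim f F F"
    and g: "expands F g x"
  shows "expands F (\<lambda>\<zeta>. g (f \<zeta>)) (tsum (tcomp_term a \<eta> x))"
proof (rule expandsI[OF tame, of 0])
  fix c :: real assume c: "c \<ge> 0"
  have a0: "a > 0" using a by simp
  have inf: "infinitesimal \<eta>" using infinitesimal_expo0[OF \<eta>(2)] b by simp
  obtain h p where h: "expoly h p" "expo0_gt c (x - p)" "(\<lambda>\<zeta>. g \<zeta> - h \<zeta>) \<in> O[F](expf c)"
    using expandsE[OF g] .
  let ?T = "\<lambda>x. tsum (tcomp_term a \<eta> x)"
  \<comment> \<open>This \<open>K\<close> puts the analytic remainder, of rate (K + 1) b - 1, as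
    well as the formal Taylor terms with \<open>k > K\<close>, of order at least k b in z, beyond
    \<open>c\<close>.\<close>
  obtain K :: nat where "of_nat K > (c + 1) / b" using reals_Archimedean2 by blast
  hence K: "(of_nat K + 1) * b - 1 \<ge> c" "of_nat K * b > c"
    using b by (auto simp: field_simps)
  have \<rho>: "\<rho> \<in> O[F](expf b)" by (rule expands_bigo[OF tame \<eta>])
  let ?h1 = "\<lambda>\<zeta>. \<Sum>k\<le>K. (1 / fact k) * (deriv ^^ k) h (of_real a * \<zeta>) * \<rho> \<zeta> ^ k"
  let ?p1 = "\<Sum>k\<le>K. tcomp_term a \<eta> p k"
  have "expands F ?h1 ?p1" unfolding tcomp_term_def
    by (intro expands_sum expands_mult[OF tame] expands_power[OF tame] \<eta>(1) expands_expoly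
        expoly_mult expoly_const expoly_scale expoly_higher_deriv h(1) a0)
  then obtain h2 p2 where h2: "expoly h2 p2" "expo0_gt c (?p1 - p2)" "(\<lambda>\<zeta>. ?h1 \<zeta> - h2 \<zeta>) \<in> O[F](expf c)"
    by (rule expandsE)
  have "(\<lambda>\<zeta>. h (f \<zeta>) - ?h1 \<zeta>) \<in> O[F](expf c)"
    using landau_o.big_trans[OF expoly_taylor[OF tame h(1) a b \<rho> f(1,2), of K] expf_bigo[OF tame K(1)]]
    by (simp add: mult_ac)
  from sum_in_bigo(1)[OF this h2(3)] have "(\<lambda>\<zeta>. h (f \<zeta>) - h2 \<zeta>) \<in> O[F](expf c)" by simp
  from sum_in_bigo(1)[OF bigo_compose_self[OF h(3) f(3,2) c] this]
  have 1: "(\<lambda>\<zeta>. g (f \<zeta>) - h2 \<zeta>) \<in> O[F](expf c)" by simp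
  let ?R = "\<lambda>k. if k \<in> {..K} then 0 else tcomp_term a \<eta> p k"
  note split = tsummable_split[OF tsummable_tcomp[OF a0 inf, of p] finite_atMost[of K]]
  have R: "expo0_gt c (tsum ?R)"
  proof
    fix m assume "m \<in> tsupp (tsum ?R)"
    then obtain k where "m \<in> tsupp (?R k)" using tsupp_tsum[OF split(1)] by blast
    hence k: "k > K" "m \<in> tsupp (tcomp_term a \<eta> p k)" by (auto split: if_splits)
    obtain L where L: "keys_below L p" using ex_keys_below by blast
    obtain m' n e where *: "m = hmon a m' + n + e" "m' \<in> tsupp p" "n \<in> natmon L" "e \<in> nsums (tsupp \<eta>) k"
      using tsupp_tcomp_term[OF L a0 k(2)] by blast
    have "of_nat k * b \<le> expo e 0" by (rule nsums_expo_ge[OF _ *(4)]) (use \<eta>(2) in force)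
    moreover have "of_nat K * b \<le> of_nat k * b" using k(1) b by simp
    moreover have "a * expo m' 0 \<ge> 0" using expoly_supp_nonneg[OF h(1) *(2)] a0 by simp
    ultimately show "expo m 0 > c" using K(2) natmon_expo_0[OF *(3)]
      by (simp add: *(1) lookup_add expo_hmon)
  qed
  have "a * c \<ge> c" using a c mult_right_mono[of 1 a c] by simp
  hence "expo0_gt c (?T (x - p))" using tsum_tcomp_expo_0_gt[OF a0 inf h(2)] by force
  from expo0_gt_add[OF expo0_gt_add[OF this R] h2(2)]
  have "expo0_gt c (?T (x - p) + tsum ?R + (?p1 - p2))" .
  also have "?T (x - p) + tsum ?R + (?p1 - p2) = ?T x - p2"
    using split(2) by (simp add: tsum_tcomp_diff[OF a0 inf])
  finally show "\<exists>h p. expoly h p \<and> expo0_gt c (?T x - p) \<and> (\<lambda>\<zeta>. g (f \<zeta>) - h \<zeta>) \<in> O[F](expf c)"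
    using 1 h2(1) by blast
qed

subsection \<open>Expansions in the sense of Dulac series\<close>

text \<open>Below any element there are only finitely many others, so a nonempty subset has a least
  element.\<close>

lemma log_support_dmon:
  assumes "\<And>m. m \<in> S \<Longrightarrow> \<exists>\<beta> j. m = dmon \<beta> j" "\<And>c. finite {m \<in> S. expo m 0 \<le> c}"
  shows "log_support S"
  unfolding log_support_def
proof (intro conjI)
  show "wfp_on S (<)" unfolding wfp_on_iff_ex_minimal
  proof (intro allI impI)
    fix B assume B: "B \<subseteq> S" "B \<noteq> {}"
    then obtain x where x: "x \<in> B" by blast
    let ?C = "{y \<in> B. y \<le> x}"
    have "?C \<subseteq> {m \<in> S. expo m 0 \<le> expo x 0}" using B(1) expo0_mono by blast
    hence fin: "finite ?C" using assms(2) finite_subset by blast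
    have ne: "?C \<noteq> {}" using x by blast
    have "Min ?C \<in> ?C" by (rule Min_in[OF fin ne])
    hence min: "Min ?C \<in> B" "Min ?C \<le> x" by auto
    have "y \<notin> B" if "y < Min ?C" for y
    proof
      assume "y \<in> B"
      hence "y \<in> ?C" using that min(2) by auto
      from Min_le[OF fin this] show False using that by simp
    qed
    thus "\<exists>z\<in>B. \<forall>y. y < z \<longrightarrow> y \<notin> B" using min(1) by blast
  qed
  show "\<forall>m\<in>S. \<forall>j\<ge>1. expo m j \<in> \<int>"
  proof
    fix m assume "m \<in> S"
    then obtain \<beta> j where "m = dmon \<beta> j" using assms(1) by blast
    thus "\<forall>j\<ge>1. expo m j \<in> \<int>" using int_mono_dmon[of \<beta> j] by (simp add: int_mono_def)
  qed
  have "Poly_Mapping.keys (dmon \<beta> j) \<subseteq> {..1}" for \<beta> j using keys_dmon[of \<beta> j] by auto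
  thus "\<exists>k. \<forall>m\<in>S. Poly_Mapping.keys m \<subseteq> {..k}" using assms(1) by blast
qed

definition dulac_term :: "(nat \<Rightarrow> real) \<Rightarrow> (nat \<Rightarrow> complex poly) \<Rightarrow> nat \<Rightarrow> transseries" where
  "dulac_term b Q i = (\<Sum>j\<le>degree (Q i). tmono (coeff (Q i) j) (dmon (b i) j))"

lemma dulac_series_eq: "dulac_series b Q = tsum (dulac_term b Q)"
  by (simp add: dulac_series_def dulac_term_def[abs_def] dmon_def)

lemma tcoeff_dulac_term:
  "tcoeff (dulac_term b Q i) (dmon \<beta> j) = (if \<beta> = b i then coeff (Q i) j else 0)"
proof -
  have "tcoeff (dulac_term b Q i) (dmon \<beta> j) =
      (\<Sum>l\<le>degree (Q i). if l = j then (if \<beta> = b i then coeff (Q i) j else 0) else 0)"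
    unfolding dulac_term_def tcoeff_sum by (rule sum.cong) (auto simp: tcoeff_tmono)
  thus ?thesis by (auto simp: coeff_eq_0)
qed

lemma dulac_term_supp:
  assumes "m \<in> tsupp (dulac_term b Q i)"
  shows "\<exists>j. m = dmon (b i) j"
proof -
  have "(\<Sum>j\<le>degree (Q i). tcoeff (tmono (coeff (Q i) j) (dmon (b i) j)) m) \<noteq> 0"
    using assms by (simp add: dulac_term_def tcoeff_sum)
  then obtain j where "tcoeff (tmono (coeff (Q i) j) (dmon (b i) j)) m \<noteq> 0"
    using sum.not_neutral_contains_not_neutral by blast
  hence "m = dmon (b i) j" by (simp add: tcoeff_tmono split: if_splits)
  thus ?thesis ..
qed

lemma expoly_dulac_term:
  assumes "b i \<ge> 0"
  shows "expoly (\<lambda>\<zeta>. exp (- of_real (b i) * \<zeta>) * poly (Q i) \<zeta>) (dulac_term b Q i)"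
proof -
  have "expoly (\<lambda>\<zeta>. \<Sum>j\<le>degree (Q i). coeff (Q i) j * exp (- of_real (b i) * \<zeta>) * \<zeta> ^ j) (dulac_term b Q i)"
    unfolding dulac_term_def by (intro expoly_sum expoly_mono assms)
  thus ?thesis by (simp add: poly_altdef sum_distrib_left mult_ac)
qed

lemma finite_b_le:
  assumes "strict_mono b" "filterlim b at_top sequentially"
  shows "finite {i :: nat. b i \<le> (c :: real)}"
proof -
  have "eventually (\<lambda>i. b i \<ge> c + 1) sequentially" using assms(2) by (simp add: filterlim_at_top)
  then obtain N where N: "\<forall>n\<ge>N. b n \<ge> c + 1" by (auto simp: eventually_sequentially)
  have "{i. b i \<le> c} \<subseteq> {..N}"
  proof
    fix i assume "i \<in> {i. b i \<le> c}"
    thus "i \<in> {..N}" using N[rule_format, of i] by (cases "i \<le> N") auto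
  qed
  thus ?thesis using finite_subset by blast
qed

lemma tsummable_dulac:
  assumes "strict_mono b" "filterlim b at_top sequentially"
  shows "tsummable (dulac_term b Q)"
  unfolding tsummable_def
proof (intro conjI allI)
  fix m
  have "{i. tcoeff (dulac_term b Q i) m \<noteq> 0} \<subseteq> {i. b i \<le> expo m 0}"
  proof
    fix i assume "i \<in> {i. tcoeff (dulac_term b Q i) m \<noteq> 0}"
    then obtain j where "m = dmon (b i) j" using dulac_term_supp[of m b Q i] by auto
    thus "i \<in> {i. b i \<le> expo m 0}" by (simp add: expo_dmon)
  qed
  thus "finite {i. tcoeff (dulac_term b Q i) m \<noteq> 0}" using finite_b_le[OF assms] finite_subset by blast
next
  show "log_support (\<Union>i. tsupp (dulac_term b Q i))"
  proof (rule log_support_dmon)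
    fix m assume "m \<in> (\<Union>i. tsupp (dulac_term b Q i))"
    thus "\<exists>\<beta> j. m = dmon \<beta> j" using dulac_term_supp by blast
  next
    fix c
    let ?X = "\<Union>i\<in>{i. b i \<le> c}. (\<lambda>j. dmon (b i) j) ` {..degree (Q i)}"
    have "{m \<in> \<Union>i. tsupp (dulac_term b Q i). expo m 0 \<le> c} \<subseteq> ?X"
    proof
      fix m assume m: "m \<in> {m \<in> \<Union>i. tsupp (dulac_term b Q i). expo m 0 \<le> c}"
      then obtain i where i: "m \<in> tsupp (dulac_term b Q i)" "expo m 0 \<le> c" by blast
      then obtain j where j: "m = dmon (b i) j" using dulac_term_supp by blast
      have "b i \<le> c" using i(2) j by (simp add: expo_dmon)
      moreover have "coeff (Q i) j \<noteq> 0" using i(1) j by (simp add: tcoeff_dulac_term)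
      hence "j \<le> degree (Q i)" by (rule le_degree)
      ultimately show "m \<in> ?X" using j by blast
    qed
    moreover have "finite ?X" using finite_b_le[OF assms] by blast
    ultimately show "finite {m \<in> \<Union>i. tsupp (dulac_term b Q i). expo m 0 \<le> c}"
      using finite_subset by blast
  qed
qed

lemma dulac_tail:
  assumes "strict_mono b" "filterlim b at_top sequentially" "\<forall>i>n. b i > c"
  shows "expo0_gt c (dulac_series b Q - (\<Sum>i\<le>n. dulac_term b Q i))"
proof -
  let ?R = "\<lambda>i. if i \<in> {..n} then 0 else dulac_term b Q i"
  note split = tsummable_split[OF tsummable_dulac[OF assms(1,2), of Q] finite_atMost[of n]]
  have "expo0_gt c (tsum ?R)"
  proof
    fix m assume "m \<in> tsupp (tsum ?R)"
    then obtain i where "m \<in> tsupp (?R i)" using tsupp_tsum[OF split(1)] by blast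
    hence i: "i > n" "m \<in> tsupp (dulac_term b Q i)" by (auto split: if_splits)
    then obtain j where "m = dmon (b i) j" using dulac_term_supp by blast
    thus "expo m 0 > c" using assms(3) i(1) by (simp add: expo_dmon)
  qed
  thus ?thesis using split(2) by (simp add: dulac_series_eq)
qed

text \<open>Long partial sums serve as approximants. The filter may be finer than that of
  \<open>D\<close>, which permits the restriction to the real axis.\<close>

lemma expands_of_expands_on:
  assumes "expands_on G D x" "F \<le> at_Re_top D" "tame F"
  shows "expands F G x"
proof -
  obtain b Q where bQ: "dulac_data b Q" "x = dulac_series b Q" and
    est: "\<And>c. c > 0 \<Longrightarrow> \<exists>N. \<forall>n\<ge>N. (\<lambda>\<zeta>. G \<zeta> - (\<Sum>i\<le>n. exp (- of_real (b i) * \<zeta>) * poly (Q i) \<zeta>))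
             \<in> o[at_Re_top D](\<lambda>\<zeta>. exp (- of_real c * \<zeta>))"
    using assms(1) unfolding expands_on_def by blast
  have b: "b 0 = 0" "strict_mono b" "filterlim b at_top sequentially"
    using bQ(1) by (auto simp: dulac_data_def)
  have b0: "b i \<ge> 0" for i using strict_mono_leD[OF b(2), of 0 i] b(1) by simp
  show ?thesis
  proof (rule expandsI[OF assms(3), of 1])
    fix c :: real assume "c \<ge> 1"
    then obtain N where N: "\<And>n. n \<ge> N \<Longrightarrow> (\<lambda>\<zeta>. G \<zeta> - (\<Sum>i\<le>n. exp (- of_real (b i) * \<zeta>) * poly (Q i) \<zeta>))
             \<in> o[at_Re_top D](\<lambda>\<zeta>. exp (- of_real c * \<zeta>))" using est[of c] by auto
    have "eventually (\<lambda>i. b i \<ge> c + 1) sequentially" using b(3) by (simp add: filterlim_at_top)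
    then obtain N' where N': "\<And>n. n \<ge> N' \<Longrightarrow> b n \<ge> c + 1" by (auto simp: eventually_sequentially)
    define n where "n = max N N'"
    have "expoly (\<lambda>\<zeta>. \<Sum>i\<le>n. exp (- of_real (b i) * \<zeta>) * poly (Q i) \<zeta>) (\<Sum>i\<le>n. dulac_term b Q i)"
      by (intro expoly_sum expoly_dulac_term b0)
    moreover have "expo0_gt c (x - (\<Sum>i\<le>n. dulac_term b Q i))"
    proof -
      have "b i > c" if "i > n" for i using N'[of i] that by (simp add: n_def)
      thus ?thesis unfolding bQ(2) by (intro dulac_tail b) blast
    qed
    moreover have "(\<lambda>\<zeta>. G \<zeta> - (\<Sum>i\<le>n. exp (- of_real (b i) * \<zeta>) * poly (Q i) \<zeta>)) \<in> O[F](expf c)"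
      using landau_o.big.filter_mono[OF assms(2) landau_o.small_imp_big[OF N[of n]]]
      by (simp add: n_def)
    ultimately show "\<exists>h p. expoly h p \<and> expo0_gt c (x - p) \<and> (\<lambda>\<zeta>. G \<zeta> - h \<zeta>) \<in> O[F](expf c)"
      by blast
  qed
qed

lemma enumerate_exponents:
  fixes G :: "real set"
  assumes "\<And>g. g \<in> G \<Longrightarrow> g \<ge> 0" "\<And>c. finite {g \<in> G. g \<le> c}"
  shows "\<exists>b. b 0 = 0 \<and> strict_mono b \<and> filterlim b at_top sequentially \<and> G \<subseteq> range (b :: nat \<Rightarrow> real)"
proof -
  \<comment> \<open>Adjoining the natural numbers supplies the initial exponent 0 and, even for
    finite \<open>G\<close>, a next exponent at distance at most 1. An exponent that does not occur
    in the series later receives the polynomial 0.\<close>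
  define \<Gamma> where "\<Gamma> = G \<union> range real"
  have fin: "finite {g \<in> \<Gamma>. g \<le> c}" for c
  proof -
    have "{g \<in> \<Gamma>. g \<le> c} \<subseteq> {g \<in> G. g \<le> c} \<union> real ` {..nat \<lceil>c\<rceil>}"
    proof
      fix g assume g: "g \<in> {g \<in> \<Gamma>. g \<le> c}"
      show "g \<in> {g \<in> G. g \<le> c} \<union> real ` {..nat \<lceil>c\<rceil>}"
      proof (cases "g \<in> G")
        case False
        then obtain n where n: "g = real n" using g by (auto simp: \<Gamma>_def)
        hence "n \<le> nat \<lceil>c\<rceil>" using g by simp linarith
        thus ?thesis using n by blast
      qed (use g in auto)
    qed
    thus ?thesis using assms(2)[of c] finite_subset by blast
  qed
  define nxt where "nxt x = Min {y \<in> \<Gamma>. x < y \<and> y \<le> x + 1}" for x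
  have nxt: "nxt x \<in> \<Gamma> \<and> x < nxt x \<and> nxt x \<le> x + 1" if "x \<ge> 0" for x
  proof -
    have fin': "finite {y \<in> \<Gamma>. x < y \<and> y \<le> x + 1}" by (rule finite_subset[OF _ fin[of "x + 1"]]) auto
    have "real (nat \<lfloor>x\<rfloor> + 1) \<in> \<Gamma>" unfolding \<Gamma>_def by blast
    moreover have "x < real (nat \<lfloor>x\<rfloor> + 1)" "real (nat \<lfloor>x\<rfloor> + 1) \<le> x + 1" using that by linarith+
    ultimately have "real (nat \<lfloor>x\<rfloor> + 1) \<in> {y \<in> \<Gamma>. x < y \<and> y \<le> x + 1}" by blast
    hence "{y \<in> \<Gamma>. x < y \<and> y \<le> x + 1} \<noteq> {}" by blast
    from Min_in[OF fin' this] show ?thesis by (simp add: nxt_def)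
  qed
  have nxt_le: "nxt x \<le> y" if "y \<in> \<Gamma>" "x < y" "y \<le> nxt x" "x \<ge> 0" for x y
  proof -
    have fin': "finite {y \<in> \<Gamma>. x < y \<and> y \<le> x + 1}" by (rule finite_subset[OF _ fin[of "x + 1"]]) auto
    have "y \<le> x + 1" using that(3) nxt[OF that(4)] by linarith
    thus ?thesis unfolding nxt_def using that by (intro Min_le[OF fin']) auto
  qed
  define b where "b = rec_nat 0 (\<lambda>_. nxt)"
  have bS: "b (Suc n) = nxt (b n)" and b0: "b 0 = 0" for n by (simp_all add: b_def)
  have bge: "b n \<ge> 0" for n
  proof (induction n)
    case (Suc n)
    thus ?case using nxt[OF Suc] by (simp add: bS)
  qed (simp add: b0)
  have mono: "strict_mono b" using nxt[OF bge] by (simp add: strict_mono_Suc_iff bS)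
  have bG: "b n \<in> \<Gamma>" for n
  proof (cases n)
    case 0
    have "real 0 \<in> \<Gamma>" unfolding \<Gamma>_def by blast
    thus ?thesis using 0 by (simp add: b0)
  next
    case (Suc k)
    thus ?thesis using nxt[OF bge[of k]] by (simp add: bS)
  qed
  have unb: "\<exists>n. b n > c" for c
  proof (rule ccontr)
    assume "\<not> ?thesis"
    hence "range b \<subseteq> {g \<in> \<Gamma>. g \<le> c}" using bG by (auto simp: not_less)
    hence "finite (range b)" using fin finite_subset by blast
    thus False using strict_mono_imp_inj_on[OF mono] finite_imageD by blast
  qed
  have lim: "filterlim b at_top sequentially"
    unfolding filterlim_at_top
  proof
    fix Z
    obtain n where n: "b n > Z" using unb by blast
    have "b k \<ge> Z" if "k \<ge> n" for k using strict_mono_leD[OF mono that] n by simp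
    thus "\<forall>\<^sub>F x in sequentially. Z \<le> b x" by (auto simp: eventually_sequentially)
  qed
  have "g \<in> range b" if g: "g \<in> G" for g
  proof -
    define n where "n = (LEAST n. b n \<ge> g)"
    have "\<exists>n. b n \<ge> g" using unb[of g] less_imp_le by blast
    hence n: "b n \<ge> g" unfolding n_def by (rule LeastI_ex)
    have "b n = g"
    proof (cases n)
      case 0
      thus ?thesis using n assms(1)[OF g] by (simp add: b0)
    next
      case (Suc k)
      have "\<not> b k \<ge> g" using not_less_Least[of k "\<lambda>n. b n \<ge> g"] Suc by (simp add: n_def)
      hence "nxt (b k) \<le> g" using n Suc g by (intro nxt_le bge) (auto simp: \<Gamma>_def bS)
      thus ?thesis using n Suc by (simp add: bS)
    qed
    thus ?thesis by blast
  qed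
  thus ?thesis using b0 mono lim by blast
qed

text \<open>The polynomials are read off the coefficients of \<open>x\<close>. Any long partial sum
  differs from an approximant only by terms of order beyond \<open>c + 1\<close>, so the estimate
  holds for all of them. The condition on \<open>x\<close> makes the leading polynomial equal to
  \<zeta>, as \<open>dulac_data\<close> requires with \<alpha> = 1 and \<beta> = 0.\<close>

lemma expands_on_of_expands:
  assumes tame: "tame (at_Re_top D)" and ex: "expands (at_Re_top D) G x"
    and x0: "expo0_gt 0 (x - tmono 1 (dmon 0 1))"
  shows "expands_on G D x"
proof -
  let ?F = "at_Re_top D"
  define \<Gamma> where "\<Gamma> = (\<lambda>m. expo m 0) ` tsupp x"
  have "\<exists>b. b 0 = 0 \<and> strict_mono b \<and> filterlim b at_top sequentially \<and> \<Gamma> \<subseteq> range (b :: nat \<Rightarrow> real)"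
  proof (rule enumerate_exponents)
    show "g \<ge> 0" if "g \<in> \<Gamma>" for g using that expands_supp_nonneg[OF ex] by (auto simp: \<Gamma>_def)
    show "finite {g \<in> \<Gamma>. g \<le> c}" for c
    proof -
      have "{g \<in> \<Gamma>. g \<le> c} = (\<lambda>m. expo m 0) ` {m \<in> tsupp x. expo m 0 \<le> c}" by (auto simp: \<Gamma>_def)
      thus ?thesis using expands_finite[OF ex, of c] by simp
    qed
  qed
  then obtain b :: "nat \<Rightarrow> real" where b: "b 0 = 0" "strict_mono b" "filterlim b at_top sequentially" "\<Gamma> \<subseteq> range b"
    by blast
  have b0: "b i \<ge> 0" for i using strict_mono_leD[OF b(2), of 0 i] b(1) by simp
  define J where "J i = {j. tcoeff x (dmon (b i) j) \<noteq> 0}" for i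
  have finJ: "finite (J i)" for i
  proof -
    have "dmon (b i) ` J i \<subseteq> {m \<in> tsupp x. expo m 0 \<le> b i}" by (auto simp: J_def expo_dmon)
    hence "finite (dmon (b i) ` J i)" using expands_finite[OF ex] finite_subset by blast
    thus ?thesis by (rule finite_imageD) (auto intro: inj_onI)
  qed
  define Q where "Q i = (\<Sum>j\<in>J i. monom (tcoeff x (dmon (b i) j)) j)" for i
  have coeffQ: "coeff (Q i) j = tcoeff x (dmon (b i) j)" for i j
    unfolding Q_def coeff_sum using finJ[of i] by (auto simp: J_def)
  have x00: "tcoeff x (dmon 0 j) = (if j = 1 then 1 else 0)" for j
  proof (rule ccontr)
    assume "\<not> ?thesis"
    hence "dmon 0 j \<in> tsupp (x - tmono 1 (dmon 0 1))" by (auto simp: tcoeff_tmono)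
    thus False using x0 by (force simp: expo_dmon)
  qed
  have Q0: "Q 0 = [:0, of_real 1:]"
    by (rule poly_eqI) (simp add: coeffQ b(1) x00 coeff_pCons split: nat.split)
  have data: "dulac_data b Q" unfolding dulac_data_def
    using b Q0 by (intro conjI exI[of _ 1] exI[of _ 0]) auto
  have x: "x = dulac_series b Q"
  proof (rule transseries_eqI)
    fix m
    note sm = tsummable_dulac[OF b(2,3), of Q]
    show "tcoeff x m = tcoeff (dulac_series b Q) m"
    proof (cases "\<exists>i j. m = dmon (b i) j")
      case True
      then obtain i j where m: "m = dmon (b i) j" by blast
      have "{k. tcoeff (dulac_term b Q k) m \<noteq> 0} \<subseteq> {i}"
        using strict_mono_eq[OF b(2)] by (auto simp: m tcoeff_dulac_term split: if_splits)
      hence "tcoeff (dulac_series b Q) m = tcoeff (dulac_term b Q i) m"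
        unfolding dulac_series_eq by (subst tcoeff_tsum[OF sm, of "{i}"]) auto
      thus ?thesis by (simp add: m tcoeff_dulac_term coeffQ)
    next
      case False
      have "m \<notin> tsupp x"
      proof
        assume m: "m \<in> tsupp x"
        obtain \<beta> j where \<beta>: "m = dmon \<beta> j" using expands_supp[OF ex m] by blast
        have "\<beta> \<in> \<Gamma>" using m \<beta> by (force simp: \<Gamma>_def expo_dmon)
        then obtain i where "\<beta> = b i" using b(4) by blast
        thus False using False \<beta> by blast
      qed
      moreover have "m \<notin> tsupp (dulac_series b Q)"
      proof
        assume "m \<in> tsupp (dulac_series b Q)"
        then obtain i where "m \<in> tsupp (dulac_term b Q i)"
          using tsupp_tsum[OF sm] unfolding dulac_series_eq by blast
        thus False using dulac_term_supp False by blast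
      qed
      ultimately show ?thesis by simp
    qed
  qed
  have "\<exists>N. \<forall>n\<ge>N. (\<lambda>\<zeta>. G \<zeta> - (\<Sum>i\<le>n. exp (- of_real (b i) * \<zeta>) * poly (Q i) \<zeta>)) \<in> o[?F](expf c)"
    for c :: real
  proof -
    obtain h p where h: "expoly h p" "expo0_gt (c + 1) (x - p)" "(\<lambda>\<zeta>. G \<zeta> - h \<zeta>) \<in> O[?F](expf (c + 1))"
      using expandsE[OF ex] .
    have "eventually (\<lambda>i. b i \<ge> c + 2) sequentially" using b(3) by (simp add: filterlim_at_top)
    then obtain N where N: "\<And>n. n \<ge> N \<Longrightarrow> b n \<ge> c + 2" by (auto simp: eventually_sequentially)
    have "(\<lambda>\<zeta>. G \<zeta> - (\<Sum>i\<le>n. exp (- of_real (b i) * \<zeta>) * poly (Q i) \<zeta>)) \<in> o[?F](expf c)" if n: "n \<ge> N" for n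
    proof -
      let ?h = "\<lambda>\<zeta>. \<Sum>i\<le>n. exp (- of_real (b i) * \<zeta>) * poly (Q i) \<zeta>"
      let ?p = "\<Sum>i\<le>n. dulac_term b Q i"
      have e: "expoly ?h ?p" by (intro expoly_sum expoly_dulac_term b0)
      have "b i > c + 1" if "i > n" for i using N[of i] that n by simp
      hence "expo0_gt (c + 1) (x - ?p)" unfolding x by (intro dulac_tail b) blast
      from expo0_gt_diff[OF this h(2)] have "expo0_gt (c + 1) (p - ?p)" by simp
      from expoly_bigo[OF tame expoly_diff[OF h(1) e] this]
      have "(\<lambda>\<zeta>. h \<zeta> - ?h \<zeta>) \<in> O[?F](expf (c + 1))" .
      from sum_in_bigo(1)[OF h(3) this] have "(\<lambda>\<zeta>. G \<zeta> - ?h \<zeta>) \<in> O[?F](expf (c + 1))" by simp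
      thus ?thesis by (rule landau_o.big_small_trans[OF _ expf_smallo[OF tame]]) simp
    qed
    thus ?thesis by blast
  qed
  thus ?thesis unfolding expands_on_def using data x by blast
qed

subsection \<open>Domains\<close>

text \<open>
  Cofinal with the quadratic domains, but with an inequality as definition, from which the
  invariance under a strongly hyperbolic map can be read off.
\<close>

definition sqrt_domain :: "real \<Rightarrow> complex set" where
  "sqrt_domain K = {\<zeta>. Re \<zeta> > K * sqrt (1 + \<bar>Im \<zeta>\<bar>)}"

lemma sqrt_domain_antimono: "K \<le> K' \<Longrightarrow> sqrt_domain K' \<subseteq> sqrt_domain K"
  unfolding sqrt_domain_def
  by (auto elim!: le_less_trans[rotated] intro!: mult_right_mono)

lemma sqrt_domain_Re:
  assumes "\<zeta> \<in> sqrt_domain K" "K \<ge> 0"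
  shows "Re \<zeta> > K"
proof -
  have "K * 1 \<le> K * sqrt (1 + \<bar>Im \<zeta>\<bar>)" using assms(2) by (intro mult_left_mono) auto
  thus ?thesis using assms(1) by (simp add: sqrt_domain_def)
qed

lemma sqrt_domain_iff:
  assumes "K > 0"
  shows "\<zeta> \<in> sqrt_domain K \<longleftrightarrow> Re \<zeta> > 0 \<and> (Re \<zeta>)\<^sup>2 > K\<^sup>2 * (1 + \<bar>Im \<zeta>\<bar>)"
proof -
  let ?s = "K * sqrt (1 + \<bar>Im \<zeta>\<bar>)"
  have s: "?s > 0" "?s\<^sup>2 = K\<^sup>2 * (1 + \<bar>Im \<zeta>\<bar>)" using assms by (auto simp: power_mult_distrib)
  have "Re \<zeta> > ?s \<longleftrightarrow> Re \<zeta> > 0 \<and> (Re \<zeta>)\<^sup>2 > ?s\<^sup>2"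
    using s(1) power_strict_mono[of ?s "Re \<zeta>" 2] power_less_imp_less_base[of ?s 2 "Re \<zeta>"] by auto
  thus ?thesis by (simp add: sqrt_domain_def s(2))
qed

lemma spiraling_sqrt_domain: "spiraling_domain (sqrt_domain K)"
  unfolding spiraling_domain_def sqrt_domain_def
  by (intro exI[of _ "\<lambda>\<theta>. exp (- (K * sqrt (1 + \<bar>\<theta>\<bar>)))"]) (auto intro!: continuous_intros)

lemma open_sqrt_domain: "open (sqrt_domain K)"
  unfolding sqrt_domain_def by (intro open_Collect_less continuous_intros)

lemma connected_sqrt_domain:
  assumes "K \<ge> 0"
  shows "connected (sqrt_domain K)"
proof -
  have "sqrt_domain K = (\<lambda>(s, y). Complex (s + K * sqrt (1 + \<bar>y\<bar>)) y) ` ({0<..} \<times> UNIV)"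
  proof (intro equalityI subsetI)
    fix \<zeta> assume "\<zeta> \<in> sqrt_domain K"
    hence "(Re \<zeta> - K * sqrt (1 + \<bar>Im \<zeta>\<bar>), Im \<zeta>) \<in> {0<..} \<times> UNIV"
      "\<zeta> = (\<lambda>(s, y). Complex (s + K * sqrt (1 + \<bar>y\<bar>)) y) (Re \<zeta> - K * sqrt (1 + \<bar>Im \<zeta>\<bar>), Im \<zeta>)"
      by (auto simp: sqrt_domain_def complex_eq_iff)
    thus "\<zeta> \<in> (\<lambda>(s, y). Complex (s + K * sqrt (1 + \<bar>y\<bar>)) y) ` ({0<..} \<times> UNIV)" by blast
  qed (auto simp: sqrt_domain_def)
  moreover have conn: "connected (({0<..} :: real set) \<times> (UNIV :: real set))"
    by (intro connected_Times convex_connected) auto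
  moreover have cont: "continuous_on ({0<..} \<times> UNIV) (\<lambda>(s, y). Complex (s + K * sqrt (1 + \<bar>y\<bar>)) y)"
    unfolding case_prod_beta by (intro continuous_intros)
  ultimately show ?thesis using connected_continuous_image[OF cont conn] by simp
qed

text \<open>The origin of the bound in \<open>tame\<close>: both \<bar>Im \<zeta>\<bar> and Re
  \<zeta> are below the square of Re \<zeta>.\<close>

lemma sqrt_domain_norm:
  assumes "\<zeta> \<in> sqrt_domain 1"
  shows "norm \<zeta> \<le> 2 * (Re \<zeta>)\<^sup>2"
proof -
  have 1: "Re \<zeta> > 1" using sqrt_domain_Re[OF assms] by simp
  have "(Re \<zeta>)\<^sup>2 > 1 + \<bar>Im \<zeta>\<bar>" using assms sqrt_domain_iff[of 1 \<zeta>] by simp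
  moreover have "Re \<zeta> \<le> (Re \<zeta>)\<^sup>2" using 1 by (simp add: power2_eq_square)
  ultimately show ?thesis using cmod_le[of \<zeta>] 1 by linarith
qed

lemma tame_subset_sqrt_domain:
  assumes "D \<subseteq> sqrt_domain 1"
  shows "tame (at_Re_top D)"
  unfolding tame_def by (rule at_Re_top_mono) (use assms sqrt_domain_norm in blast)

text \<open>To invert the parametrization, put u = (w + 1)^(1/2) and solve u^2 + C u = 1 + \<zeta>,
  taking the root with positive real part. It remains to see that Re w = Re \<zeta> - C Re u is
  positive, which follows from \<bar>u\<bar>^2 \<le> \<bar>u\<bar> \<bar>u + C\<bar> = \<bar>1 +
  \<zeta>\<bar>.\<close>

lemma sqrt_domain_subset_quadratic:
  assumes "C > 0"
  shows "\<exists>K0\<ge>1. \<forall>K\<ge>K0. sqrt_domain K \<subseteq> quadratic_domain C"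
proof -
  \<comment> \<open>A bound of at least 2 C^2 makes C^2 (1 + \<bar>Im \<zeta>\<bar>) and C^2 Re
    \<zeta> at most half of the square of Re \<zeta> each.\<close>
  define K0 where "K0 = max 1 (2 * C\<^sup>2 + 2)"
  have "sqrt_domain K0 \<subseteq> quadratic_domain C"
  proof
    fix \<zeta> assume \<zeta>: "\<zeta> \<in> sqrt_domain K0"
    have K0: "K0 \<ge> 1" "K0 \<ge> 2 * C\<^sup>2 + 2" by (auto simp: K0_def)
    have x: "Re \<zeta> > K0" using sqrt_domain_Re[OF \<zeta>] K0 by simp
    have sq: "(Re \<zeta>)\<^sup>2 > K0\<^sup>2 * (1 + \<bar>Im \<zeta>\<bar>)" using \<zeta> sqrt_domain_iff[of K0 \<zeta>] K0 by simp
    define r where "r = csqrt (of_real (C\<^sup>2) + 4 * (1 + \<zeta>))"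
    define u where "u = (r - of_real C) / 2"
    have r2: "r\<^sup>2 = of_real (C\<^sup>2) + 4 * (1 + \<zeta>)" by (simp add: r_def)
    have u2: "u\<^sup>2 + of_real C * u = 1 + \<zeta>"
    proof -
      have r: "r = 2 * u + of_real C" by (simp add: u_def field_simps)
      have "4 * (u\<^sup>2 + of_real C * u) = r\<^sup>2 - of_real (C\<^sup>2)"
        unfolding r by (simp add: power2_eq_square algebra_simps)
      hence "4 * (u\<^sup>2 + of_real C * u) = 4 * (1 + \<zeta>)" unfolding r2 by simp
      thus ?thesis by (simp only: mult_cancel_left) simp
    qed
    have "(Re r)\<^sup>2 > C\<^sup>2"
    proof -
      have "(Re r)\<^sup>2 = C\<^sup>2 + (4 * (1 + Re \<zeta>) + (Im r)\<^sup>2)"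
        using arg_cong[OF r2, of Re] by (simp add: power2_eq_square algebra_simps)
      moreover have "4 * (1 + Re \<zeta>) + (Im r)\<^sup>2 > 0"
        by (rule add_pos_nonneg) (use x K0(1) in auto)
      ultimately show ?thesis by simp
    qed
    moreover have "Re r \<ge> 0" using csqrt_principal[of "of_real (C\<^sup>2) + 4 * (1 + \<zeta>)"] by (auto simp: r_def)
    ultimately have "Re r > C" using power2_less_imp_less by blast
    hence Reu: "Re u > 0" by (simp add: u_def)
    define w where "w = u\<^sup>2 - 1"
    have cs: "csqrt (w + 1) = u" unfolding w_def using csqrt_square[of u] Reu by simp
    have \<zeta>w: "\<zeta> = w + of_real C * csqrt (w + 1)" using u2 unfolding cs by (simp add: w_def algebra_simps)
    have "(norm u)\<^sup>2 \<le> norm (1 + \<zeta>)"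
    proof -
      have "norm u \<le> norm (u + of_real C)"
        unfolding cmod_def using Reu assms by (intro real_sqrt_le_mono add_right_mono power_mono) auto
      hence "norm u * norm u \<le> norm u * norm (u + of_real C)" by (intro mult_left_mono) auto
      also have "\<dots> = norm (1 + \<zeta>)" unfolding u2[symmetric]
        by (simp add: norm_mult[symmetric] power2_eq_square algebra_simps)
      finally show ?thesis by (simp add: power2_eq_square)
    qed
    also have "norm (1 + \<zeta>) \<le> 1 + Re \<zeta> + \<bar>Im \<zeta>\<bar>" using cmod_le[of "1 + \<zeta>"] x K0 by simp
    finally have nu: "(norm u)\<^sup>2 \<le> 1 + Re \<zeta> + \<bar>Im \<zeta>\<bar>" .
    have "(C * norm u)\<^sup>2 < (Re \<zeta>)\<^sup>2"
    proof -
      have "(C * norm u)\<^sup>2 \<le> C\<^sup>2 * (1 + Re \<zeta> + \<bar>Im \<zeta>\<bar>)"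
        unfolding power_mult_distrib using nu by (intro mult_left_mono) auto
      also have "\<dots> = C\<^sup>2 * (1 + \<bar>Im \<zeta>\<bar>) + C\<^sup>2 * Re \<zeta>" by (simp add: algebra_simps)
      also have "C\<^sup>2 * (1 + \<bar>Im \<zeta>\<bar>) \<le> K0 * (1 + \<bar>Im \<zeta>\<bar>) / 2"
        using mult_right_mono[of "2 * C\<^sup>2" K0 "1 + \<bar>Im \<zeta>\<bar>"] K0 by simp
      also have "K0 * (1 + \<bar>Im \<zeta>\<bar>) / 2 \<le> K0\<^sup>2 * (1 + \<bar>Im \<zeta>\<bar>) / 2"
        using K0 by (simp add: power2_eq_square mult_right_mono)
      also have "\<dots> < (Re \<zeta>)\<^sup>2 / 2" using sq by simp
      also have "C\<^sup>2 * Re \<zeta> \<le> (Re \<zeta>)\<^sup>2 / 2"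
        using mult_right_mono[of "2 * C\<^sup>2" "Re \<zeta>" "Re \<zeta>"] x K0 by (simp add: power2_eq_square)
      finally show ?thesis by simp
    qed
    hence "C * norm u < Re \<zeta>" by (rule power2_less_imp_less) (use x K0 in simp)
    moreover have "Re w = Re \<zeta> - C * Re u" using \<zeta>w cs by (simp add: algebra_simps)
    moreover have "C * Re u \<le> C * norm u" using complex_Re_le_cmod assms by simp
    ultimately have "Re w > 0" by linarith
    thus "\<zeta> \<in> quadratic_domain C" unfolding quadratic_domain_def using \<zeta>w by blast
  qed
  hence "\<forall>K\<ge>K0. sqrt_domain K \<subseteq> quadratic_domain C" using sqrt_domain_antimono by blast
  thus ?thesis by (intro exI[of _ K0]) (simp add: K0_def)
qed

text \<open>With u = (w + 1)^(1/2), the real part of u^2 is positive, so the square of Re u is at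
  least half of \<bar>u\<bar>^2. Thus Re \<zeta> is at least of size C \<bar>u\<bar>, whereas 1 +
  \<bar>Im \<zeta>\<bar> is at most (2 + C) \<bar>u\<bar>^2.\<close>

lemma quadratic_subset_sqrt_domain:
  assumes "K \<ge> 1"
  shows "\<exists>C>0. quadratic_domain C \<subseteq> sqrt_domain K"
proof -
  \<comment> \<open>Chosen so that C^2 exceeds 2 K^2 (2 + C), the inequality that results from
    comparing the two estimates.\<close>
  define C where "C = 2 * K\<^sup>2 + 2 * K"
  have "K\<^sup>2 \<ge> 1" using assms by simp
  hence C: "C > 0" "C\<^sup>2 > 2 * K\<^sup>2 * (2 + C)"
  proof -
    show "C > 0" using assms \<open>K\<^sup>2 \<ge> 1\<close> unfolding C_def by linarith
    have "C\<^sup>2 = 4 * K ^ 4 + 8 * K ^ 3 + 4 * K\<^sup>2" by (simp add: C_def) algebra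
    moreover have "2 * K\<^sup>2 * (2 + C) = 4 * K\<^sup>2 + 4 * K ^ 4 + 4 * K ^ 3" by (simp add: C_def) algebra
    moreover have "K ^ 3 > 0" using assms by simp
    ultimately show "C\<^sup>2 > 2 * K\<^sup>2 * (2 + C)" by linarith
  qed
  have "quadratic_domain C \<subseteq> sqrt_domain K"
  proof
    fix \<zeta> assume "\<zeta> \<in> quadratic_domain C"
    then obtain w where w: "Re w > 0" "\<zeta> = w + of_real C * csqrt (w + 1)"
      unfolding quadratic_domain_def by blast
    define u where "u = csqrt (w + 1)"
    have u2: "u\<^sup>2 = w + 1" by (simp add: u_def)
    have Reu: "Re u \<ge> 0" using csqrt_principal[of "w + 1"] by (auto simp: u_def)
    have d: "(Re u)\<^sup>2 - (Im u)\<^sup>2 = Re w + 1" using arg_cong[OF u2, of Re] by (simp add: power2_eq_square)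
    define n where "n = (norm u)\<^sup>2"
    have n: "n = (Re u)\<^sup>2 + (Im u)\<^sup>2" by (simp add: n_def cmod_power2)
    have n1: "n \<ge> 1" and un: "(Re u)\<^sup>2 \<ge> n / 2" using d w(1) by (auto simp: n)
      (use zero_le_power2[of "Im u"] in linarith)
    have "norm u \<ge> 1" using n1 unfolding n_def by (metis norm_ge_zero one_power2 power2_le_imp_le)
    hence nn: "norm u \<le> n" unfolding n_def by (intro self_le_power) auto
    have x: "Re \<zeta> \<ge> C * Re u" using w by (simp add: u_def)
    have Repos: "Re u > 0" using un n1 Reu by (cases "Re u = 0") auto
    have y: "1 + \<bar>Im \<zeta>\<bar> \<le> (2 + C) * n"
    proof -
      have "\<bar>Im w\<bar> \<le> norm (w + 1)" using abs_Im_le_cmod[of "w + 1"] by simp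
      also have "\<dots> = n" unfolding n_def u2[symmetric] by (simp add: norm_power)
      finally have "\<bar>Im w\<bar> \<le> n" .
      moreover have "C * \<bar>Im u\<bar> \<le> C * n"
        using abs_Im_le_cmod[of u] nn C(1) by (intro mult_left_mono) auto
      moreover have "\<bar>Im \<zeta>\<bar> \<le> \<bar>Im w\<bar> + C * \<bar>Im u\<bar>"
        using abs_triangle_ineq[of "Im w" "C * Im u"] C(1) by (simp add: w(2) u_def abs_mult)
      ultimately show ?thesis using n1 by (simp add: algebra_simps)
    qed
    have "K\<^sup>2 * (1 + \<bar>Im \<zeta>\<bar>) \<le> K\<^sup>2 * ((2 + C) * n)" using y by (intro mult_left_mono) auto
    also have "\<dots> < C\<^sup>2 * (n / 2)"
      using mult_strict_right_mono[OF C(2), of "n / 2"] n1 by (simp add: algebra_simps)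
    also have "\<dots> \<le> C\<^sup>2 * (Re u)\<^sup>2" using un by (intro mult_left_mono) auto
    also have "\<dots> \<le> (Re \<zeta>)\<^sup>2" unfolding power_mult_distrib[symmetric]
      using x Repos C(1) by (intro power_mono) auto
    finally show "\<zeta> \<in> sqrt_domain K"
      using x mult_pos_pos[OF C(1) Repos] assms by (subst sqrt_domain_iff) auto
  qed
  thus ?thesis using C(1) by blast
qed

subsection \<open>Preimages of spiraling domains\<close>

text \<open>A locally finite sum of continuous ramps. It turns bounds on successive strips into a
  continuous function, which the definition of a spiraling domain demands.\<close>

lemma continuous_majorant:
  fixes M :: "nat \<Rightarrow> real"
  assumes "\<And>n. M n \<ge> 0"
  shows "\<exists>G :: real \<Rightarrow> real. continuous_on UNIV G \<and> (\<forall>y n. of_nat n \<le> \<bar>y\<bar> \<longrightarrow> M n \<le> G y)"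
proof -
  \<comment> \<open>The ramp vanishes for \<bar>y\<bar> \<le> n - 1 and is at least
    \<open>M n\<close> for \<bar>y\<bar> \<ge> n.\<close>
  define t where "t n y = M n * max 0 (\<bar>y\<bar> - of_nat n + 1)" for n and y :: real
  define G where "G y = (\<Sum>n\<le>nat \<lceil>\<bar>y\<bar> + 1\<rceil>. t n y)" for y
  have G: "G y = (\<Sum>n\<le>N. t n y)" if "\<bar>y\<bar> + 1 \<le> of_nat N" for y N
    unfolding G_def
  proof (rule sum.mono_neutral_left)
    show "{..nat \<lceil>\<bar>y\<bar> + 1\<rceil>} \<subseteq> {..N}" using that by simp linarith
    show "\<forall>i\<in>{..N} - {..nat \<lceil>\<bar>y\<bar> + 1\<rceil>}. t i y = 0"
    proof
      fix i assume "i \<in> {..N} - {..nat \<lceil>\<bar>y\<bar> + 1\<rceil>}"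
      hence "nat \<lceil>\<bar>y\<bar> + 1\<rceil> < i" by simp
      hence "\<bar>y\<bar> - of_nat i + 1 \<le> 0" by linarith
      thus "t i y = 0" by (simp add: t_def)
    qed
  qed auto
  have "continuous_on {-r<..<r} G" for r
  proof -
    define N where "N = nat \<lceil>\<bar>r\<bar> + 1\<rceil>"
    have "continuous_on {-r<..<r} (\<lambda>y. \<Sum>n\<le>N. t n y)" unfolding t_def by (intro continuous_intros)
    moreover have "G y = (\<Sum>n\<le>N. t n y)" if "y \<in> {-r<..<r}" for y
    proof (rule G)
      have "\<bar>y\<bar> < \<bar>r\<bar>" using that by auto
      moreover have "\<bar>r\<bar> + 1 \<le> of_nat N" unfolding N_def by linarith
      ultimately show "\<bar>y\<bar> + 1 \<le> of_nat N" by linarith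
    qed
    ultimately show ?thesis using continuous_on_eq by (metis (no_types, lifting))
  qed
  hence "isCont G y" for y
  proof -
    have "y \<in> interior {-(\<bar>y\<bar> + 1)<..<\<bar>y\<bar> + 1}" by (subst interior_open) auto
    with \<open>\<And>r. continuous_on {-r<..<r} G\<close> show ?thesis by (rule continuous_on_interior)
  qed
  hence "continuous_on UNIV G" by (simp add: continuous_at_imp_continuous_on)
  moreover have "M n \<le> G y" if "of_nat n \<le> \<bar>y\<bar>" for n y
  proof -
    have "M n * 1 \<le> t n y" unfolding t_def using that assms by (intro mult_left_mono) auto
    moreover have "t n y \<le> G y" unfolding G_def
    proof (rule member_le_sum)
      show "n \<in> {..nat \<lceil>\<bar>y\<bar> + 1\<rceil>}" using that by simp linarith
    qed (auto simp: t_def assms)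
    ultimately show ?thesis by simp
  qed
  ultimately show ?thesis by blast
qed

lemma spiraling_domain_alt:
  assumes "spiraling_domain D"
  obtains g where "continuous_on UNIV g" "D = {\<zeta>. Re \<zeta> > g (Im \<zeta>)}"
proof -
  obtain h where h: "continuous_on UNIV h" "\<And>\<theta>. h \<theta> > (0::real)" "D = {\<zeta>. exp (- Re \<zeta>) < h (- Im \<zeta>)}"
    using assms unfolding spiraling_domain_def by blast
  have eq: "exp (- Re \<zeta>) < h (- Im \<zeta>) \<longleftrightarrow> Re \<zeta> > - ln (h (- Im \<zeta>))" for \<zeta>
  proof -
    have "exp (- Re \<zeta>) < h (- Im \<zeta>) \<longleftrightarrow> exp (- Re \<zeta>) < exp (ln (h (- Im \<zeta>)))" using h(2) by simp
    thus ?thesis by (simp only: exp_less_cancel_iff) linarith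
  qed
  have "continuous_on UNIV (\<lambda>y. h (- y))"
    by (rule continuous_on_compose2[OF h(1)]) (auto intro: continuous_intros)
  hence "continuous_on UNIV (\<lambda>y. - ln (h (- y)))"
    using h(2) by (intro continuous_on_minus continuous_on_ln) (auto simp: less_imp_neq[symmetric])
  thus ?thesis using that[of "\<lambda>y. - ln (h (- y))"] h(3) eq by simp
qed

lemma spiraling_domain_gt:
  assumes "continuous_on UNIV g"
  shows "spiraling_domain {\<zeta>. Re \<zeta> > g (Im \<zeta>)}"
  unfolding spiraling_domain_def
  by (intro exI[of _ "\<lambda>\<theta>. exp (- g (- \<theta>))"] conjI)
     (auto intro!: continuous_on_exp continuous_on_minus continuous_on_compose2[OF assms])

lemma open_spiraling_domain:
  assumes "spiraling_domain D"
  shows "open D"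
proof -
  obtain g where g: "continuous_on UNIV g" "D = {\<zeta>. Re \<zeta> > g (Im \<zeta>)}"
    using spiraling_domain_alt[OF assms] .
  have "continuous_on UNIV (\<lambda>\<zeta>. g (Im \<zeta>))"
    by (rule continuous_on_compose2[OF g(1)]) (auto intro: continuous_intros)
  thus ?thesis unfolding g(2) by (intro open_Collect_less continuous_intros)
qed

lemma spiraling_domain_real:
  assumes "spiraling_domain D"
  shows "\<exists>X. \<forall>x>X. complex_of_real x \<in> D"
proof -
  obtain g where "D = {\<zeta>. Re \<zeta> > g (Im \<zeta>)}" using spiraling_domain_alt[OF assms] by blast
  thus ?thesis by (intro exI[of _ "g 0"]) auto
qed

text \<open>On each strip n \<le> \<bar>Im \<zeta>\<bar> \<le> n + 1 the imaginary part of
  f(\<zeta>) stays in a compact interval, where the boundary function of \<open>D\<close> is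
  bounded. A continuous majorant of these bounds delimits \<open>E'\<close>, because
  \<open>f\<close> does not decrease real parts.\<close>

lemma spiraling_preimage:
  assumes E: "spiraling_domain E" and D: "spiraling_domain D" and "a > 0"
    and f: "\<And>\<zeta>. \<zeta> \<in> E \<Longrightarrow> norm (f \<zeta> - of_real a * \<zeta>) \<le> \<delta>" "\<And>\<zeta>. \<zeta> \<in> E \<Longrightarrow> Re (f \<zeta>) \<ge> Re \<zeta>"
  shows "\<exists>E'. spiraling_domain E' \<and> f ` E' \<subseteq> D"
proof -
  obtain g where g: "continuous_on UNIV g" "D = {\<zeta>. Re \<zeta> > g (Im \<zeta>)}"
    using spiraling_domain_alt[OF D] .
  define I where "I n = {- (a * (of_nat n + 1) + \<delta>)..a * (of_nat n + 1) + \<delta>}" for n :: nat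
  have "\<exists>B\<ge>0. \<forall>y\<in>I n. g y \<le> B" for n
  proof -
    have "compact (g ` I n)" unfolding I_def
      by (intro compact_continuous_image continuous_on_subset[OF g(1)]) auto
    hence "bounded (g ` I n)" by (rule compact_imp_bounded)
    then obtain B where "\<And>y. y \<in> I n \<Longrightarrow> \<bar>g y\<bar> \<le> B" by (auto simp: bounded_iff)
    hence "\<forall>y\<in>I n. g y \<le> max 0 B" by fastforce
    thus ?thesis by (intro exI[of _ "max 0 B"]) auto
  qed
  then obtain M where M: "\<And>n. M n \<ge> 0" "\<And>n y. y \<in> I n \<Longrightarrow> g y \<le> M n" by metis
  obtain G :: "real \<Rightarrow> real" where G: "continuous_on UNIV G" "\<And>y n. of_nat n \<le> \<bar>y\<bar> \<Longrightarrow> M n \<le> G y"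
    using continuous_majorant[of M, OF M(1)] by blast
  have "f ` (E \<inter> {\<zeta>. Re \<zeta> > G (Im \<zeta>)}) \<subseteq> D"
  proof
    fix w assume "w \<in> f ` (E \<inter> {\<zeta>. Re \<zeta> > G (Im \<zeta>)})"
    then obtain \<zeta> where \<zeta>: "w = f \<zeta>" "\<zeta> \<in> E" "Re \<zeta> > G (Im \<zeta>)" by blast
    define n where "n = nat \<lfloor>\<bar>Im \<zeta>\<bar>\<rfloor>"
    have n: "of_nat n \<le> \<bar>Im \<zeta>\<bar>" "\<bar>Im \<zeta>\<bar> \<le> of_nat n + 1" unfolding n_def by linarith+
    have "\<bar>Im w - a * Im \<zeta>\<bar> \<le> \<delta>"
      using abs_Im_le_cmod[of "w - of_real a * \<zeta>"] f(1)[OF \<zeta>(2)] \<zeta>(1) by simp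
    moreover have "\<bar>a * Im \<zeta>\<bar> \<le> a * (of_nat n + 1)"
      using n(2) assms(3) by (simp add: abs_mult)
    ultimately have "Im w \<in> I n" unfolding I_def by auto
    hence "g (Im w) \<le> G (Im \<zeta>)" using M(2) G(2)[OF n(1)] order_trans by blast
    thus "w \<in> D" using \<zeta> f(2)[OF \<zeta>(2)] g(2) by auto
  qed
  thus ?thesis using spiraling_domain_Int[OF E spiraling_domain_gt[OF G(1)]] by blast
qed

subsection \<open>The linearizing limit\<close>

lemma eventually_power_ge:
  fixes x :: real
  assumes "x > 1"
  shows "\<exists>N. \<forall>n\<ge>N. x ^ n \<ge> c"
proof -
  obtain N where N: "c < x ^ N" using real_arch_pow[OF assms] by blast
  have "x ^ N \<le> x ^ n" if "n \<ge> N" for n by (rule power_increasing[OF that]) (use assms in simp)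
  thus ?thesis using N by (meson less_imp_le order_trans)
qed

text \<open>
  The bound \<open>a - \<surd>a\<close> is chosen such that \<open>Re (f \<zeta>) \<ge> \<surd>a Re \<zeta>\<close> and \<open>1 + \<bar>Im (f \<zeta>)\<bar> \<le> a (1 + \<bar>Im \<zeta>\<bar>)\<close>, which
  makes the domain invariant.
\<close>

locale hyperbolic_map =
  fixes f :: "complex \<Rightarrow> complex" and a K M b :: real
  assumes a: "a > 1" and K: "K \<ge> 1" and b: "b > 0"
    and hol: "f holomorphic_on sqrt_domain K"
    and near: "\<And>\<zeta>. \<zeta> \<in> sqrt_domain K \<Longrightarrow> norm (f \<zeta> - of_real a * \<zeta>) \<le> a - sqrt a"
    and decay: "\<And>\<zeta>. \<zeta> \<in> sqrt_domain K \<Longrightarrow> norm (f \<zeta> - of_real a * \<zeta>) \<le> M * exp (- b * Re \<zeta>)"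
begin

abbreviation E :: "complex set" where "E \<equiv> sqrt_domain K"
abbreviation \<rho> :: "complex \<Rightarrow> complex" where "\<rho> \<zeta> \<equiv> f \<zeta> - of_real a * \<zeta>"

lemma sqrt_a: "sqrt a > 1" "a - sqrt a > 0" "sqrt a * sqrt a = a"
proof -
  show 1: "sqrt a > 1" using a by simp
  show 2: "sqrt a * sqrt a = a" using a by simp
  have "sqrt a * 1 < sqrt a * sqrt a" using 1 by (intro mult_strict_left_mono) auto
  thus "a - sqrt a > 0" using 2 by simp
qed

lemma Re_E: "\<zeta> \<in> E \<Longrightarrow> Re \<zeta> > 1"
  using sqrt_domain_Re[of \<zeta> K] K by simp

lemma M_nonneg: "M \<ge> 0"
proof -
  have "complex_of_real (K + 1) \<in> E" using K by (simp add: sqrt_domain_def)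
  from decay[OF this] have "0 \<le> M * exp (- b * Re (complex_of_real (K + 1)))"
    by (rule order_trans[OF norm_ge_zero])
  thus ?thesis by (simp add: zero_le_mult_iff)
qed

lemma Re_f:
  assumes "\<zeta> \<in> E"
  shows "Re (f \<zeta>) \<ge> sqrt a * Re \<zeta>"
proof -
  have "\<bar>Re (f \<zeta>) - a * Re \<zeta>\<bar> \<le> a - sqrt a"
    using near[OF assms] abs_Re_le_cmod[of "\<rho> \<zeta>"] by simp
  hence "Re (f \<zeta>) \<ge> a * Re \<zeta> - (a - sqrt a) * 1" by simp
  moreover have "(a - sqrt a) * 1 \<le> (a - sqrt a) * Re \<zeta>"
    using sqrt_a Re_E[OF assms] by (intro mult_left_mono) auto
  ultimately show ?thesis by (simp add: algebra_simps)
qed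

lemma Re_f_ge:
  assumes "\<zeta> \<in> E"
  shows "Re (f \<zeta>) \<ge> Re \<zeta>"
proof -
  have "1 * Re \<zeta> \<le> sqrt a * Re \<zeta>"
    using sqrt_a(1) Re_E[OF assms] by (intro mult_right_mono) auto
  thus ?thesis using Re_f[OF assms] by linarith
qed

lemma f_in_E:
  assumes "\<zeta> \<in> E"
  shows "f \<zeta> \<in> E"
proof -
  have im: "\<bar>Im (f \<zeta>) - a * Im \<zeta>\<bar> \<le> a - sqrt a"
    using near[OF assms] abs_Im_le_cmod[of "\<rho> \<zeta>"] by simp
  have "\<bar>a * Im \<zeta>\<bar> = a * \<bar>Im \<zeta>\<bar>" using a by (simp add: abs_mult)
  hence "1 + \<bar>Im (f \<zeta>)\<bar> \<le> 1 + a * \<bar>Im \<zeta>\<bar> + (a - sqrt a)" using im by linarith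
  also have "\<dots> \<le> a * (1 + \<bar>Im \<zeta>\<bar>)" using sqrt_a by (simp add: algebra_simps)
  finally have "K\<^sup>2 * (1 + \<bar>Im (f \<zeta>)\<bar>) \<le> K\<^sup>2 * (a * (1 + \<bar>Im \<zeta>\<bar>))" by (intro mult_left_mono) auto
  also have "\<dots> = a * (K\<^sup>2 * (1 + \<bar>Im \<zeta>\<bar>))" by simp
  also have "\<dots> < a * (Re \<zeta>)\<^sup>2" using assms sqrt_domain_iff[of K \<zeta>] K a by simp
  also have "\<dots> = (sqrt a * Re \<zeta>)\<^sup>2" using a by (simp add: power_mult_distrib)
  also have "\<dots> \<le> (Re (f \<zeta>))\<^sup>2" using Re_f[OF assms] Re_E[OF assms] sqrt_a by (intro power_mono) auto
  finally have "K\<^sup>2 * (1 + \<bar>Im (f \<zeta>)\<bar>) < (Re (f \<zeta>))\<^sup>2" .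
  moreover have "Re (f \<zeta>) > 0" using Re_f_ge[OF assms] Re_E[OF assms] by simp
  ultimately show ?thesis using K by (subst sqrt_domain_iff) auto
qed

lemma iter_in_E: "\<zeta> \<in> E \<Longrightarrow> (f ^^ n) \<zeta> \<in> E"
  by (induction n) (auto intro: f_in_E)

lemma Re_iter:
  assumes "\<zeta> \<in> E"
  shows "Re ((f ^^ n) \<zeta>) \<ge> sqrt a ^ n * Re \<zeta>"
proof (induction n)
  case (Suc n)
  have "sqrt a ^ Suc n * Re \<zeta> \<le> sqrt a * Re ((f ^^ n) \<zeta>)"
    using Suc sqrt_a by (simp add: mult_left_mono mult.assoc)
  also have "\<dots> \<le> Re (f ((f ^^ n) \<zeta>))" by (rule Re_f[OF iter_in_E[OF assms]])
  finally show ?case by simp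
qed auto

lemma Re_iter_ge: "\<zeta> \<in> E \<Longrightarrow> Re ((f ^^ n) \<zeta>) \<ge> Re \<zeta>"
proof -
  assume \<zeta>: "\<zeta> \<in> E"
  have "1 * Re \<zeta> \<le> sqrt a ^ n * Re \<zeta>"
    using sqrt_a(1) Re_E[OF \<zeta>] by (intro mult_right_mono one_le_power) auto
  thus ?thesis using Re_iter[OF \<zeta>, of n] by linarith
qed

text \<open>The increment between the consecutive approximations a^(-n) f^n(\<zeta>) and a^(-n-1)
  f^(n+1)(\<zeta>); hence the telescoping in \<open>iter_eq_sum\<close>.\<close>

definition summand :: "nat \<Rightarrow> complex \<Rightarrow> complex" where
  "summand n \<zeta> = \<rho> ((f ^^ n) \<zeta>) / of_real a ^ Suc n"

definition phi :: "complex \<Rightarrow> complex" where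
  "phi \<zeta> = \<zeta> + (suminf (\<lambda>n. summand n \<zeta>))"

lemma norm_summand:
  assumes "\<zeta> \<in> E"
  shows "norm (summand n \<zeta>) \<le> M * exp (- b * Re \<zeta>) * (1 / a) ^ Suc n"
proof -
  have "norm (\<rho> ((f ^^ n) \<zeta>)) \<le> M * exp (- b * Re ((f ^^ n) \<zeta>))"
    by (rule decay[OF iter_in_E[OF assms]])
  also have "\<dots> \<le> M * exp (- b * Re \<zeta>)"
    using Re_iter_ge[OF assms, of n] b M_nonneg by (intro mult_left_mono) auto
  finally have "norm (\<rho> ((f ^^ n) \<zeta>)) / a ^ Suc n \<le> M * exp (- b * Re \<zeta>) / a ^ Suc n"
    using a by (intro divide_right_mono) auto
  thus ?thesis using a by (simp add: summand_def norm_divide norm_power norm_mult power_one_over field_simps)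
qed

lemma summable_geometric_a: "summable (\<lambda>n. C * (1 / a) ^ Suc n)"
  using a by (intro summable_mult summable_ignore_initial_segment[of "\<lambda>n. (1 / a) ^ n" 1, simplified] summable_geometric) auto

lemma summable_summand: "\<zeta> \<in> E \<Longrightarrow> summable (\<lambda>n. summand n \<zeta>)"
  by (rule summable_comparison_test'[OF summable_geometric_a[of "M * exp (- b * Re \<zeta>)"], of 0])
     (rule norm_summand)

lemma phi_bound:
  assumes "\<zeta> \<in> E"
  shows "norm (phi \<zeta> - \<zeta>) \<le> M * (suminf (\<lambda>n. (1 / a) ^ Suc n)) * exp (- b * Re \<zeta>)"
proof -
  have "norm (suminf (\<lambda>n. summand n \<zeta>)) \<le> (suminf (\<lambda>n. M * exp (- b * Re \<zeta>) * (1 / a) ^ Suc n))"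
    by (rule norm_suminf_le[OF norm_summand[OF assms] summable_geometric_a])
  also have "\<dots> = M * exp (- b * Re \<zeta>) * (suminf (\<lambda>n. (1 / a) ^ Suc n))"
    by (rule suminf_mult) (use summable_geometric_a[of 1] in simp)
  finally show ?thesis by (simp add: phi_def mult_ac)
qed

text \<open>Composition with \<open>f\<close> shifts the index of the series, up to the factor
  \<open>a\<close>; the summand of index 0 lost in this way is the difference between f(\<zeta>) and
  a \<zeta>.\<close>

lemma phi_f:
  assumes "\<zeta> \<in> E"
  shows "phi (f \<zeta>) = of_real a * phi \<zeta>"
proof -
  have a0: "complex_of_real a \<noteq> 0" using a by simp
  have "summand n (f \<zeta>) = of_real a * summand (Suc n) \<zeta>" for n
    using a0 by (simp add: summand_def funpow_swap1)
  hence "(suminf (\<lambda>n. summand n (f \<zeta>))) = of_real a * (suminf (\<lambda>n. summand (Suc n) \<zeta>))"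
    using suminf_mult[of "\<lambda>n. summand (Suc n) \<zeta>" "of_real a"] summable_summand[OF assms]
      summable_Suc_iff[of "\<lambda>n. summand n \<zeta>"] by simp
  also have "(suminf (\<lambda>n. summand (Suc n) \<zeta>)) = (suminf (\<lambda>n. summand n \<zeta>)) - summand 0 \<zeta>"
    by (rule suminf_split_head[OF summable_summand[OF assms]])
  finally have "phi (f \<zeta>) = f \<zeta> + of_real a * ((suminf (\<lambda>n. summand n \<zeta>)) - summand 0 \<zeta>)"
    by (simp add: phi_def)
  moreover have "of_real a * summand 0 \<zeta> = \<rho> \<zeta>" using a0 by (simp add: summand_def)
  ultimately show ?thesis by (simp add: phi_def algebra_simps)
qed

lemma phi_iter: "\<zeta> \<in> E \<Longrightarrow> phi ((f ^^ n) \<zeta>) = of_real a ^ n * phi \<zeta>"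
  by (induction n) (simp_all add: phi_f iter_in_E)

lemma iter_eq_sum:
  assumes "\<zeta> \<in> E"
  shows "(f ^^ n) \<zeta> = of_real a ^ n * (\<zeta> + (\<Sum>k<n. summand k \<zeta>))"
proof (induction n)
  case (Suc n)
  have "complex_of_real a ^ Suc n * summand n \<zeta> = \<rho> ((f ^^ n) \<zeta>)"
    using a by (simp add: summand_def)
  hence "(f ^^ Suc n) \<zeta> = of_real a * (f ^^ n) \<zeta> + of_real a ^ Suc n * summand n \<zeta>" by simp
  thus ?case unfolding Suc.IH by (simp add: algebra_simps)
qed auto

lemma iter_holomorphic: "(f ^^ n) holomorphic_on E"
proof (induction n)
  case (Suc n)
  have "(f \<circ> (f ^^ n)) holomorphic_on E"
    by (rule holomorphic_on_compose_gen[OF Suc hol]) (use iter_in_E in blast)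
  thus ?case by (simp only: funpow.simps)
qed (simp add: id_def)

lemma phi_holomorphic: "phi holomorphic_on E"
proof -
  have "(\<lambda>\<zeta>. suminf (\<lambda>n. summand n \<zeta>)) holomorphic_on E"
  proof (rule holomorphic_uniform_sequence[OF open_sqrt_domain])
    have "(\<lambda>\<zeta>. f ((f ^^ n) \<zeta>)) = f ^^ Suc n" for n by (simp add: fun_eq_iff)
    hence "(\<lambda>\<zeta>. f ((f ^^ n) \<zeta>)) holomorphic_on E" for n using iter_holomorphic[of "Suc n"] by metis
    hence "summand n holomorphic_on E" for n
      unfolding summand_def[abs_def] using a
      by (intro holomorphic_intros iter_holomorphic) auto
    thus "(\<lambda>\<zeta>. \<Sum>i<n. summand i \<zeta>) holomorphic_on E" for n by (intro holomorphic_on_sum) auto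
    fix x assume "x \<in> E"
    then obtain d where d: "d > 0" "cball x d \<subseteq> E" using open_sqrt_domain open_contains_cball by blast
    have "uniform_limit (cball x d) (\<lambda>n \<zeta>. \<Sum>i<n. summand i \<zeta>) (\<lambda>\<zeta>. suminf (\<lambda>n. summand n \<zeta>)) sequentially"
    proof (rule Weierstrass_m_test[OF _ summable_geometric_a[of M]])
      fix n \<zeta> assume "\<zeta> \<in> cball x d"
      hence \<zeta>: "\<zeta> \<in> E" using d by blast
      have "M * exp (- b * Re \<zeta>) \<le> M * 1" using M_nonneg b Re_E[OF \<zeta>] by (intro mult_left_mono) auto
      hence "M * exp (- b * Re \<zeta>) * (1 / a) ^ Suc n \<le> M * (1 / a) ^ Suc n"
        using a by (intro mult_right_mono) auto
      thus "norm (summand n \<zeta>) \<le> M * (1 / a) ^ Suc n" using norm_summand[OF \<zeta>, of n] by linarith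
    qed
    thus "\<exists>d>0. cball x d \<subseteq> E \<and> uniform_limit (cball x d) (\<lambda>n \<zeta>. \<Sum>i<n. summand i \<zeta>)
            (\<lambda>\<zeta>. suminf (\<lambda>n. summand n \<zeta>)) sequentially" using d by blast
  qed
  thus ?thesis unfolding phi_def[abs_def] by (intro holomorphic_intros)
qed

text \<open>The iterates never move left of \<zeta>, so reality of \<open>f\<close> is only asked
  for from Re \<zeta> on; for a real germ it is known only far out.\<close>

lemma phi_real:
  assumes "\<zeta> \<in> E" "\<zeta> \<in> \<real>" and real: "\<And>w. w \<in> E \<Longrightarrow> w \<in> \<real> \<Longrightarrow> Re w \<ge> Re \<zeta> \<Longrightarrow> f w \<in> \<real>"
  shows "phi \<zeta> \<in> \<real>"
proof -
  have iter: "(f ^^ n) \<zeta> \<in> \<real>" for n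
  proof (induction n)
    case (Suc n)
    thus ?case using real[OF iter_in_E[OF assms(1)] Suc Re_iter_ge[OF assms(1)]] by simp
  qed (use assms in auto)
  have "summand n \<zeta> \<in> \<real>" for n
    using iter[of n] iter[of "Suc n"] by (auto simp: summand_def)
  hence "Im (summand n \<zeta>) = 0" for n by (simp add: complex_is_Real_iff)
  hence "Im (suminf (\<lambda>n. summand n \<zeta>)) = 0"
    using sums_Im[OF summable_sums[OF summable_summand[OF assms(1)]]] by (simp add: sums_iff)
  thus ?thesis using assms(2) by (simp add: phi_def complex_is_Real_iff)
qed

lemma eq_phi:
  assumes \<psi>: "\<And>\<zeta>. \<zeta> \<in> E \<Longrightarrow> \<psi> (f \<zeta>) = of_real a * \<psi> \<zeta>"
    and bound: "\<And>\<zeta>. \<zeta> \<in> E \<Longrightarrow> Re \<zeta> \<ge> X \<Longrightarrow> norm (\<psi> \<zeta> - \<zeta>) \<le> B"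
    and \<zeta>: "\<zeta> \<in> E"
  shows "\<psi> \<zeta> = phi \<zeta>"
proof -
  have iter: "\<psi> ((f ^^ n) \<zeta>) = of_real a ^ n * \<psi> \<zeta>" for n
    by (induction n) (simp_all add: \<psi> iter_in_E[OF \<zeta>])
  \<comment> \<open>Beyond \<open>X\<close> both \<psi> and \<open>phi\<close> stay within a bounded
    distance of the identity, so \<open>B'\<close> bounds their difference there. After
    \<open>N\<close> steps every orbit is beyond \<open>X\<close>, since
    \<open>Re \<zeta> > 1\<close> and real parts grow like \<open>sqrt a ^ n\<close>.\<close>
  define B' where "B' = B + M * (suminf (\<lambda>n. (1 / a) ^ Suc n))"
  have sum_nonneg: "(suminf (\<lambda>n. (1 / a) ^ Suc n)) \<ge> 0"
    using a summable_geometric_a[of 1] by (intro suminf_nonneg) auto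
  obtain N where N: "\<And>n. n \<ge> N \<Longrightarrow> sqrt a ^ n \<ge> \<bar>X\<bar>"
    using eventually_power_ge[OF sqrt_a(1)] by blast
  have est: "norm (\<psi> \<zeta> - phi \<zeta>) \<le> B' * (1 / a) ^ n" if n: "n \<ge> N" for n
  proof -
    let ?w = "(f ^^ n) \<zeta>"
    have w: "?w \<in> E" by (rule iter_in_E[OF \<zeta>])
    have "\<bar>X\<bar> * 1 \<le> sqrt a ^ n * Re \<zeta>" using N[OF n] Re_E[OF \<zeta>] by (intro mult_mono) auto
    hence "Re ?w \<ge> X" using Re_iter[OF \<zeta>, of n] by linarith
    from bound[OF w this] have 1: "norm (\<psi> ?w - ?w) \<le> B" .
    have "M * (suminf (\<lambda>n. (1 / a) ^ Suc n)) * exp (- b * Re ?w) \<le> M * (suminf (\<lambda>n. (1 / a) ^ Suc n)) * 1"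
      using Re_E[OF w] b M_nonneg sum_nonneg by (intro mult_left_mono) auto
    with phi_bound[OF w] have 2: "norm (phi ?w - ?w) \<le> M * (suminf (\<lambda>n. (1 / a) ^ Suc n))" by linarith
    have "norm (\<psi> ?w - phi ?w) \<le> B'"
      using 1 2 norm_triangle_ineq4[of "\<psi> ?w - ?w" "phi ?w - ?w"] unfolding B'_def by simp
    moreover have "\<psi> ?w - phi ?w = of_real a ^ n * (\<psi> \<zeta> - phi \<zeta>)"
      by (simp add: iter phi_iter[OF \<zeta>] algebra_simps)
    ultimately have "norm (of_real a ^ n * (\<psi> \<zeta> - phi \<zeta>)) \<le> B'" by simp
    hence "a ^ n * norm (\<psi> \<zeta> - phi \<zeta>) \<le> B'" using a by (simp add: norm_mult norm_power)
    thus ?thesis using a by (simp add: field_simps power_one_over)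
  qed
  have "(\<lambda>n. B' * (1 / a) ^ n) \<longlonglongrightarrow> B' * 0"
    using a by (intro tendsto_mult tendsto_const LIMSEQ_power_zero) auto
  moreover have "eventually (\<lambda>n. norm (\<psi> \<zeta> - phi \<zeta>) \<le> B' * (1 / a) ^ n) sequentially"
    using est by (auto simp: eventually_sequentially)
  ultimately have "norm (\<psi> \<zeta> - phi \<zeta>) \<le> B' * 0"
    by (rule tendsto_lowerbound) auto
  thus ?thesis by simp
qed

lemma tame_E: "tame (at_Re_top E)"
  by (rule tame_subset_sqrt_domain[OF sqrt_domain_antimono[OF K]])

lemma eventually_in_E: "eventually (\<lambda>\<zeta>. \<zeta> \<in> E) (at_Re_top E)"
  by (auto simp: eventually_at_Re_top)

lemma filterlim_f: "filterlim f (at_Re_top E) (at_Re_top E)"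
  unfolding filterlim_iff eventually_at_Re_top
proof (intro allI impI)
  fix P assume "\<exists>X. \<forall>\<zeta>\<in>E. X \<le> Re \<zeta> \<longrightarrow> P \<zeta>"
  then obtain X where X: "\<And>\<zeta>. \<zeta> \<in> E \<Longrightarrow> X \<le> Re \<zeta> \<Longrightarrow> P \<zeta>" by blast
  have "P (f \<zeta>)" if "\<zeta> \<in> E" "X \<le> Re \<zeta>" for \<zeta>
    using X f_in_E[OF that(1)] Re_f_ge[OF that(1)] that(2) order_trans by blast
  thus "\<exists>X. \<forall>\<zeta>\<in>E. X \<le> Re \<zeta> \<longrightarrow> P (f \<zeta>)" by blast
qed

section \<open>The expansion of the limit\<close>

definition formal_summand :: "transseries \<Rightarrow> nat \<Rightarrow> transseries" where
  "formal_summand \<eta> n = ((\<lambda>x. tsum (tcomp_term a \<eta> x)) ^^ n) \<eta>"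

text \<open>The remainder after \<open>N\<close> summands is a^(-N) times \<open>phi\<close> minus
  the identity, evaluated at the \<open>N\<close>-th iterate. It is therefore O(exp(-b
  Re(f^N(\<zeta>)))), and Re(f^N(\<zeta>)) is at least \<open>sqrt a ^ N * Re \<zeta>\<close>, so a
  large \<open>N\<close> achieves any decay rate. On the formal side, the order in z of the
  \<open>n\<close>-th summand exceeds \<open>a ^ n * c0\<close>.\<close>

lemma phi_expands:
  assumes \<eta>: "expands (at_Re_top E) \<rho> \<eta>" "c0 > 0" "expo0_gt c0 \<eta>"
  shows "\<exists>\<psi>. expands (at_Re_top E) phi \<psi> \<and> expo0_gt 0 (\<psi> - tmono 1 (dmon 0 1)) \<and>
    tsum (tcomp_term a \<eta> \<psi>) = tconst (of_real a) * \<psi>"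
proof -
  let ?F = "at_Re_top E"
  have inf: "infinitesimal \<eta>" using infinitesimal_expo0[OF \<eta>(3)] \<eta>(2) by simp
  have Re_ev: "eventually (\<lambda>\<zeta>. Re (f \<zeta>) \<ge> Re \<zeta>) ?F"
    using eventually_in_E by eventually_elim (rule Re_f_ge)
  have compose: "expands ?F (\<lambda>\<zeta>. g (f \<zeta>)) (tsum (tcomp_term a \<eta> x))" if "expands ?F g x" for g x
    by (rule expands_compose[OF tame_E _ \<eta>(2,1,3) _ Re_ev filterlim_f that]) (use a in auto)
  let ?x = "formal_summand \<eta>"
  have x: "expands ?F (\<lambda>\<zeta>. \<rho> ((f ^^ n) \<zeta>)) (?x n) \<and> expo0_gt (a ^ n * c0) (?x n)" for n
  proof (induction n)
    case (Suc n)
    from compose[OF conjunct1[OF Suc]]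
    have "expands ?F (\<lambda>\<zeta>. \<rho> ((f ^^ Suc n) \<zeta>)) (?x (Suc n))"
      by (simp add: formal_summand_def funpow_swap1)
    moreover have "expo0_gt (a * (a ^ n * c0)) (tsum (tcomp_term a \<eta> (?x n)))"
      by (rule tsum_tcomp_expo_0_gt[OF _ inf]) (use a Suc in auto)
    ultimately show ?case by (simp add: formal_summand_def mult.assoc)
  qed (use \<eta> in \<open>simp add: formal_summand_def\<close>)
  define y where "y n = tconst (1 / of_real a ^ Suc n) * ?x n" for n
  have y: "expands ?F (summand n) (y n)" for n
    using expands_const_mult[OF tame_E conjunct1[OF x[of n]], of "1 / of_real a ^ Suc n"]
    by (simp add: y_def summand_def[abs_def])
  have ygt: "expo0_gt (a ^ n * c0) (y n)" for n using x[of n] by (auto simp: y_def)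
  have large: "\<exists>N. \<forall>n\<ge>N. expo0_gt c (y n)" for c
  proof -
    obtain N where "\<And>n. n \<ge> N \<Longrightarrow> a ^ n \<ge> c / c0" using eventually_power_ge[OF a] by blast
    hence "\<And>n. n \<ge> N \<Longrightarrow> a ^ n * c0 \<ge> c" using \<eta>(2) by (simp add: field_simps)
    hence "expo0_gt c (y n)" if "n \<ge> N" for n using ygt[of n] that by fastforce
    thus ?thesis by blast
  qed
  have sm: "tsummable y"
    unfolding tsummable_def
  proof (intro conjI allI)
    fix m
    obtain N where N: "\<And>n. n \<ge> N \<Longrightarrow> expo0_gt (expo m 0) (y n)" using large by blast
    have "{n. tcoeff (y n) m \<noteq> 0} \<subseteq> {..<N}"
    proof
      fix n assume "n \<in> {n. tcoeff (y n) m \<noteq> 0}"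
      thus "n \<in> {..<N}" using N[of n] by (cases "n < N") auto
    qed
    thus "finite {n. tcoeff (y n) m \<noteq> 0}" using finite_subset by blast
  next
    show "log_support (\<Union>n. tsupp (y n))"
    proof (rule log_support_dmon)
      fix m assume "m \<in> (\<Union>n. tsupp (y n))"
      thus "\<exists>\<beta> j. m = dmon \<beta> j" using expands_supp[OF y] by blast
    next
      fix c
      obtain N where N: "\<And>n. n \<ge> N \<Longrightarrow> expo0_gt c (y n)" using large by blast
      have "{m \<in> \<Union>n. tsupp (y n). expo m 0 \<le> c} \<subseteq> (\<Union>n\<in>{..<N}. {m \<in> tsupp (y n). expo m 0 \<le> c})"
      proof
        fix m assume m: "m \<in> {m \<in> \<Union>n. tsupp (y n). expo m 0 \<le> c}"
        then obtain n where n: "m \<in> tsupp (y n)" "expo m 0 \<le> c" by blast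
        have "n < N"
        proof (rule ccontr)
          assume "\<not> n < N"
          hence "expo m 0 > c" using N[of n] n(1) by simp
          thus False using n(2) by simp
        qed
        thus "m \<in> (\<Union>n\<in>{..<N}. {m \<in> tsupp (y n). expo m 0 \<le> c})" using n by blast
      qed
      moreover have "finite (\<Union>n\<in>{..<N}. {m \<in> tsupp (y n). expo m 0 \<le> c})"
        using expands_finite[OF y] by blast
      ultimately show "finite {m \<in> \<Union>n. tsupp (y n). expo m 0 \<le> c}" using finite_subset by blast
    qed
  qed
  let ?z = "tmono 1 (dmon 0 1)"
  define \<psi> where "\<psi> = ?z + tsum y"
  have z: "expands ?F (\<lambda>\<zeta>. \<zeta>) ?z"
    using expands_expoly[OF expoly_mono[of 0 1 1]] by simp
  have \<psi>gt: "expo0_gt 0 (\<psi> - ?z)"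
  proof
    fix m assume "m \<in> tsupp (\<psi> - ?z)"
    hence "m \<in> tsupp (tsum y)" by (simp add: \<psi>_def)
    then obtain n where "m \<in> tsupp (y n)" using tsupp_tsum[OF sm] by blast
    hence "expo m 0 > a ^ n * c0" using ygt by blast
    moreover have "a ^ n * c0 > 0" using a \<eta>(2) by simp
    ultimately show "expo m 0 > 0" by linarith
  qed
  have "expands ?F phi \<psi>"
  proof (rule expandsI[OF tame_E, of 0])
    fix c :: real assume c: "c \<ge> 0"
    obtain N1 where N1: "\<And>n. n \<ge> N1 \<Longrightarrow> expo0_gt c (y n)" using large by blast
    \<comment> \<open>Then \<open>b * sqrt a ^ n \<ge> c\<close>, which turns the decay of the
      remainder into the required rate \<open>c\<close>.\<close>
    obtain N2 where N2: "\<And>n. n \<ge> N2 \<Longrightarrow> sqrt a ^ n \<ge> c / b"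
      using eventually_power_ge[OF sqrt_a(1)] by blast
    define N where "N = max N1 N2"
    have "expands ?F (\<lambda>\<zeta>. \<zeta> + (\<Sum>n<N. summand n \<zeta>)) (?z + (\<Sum>n<N. y n))"
      by (intro expands_add z expands_sum y)
    then obtain h p where h: "expoly h p" "expo0_gt c (?z + (\<Sum>n<N. y n) - p)"
        "(\<lambda>\<zeta>. \<zeta> + (\<Sum>n<N. summand n \<zeta>) - h \<zeta>) \<in> O[?F](expf c)" by (rule expandsE)
    let ?R = "\<lambda>n. if n \<in> {..<N} then 0 else y n"
    note split = tsummable_split[OF sm finite_lessThan[of N]]
    have "expo0_gt c (tsum ?R)"
    proof
      fix m assume "m \<in> tsupp (tsum ?R)"
      then obtain n where "m \<in> tsupp (?R n)" using tsupp_tsum[OF split(1)] by blast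
      hence "n \<ge> N1" "m \<in> tsupp (y n)" by (auto simp: N_def split: if_splits)
      thus "expo m 0 > c" using N1 by blast
    qed
    from expo0_gt_add[OF h(2) this] have 1: "expo0_gt c (\<psi> - p)"
      using split(2) by (simp add: \<psi>_def algebra_simps)
    define S where "S = M * (suminf (\<lambda>n. (1 / a) ^ Suc n))"
    have "(\<lambda>\<zeta>. phi \<zeta> - (\<zeta> + (\<Sum>n<N. summand n \<zeta>))) \<in> O[?F](expf c)"
    proof (rule bigoI[where c = S])
      show "\<forall>\<^sub>F \<zeta> in ?F. norm (phi \<zeta> - (\<zeta> + (\<Sum>n<N. summand n \<zeta>))) \<le> S * norm (expf c \<zeta>)"
        using eventually_in_E
      proof eventually_elim
        case (elim \<zeta>)
        let ?w = "(f ^^ N) \<zeta>"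
        have w: "?w \<in> E" by (rule iter_in_E[OF elim])
        have S0: "S \<ge> 0" using M_nonneg a summable_geometric_a[of 1]
          unfolding S_def by (intro mult_nonneg_nonneg suminf_nonneg) auto
        have "phi ?w - ?w = of_real a ^ N * (phi \<zeta> - (\<zeta> + (\<Sum>n<N. summand n \<zeta>)))"
          unfolding phi_iter[OF elim] by (simp only: iter_eq_sum[OF elim, of N] right_diff_distrib)
        hence "a ^ N * norm (phi \<zeta> - (\<zeta> + (\<Sum>n<N. summand n \<zeta>))) = norm (phi ?w - ?w)"
          using a by (simp add: norm_mult norm_power)
        also have "\<dots> \<le> S * exp (- b * Re ?w)" using phi_bound[OF w] by (simp add: S_def)
        also have "exp (- b * Re ?w) \<le> exp (- c * Re \<zeta>)"
        proof -
          have "c \<le> b * sqrt a ^ N" using N2[of N] b by (simp add: N_def field_simps)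
          hence "c * Re \<zeta> \<le> b * sqrt a ^ N * Re \<zeta>" using Re_E[OF elim] by (intro mult_right_mono) auto
          also have "\<dots> \<le> b * Re ?w" using Re_iter[OF elim, of N] b by (simp add: mult.assoc)
          finally show ?thesis by simp
        qed
        finally have le: "a ^ N * norm (phi \<zeta> - (\<zeta> + (\<Sum>n<N. summand n \<zeta>))) \<le> S * exp (- c * Re \<zeta>)"
          using S0 by (simp add: mult_left_mono)
        have "1 * norm (phi \<zeta> - (\<zeta> + (\<Sum>n<N. summand n \<zeta>))) \<le> a ^ N * norm (phi \<zeta> - (\<zeta> + (\<Sum>n<N. summand n \<zeta>)))"
          using a by (intro mult_right_mono one_le_power) auto
        thus ?case using le by simp
      qed
    qed
    from sum_in_bigo(1)[OF this h(3)] have "(\<lambda>\<zeta>. phi \<zeta> - h \<zeta>) \<in> O[?F](expf c)" by simp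
    thus "\<exists>h p. expoly h p \<and> expo0_gt c (\<psi> - p) \<and> (\<lambda>\<zeta>. phi \<zeta> - h \<zeta>) \<in> O[?F](expf c)"
      using h(1) 1 by blast
  qed
  moreover have "tsum (tcomp_term a \<eta> \<psi>) = tconst (of_real a) * \<psi>"
  proof (rule expands_unique[OF tame_E])
    show "?F \<noteq> bot"
    proof
      assume "?F = bot"
      hence "eventually (\<lambda>_. False) ?F" by simp
      then obtain X where X: "\<forall>\<zeta>\<in>E. \<not> X \<le> Re \<zeta>" unfolding eventually_at_Re_top by blast
      have "complex_of_real (max X (K + 1)) \<in> E" using K by (simp add: sqrt_domain_def)
      thus False using X by fastforce
    qed
    show "expands ?F (\<lambda>\<zeta>. phi (f \<zeta>)) (tsum (tcomp_term a \<eta> \<psi>))" by (rule compose) fact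
    show "expands ?F (\<lambda>\<zeta>. phi (f \<zeta>)) (tconst (of_real a) * \<psi>)"
      by (rule expands_cong[OF expands_const_mult[OF tame_E \<open>expands ?F phi \<psi>\<close>]])
         (use eventually_in_E in \<open>eventually_elim, simp add: phi_f\<close>)
  qed
  ultimately show ?thesis using \<psi>gt by blast
qed

end

subsection \<open>Normalization of Dulac germs\<close>

lemma tzeta_eq: "tzeta = tmono 1 (dmon 0 1)"
  by (simp add: tzeta_def zetamon_eq)

lemma expands_tzeta: "expands F (\<lambda>\<zeta>. \<zeta>) tzeta"
  using expands_expoly[OF expoly_mono[of 0 1 1]] by (simp add: tzeta_eq)

lemma expands_diff:
  assumes "tame F" "expands F g x" "expands F g' y"
  shows "expands F (\<lambda>\<zeta>. g \<zeta> - g' \<zeta>) (x - y)"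
proof -
  have "tconst (-1) * y = - y" by (rule transseries_eqI) simp
  thus ?thesis using expands_add[OF assms(2) expands_const_mult[OF assms(1,3), of "-1"]] by simp
qed

lemma expands_tendsto_0:
  assumes "tame F" "expands F g x" "expo0_gt 0 x"
  shows "(g \<longlongrightarrow> 0) F"
proof -
  obtain b where b: "b > 0" "expo0_gt b x" using expands_gap[OF assms(2,3)] by blast
  have "g \<in> o[F](expf 0)"
    by (rule landau_o.big_small_trans[OF expands_bigo[OF assms(1,2) b(2)] expf_smallo[OF assms(1) b(1)]])
  thus ?thesis by (auto dest: smalloD_tendsto)
qed

text \<open>Two representatives of a germ need not agree on any quadratic domain, but they agree
  along this filter, and it is tame and nontrivial, hence fine enough to compare and to determine
  expansions.\<close>

abbreviation real_filter :: "real \<Rightarrow> complex filter" where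
  "real_filter K \<equiv> at_Re_top (sqrt_domain K \<inter> \<real>)"

lemma real_in_sqrt_domain: "x > K \<Longrightarrow> complex_of_real x \<in> sqrt_domain K"
  by (simp add: sqrt_domain_def)

lemma tame_real_filter: "K \<ge> 1 \<Longrightarrow> tame (real_filter K)"
  by (rule tame_subset_sqrt_domain) (use sqrt_domain_antimono in blast)

lemma real_filter_neq_bot: "real_filter K \<noteq> bot"
proof
  assume "real_filter K = bot"
  hence "eventually (\<lambda>_. False) (real_filter K)" by simp
  then obtain X where X: "\<forall>\<zeta>\<in>sqrt_domain K \<inter> \<real>. \<not> X \<le> Re \<zeta>" unfolding eventually_at_Re_top by blast
  have "complex_of_real (max X (K + 1)) \<in> sqrt_domain K \<inter> \<real>" using real_in_sqrt_domain by simp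
  from bspec[OF X this] show False by simp
qed

lemma germ_eq_real_filter:
  assumes "germ_eq G G'"
  shows "eventually (\<lambda>\<zeta>. G \<zeta> = G' \<zeta>) (real_filter K)"
proof -
  obtain D where D: "spiraling_domain D" "\<And>\<zeta>. \<zeta> \<in> D \<Longrightarrow> G \<zeta> = G' \<zeta>"
    using assms unfolding germ_eq_def by blast
  obtain X where X: "\<And>x. x > X \<Longrightarrow> complex_of_real x \<in> D" using spiraling_domain_real[OF D(1)] by blast
  have "G \<zeta> = G' \<zeta>" if "\<zeta> \<in> \<real>" "Re \<zeta> \<ge> X + 1" for \<zeta>
    using D(2)[OF X[of "Re \<zeta>"]] that by (simp add: of_real_Re)
  thus ?thesis unfolding eventually_at_Re_top by blast
qed

lemma sqrt_domain_subset_quadratic2: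
  assumes "C > 0" "C' > 0"
  shows "\<exists>K\<ge>K0. K \<ge> 1 \<and> sqrt_domain K \<subseteq> quadratic_domain C \<and> sqrt_domain K \<subseteq> quadratic_domain C'"
proof -
  obtain K1 K2 where "K1 \<ge> 1" "\<forall>K\<ge>K1. sqrt_domain K \<subseteq> quadratic_domain C"
      "\<forall>K\<ge>K2. sqrt_domain K \<subseteq> quadratic_domain C'"
    using sqrt_domain_subset_quadratic[OF assms(1)] sqrt_domain_subset_quadratic[OF assms(2)] by blast
  thus ?thesis by (intro exI[of _ "max K0 (max K1 K2)"]) auto
qed

lemma expansion_unique:
  assumes "C > 0" "C' > 0" "expands_on G (quadratic_domain C) x" "expands_on G' (quadratic_domain C') x'"
    and eq: "germ_eq G G'"
  shows "x = x'"
proof -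
  obtain K where K: "K \<ge> 1" "sqrt_domain K \<subseteq> quadratic_domain C" "sqrt_domain K \<subseteq> quadratic_domain C'"
    using sqrt_domain_subset_quadratic2[OF assms(1,2)] by blast
  note tame = tame_real_filter[OF K(1)]
  have "expands (real_filter K) G x"
    by (rule expands_of_expands_on[OF assms(3) at_Re_top_mono tame]) (use K in blast)
  moreover have "expands (real_filter K) G' x'"
    by (rule expands_of_expands_on[OF assms(4) at_Re_top_mono tame]) (use K in blast)
  ultimately show ?thesis
    using expands_unique[OF tame real_filter_neq_bot] expands_cong germ_eq_real_filter[OF eq] by blast
qed

text \<open>One choice of \<open>M\<close> and \<open>b\<close> serves all large \<open>K\<close>.
  Uniqueness and reality later shrink the domain to where a further representative is under control,
  and the same limit function must be available there.\<close>

lemma hyperbolic_map_ex: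
  assumes C: "C > 0" and an: "F analytic_on quadratic_domain C"
    and ex: "expands_on F (quadratic_domain C) x" and a: "a > 1"
    and inf: "infinitesimal (x - tconst (of_real a) * tzeta)"
  shows "\<exists>K0 M b. b > 0 \<and> expo0_gt b (x - tconst (of_real a) * tzeta) \<and> (\<forall>K\<ge>K0. hyperbolic_map F a K M b \<and>
    expands (at_Re_top (sqrt_domain K)) (\<lambda>\<zeta>. F \<zeta> - of_real a * \<zeta>) (x - tconst (of_real a) * tzeta))"
proof -
  let ?\<eta> = "x - tconst (of_real a) * tzeta" and ?\<rho> = "\<lambda>\<zeta>. F \<zeta> - of_real a * \<zeta>"
  obtain K1 where K1: "K1 \<ge> 1" "sqrt_domain K1 \<subseteq> quadratic_domain C"
    using sqrt_domain_subset_quadratic[OF C] by blast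
  let ?F = "at_Re_top (sqrt_domain K1)"
  have tame: "tame ?F" by (rule tame_subset_sqrt_domain[OF sqrt_domain_antimono[OF K1(1)]])
  have \<eta>: "expands ?F ?\<rho> ?\<eta>"
    by (intro expands_diff[OF tame] expands_const_mult[OF tame] expands_tzeta
        expands_of_expands_on[OF ex at_Re_top_mono[OF K1(2)] tame])
  have "expo0_gt 0 ?\<eta>"
  proof
    fix m assume m: "m \<in> tsupp ?\<eta>"
    obtain \<beta> j where \<beta>: "m = dmon \<beta> j" "\<beta> \<ge> 0" using expands_supp[OF \<eta> m] by blast
    \<comment> \<open>An infinitesimal might have monomials without z, but a monomial e^(-\<beta>
      \<zeta>) \<zeta>^j with \<open>j \<ge> 0\<close> is infinitesimal only if \<beta> > 0. This
      makes \<rho> exponentially small.\<close>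
    have "dmon 0 0 < dmon \<beta> j" using infinitesimal_pos[OF inf m] \<beta>(1) by (simp add: dmon_0_0)
    thus "expo m 0 > 0" by (simp add: dmon_less_iff \<beta>(1) expo_dmon)
  qed
  then obtain b where b: "b > 0" "expo0_gt b ?\<eta>" using expands_gap[OF \<eta>] by blast
  have big: "?\<rho> \<in> O[?F](expf b)" by (rule expands_bigo[OF tame \<eta> b(2)])
  then obtain M where M: "eventually (\<lambda>\<zeta>. norm (?\<rho> \<zeta>) \<le> M * norm (expf b \<zeta>)) ?F"
    by (elim landau_o.bigE)
  have sq: "a - sqrt a > 0"
  proof -
    have "sqrt a * 1 < sqrt a * sqrt a" using a by (intro mult_strict_left_mono) auto
    thus ?thesis using a by simp
  qed
  have "?\<rho> \<in> o[?F](expf 0)" by (rule landau_o.big_small_trans[OF big expf_smallo[OF tame b(1)]])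
  from landau_o.smallD[OF this sq]
  have "eventually (\<lambda>\<zeta>. norm (?\<rho> \<zeta>) \<le> a - sqrt a) ?F" by simp
  from eventually_conj[OF M this] obtain X where
    X: "\<And>\<zeta>. \<zeta> \<in> sqrt_domain K1 \<Longrightarrow> Re \<zeta> \<ge> X \<Longrightarrow>
          norm (?\<rho> \<zeta>) \<le> M * norm (expf b \<zeta>) \<and> norm (?\<rho> \<zeta>) \<le> a - sqrt a"
    unfolding eventually_at_Re_top by blast
  have "hyperbolic_map F a K M b \<and> expands (at_Re_top (sqrt_domain K)) ?\<rho> ?\<eta>" if K: "K \<ge> max K1 X" for K
  proof
    have sub: "sqrt_domain K \<subseteq> sqrt_domain K1" by (rule sqrt_domain_antimono) (use K in simp)
    show "expands (at_Re_top (sqrt_domain K)) ?\<rho> ?\<eta>"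
      by (rule expands_filter_mono[OF \<eta> at_Re_top_mono[OF sub]])
    have near: "norm (?\<rho> \<zeta>) \<le> M * norm (expf b \<zeta>) \<and> norm (?\<rho> \<zeta>) \<le> a - sqrt a"
      if "\<zeta> \<in> sqrt_domain K" for \<zeta>
      by (rule X) (use that sub sqrt_domain_Re[OF that] K K1(1) in auto)
    show "hyperbolic_map F a K M b"
    proof
      show "F holomorphic_on sqrt_domain K"
        by (rule analytic_imp_holomorphic, rule analytic_on_subset[OF an]) (use sub K1(2) in blast)
      show "norm (?\<rho> \<zeta>) \<le> M * exp (- b * Re \<zeta>)" if "\<zeta> \<in> sqrt_domain K" for \<zeta>
        using near[OF that] by simp
    qed (use a K K1(1) b(1) near in auto)
  qed
  thus ?thesis using b by (intro exI[of _ "max K1 X"] exI[of _ M] exI[of _ b]) auto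
qed

lemma infinitesimal_diff: "infinitesimal x \<Longrightarrow> infinitesimal y \<Longrightarrow> infinitesimal (x - y)"
  unfolding infinitesimal_def by fastforce

text \<open>Existence is provided by \<psi>, the expansion found in \<open>phi_expands\<close>. For
  a competitor the difference to \<psi> is only known to be infinitesimal and may contain iterated
  logarithms, which is why \<open>homogeneous_solution_0\<close> is stated for general
  transseries.\<close>

lemma normalizing_transseries_ex1:
  assumes a: "a > 1" and \<eta>: "expo0_gt 0 (fhat - tconst (of_real a) * tzeta)"
    and \<psi>: "expo0_gt 0 (\<psi> - tzeta)"
      "tsum (tcomp_term a (fhat - tconst (of_real a) * tzeta) \<psi>) = tconst (of_real a) * \<psi>"
  shows "\<exists>!x. normalizing_transseries a fhat x" "normalizing_transseries a fhat x \<Longrightarrow> zeta_chart x = \<psi>"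
proof -
  let ?\<eta> = "fhat - tconst (of_real a) * tzeta"
  have inf: "infinitesimal ?\<eta>" by (rule infinitesimal_expo0[OF \<eta> order_refl])
  have "tcoeff ?\<eta> zetamon = 0"
  proof (rule ccontr)
    assume "tcoeff ?\<eta> zetamon \<noteq> 0"
    hence "zetamon \<in> tsupp ?\<eta>" by simp
    hence "expo zetamon 0 > 0" using \<eta> by blast
    thus False by (simp add: zetamon_eq expo_dmon)
  qed
  from tcomp_eq[OF this, of _ a] have tcomp: "tcomp g fhat = tsum (tcomp_term a ?\<eta> g)" for g by simp
  have unique: "zeta_chart x = \<psi>" if "normalizing_transseries a fhat x" for x
  proof -
    have x: "parabolic_transseries x" "tsum (tcomp_term a ?\<eta> (zeta_chart x)) = tconst (of_real a) * zeta_chart x"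
      using that by (auto simp: normalizing_transseries_def tcomp)
    have "infinitesimal ((zeta_chart x - tzeta) - (\<psi> - tzeta))"
      by (rule infinitesimal_diff[OF infinitesimal_zeta_chart[OF x(1)] infinitesimal_expo0[OF \<psi>(1) order_refl]])
    hence "infinitesimal (zeta_chart x - \<psi>)" by simp
    moreover have "tsum (tcomp_term a ?\<eta> (zeta_chart x - \<psi>)) = tconst (of_real a) * (zeta_chart x - \<psi>)"
      using a by (simp add: tsum_tcomp_diff[OF _ inf] x(2) \<psi>(2) right_diff_distrib)
    ultimately have "zeta_chart x - \<psi> = 0" by (rule homogeneous_solution_0[OF a \<eta> inf])
    thus ?thesis by simp
  qed
  thus "normalizing_transseries a fhat x \<Longrightarrow> zeta_chart x = \<psi>" .
  obtain x where x: "parabolic_transseries x" "zeta_chart x = \<psi>"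
    using zeta_chart_surj[OF infinitesimal_expo0[OF \<psi>(1) order_refl]] by blast
  show "\<exists>!x. normalizing_transseries a fhat x"
  proof (rule ex1I[of _ x])
    show "normalizing_transseries a fhat x"
      using x \<psi>(2) by (simp add: normalizing_transseries_def tcomp)
    show "y = x" if "normalizing_transseries a fhat y" for y
      using zeta_chart_inj[of y x] unique[OF that] x that by (simp add: normalizing_transseries_def)
  qed
qed

context hyperbolic_map
begin

text \<open>Shows that the composition is not the dummy value of \<open>germ_comp\<close>: under
  \<open>f\<close>, every spiraling domain receives the image of another one.\<close>

lemma germ_comp_f: "germ_comp (germ_of g) (germ_of f) = germ_of (g \<circ> f)"
proof -
  have "\<exists>E'. spiraling_domain E' \<and> f ` E' \<subseteq> D" if "spiraling_domain D" for D
    by (rule spiraling_preimage[OF spiraling_sqrt_domain that _ near Re_f_ge]) (use a in auto)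
  thus ?thesis by (simp add: germ_comp.abs_eq)
qed

lemma phi_normalizing:
  assumes \<psi>: "expands (at_Re_top E) phi \<psi>" "expo0_gt 0 (\<psi> - tzeta)"
  shows "normalizing_germ a (germ_of f) (germ_of phi)" "has_expansion (germ_of phi) \<psi>"
proof -
  obtain C where C: "C > 0" "quadratic_domain C \<subseteq> E" using quadratic_subset_sqrt_domain[OF K] by blast
  let ?F = "at_Re_top (quadratic_domain C)"
  have le: "?F \<le> at_Re_top E" by (rule at_Re_top_mono[OF C(2)])
  have tame: "tame ?F" using tame_E le by (auto simp: tame_def)
  have ex: "expands ?F phi \<psi>" by (rule expands_filter_mono[OF \<psi>(1) le])
  have ex_on: "expands_on phi (quadratic_domain C) \<psi>"
    by (rule expands_on_of_expands[OF tame ex]) (use \<psi>(2) in \<open>simp add: tzeta_eq\<close>)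
  show "has_expansion (germ_of phi) \<psi>" unfolding has_expansion_def using C ex_on by blast
  have "phi analytic_on E" using phi_holomorphic open_sqrt_domain analytic_on_open by blast
  hence "phi analytic_on quadratic_domain C" by (rule analytic_on_subset[OF _ C(2)])
  hence dulac: "dulac_germ (germ_of phi)" unfolding dulac_germ_def using C ex_on by blast
  have "((\<lambda>\<zeta>. phi \<zeta> - \<zeta>) \<longlongrightarrow> 0) ?F"
    by (rule expands_tendsto_0[OF tame expands_diff[OF tame ex expands_tzeta] \<psi>(2)])
  hence par: "parabolic_germ (germ_of phi)"
    unfolding parabolic_germ_def germ_affine_def using C by (intro exI[of _ phi] exI[of _ C]) auto
  have "germ_eq (phi \<circ> f) (\<lambda>\<zeta>. of_real a * phi \<zeta>)"
    unfolding germ_eq_def using spiraling_sqrt_domain phi_f by (intro exI[of _ E]) auto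
  hence "germ_comp (germ_of phi) (germ_of f) = germ_scale (of_real a) (germ_of phi)"
    by (simp add: germ_comp_f germ_scale.abs_eq germ.abs_eq_iff)
  thus "normalizing_germ a (germ_of f) (germ_of phi)"
    unfolding normalizing_germ_def using dulac par by blast
qed

end

text \<open>The function \<open>hyperbolic_map.phi f a\<close> does not depend on \<open>K\<close>,
  so the locale may be interpreted on a domain small enough for the representatives of \<phi> at
  hand.\<close>

lemma normalizing_germ_unique:
  assumes hyp: "\<And>K. K \<ge> K0 \<Longrightarrow> hyperbolic_map f a K M b"
    and norm: "normalizing_germ a (germ_of f) \<phi>"
  shows "\<phi> = germ_of (hyperbolic_map.phi f a)"
proof -
  obtain G C y where G: "C > 0" "\<phi> = germ_of G" "G analytic_on quadratic_domain C"
      "expands_on G (quadratic_domain C) y"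
    using norm unfolding normalizing_germ_def dulac_germ_def by blast
  obtain G2 C2 where G2: "C2 > 0" "\<phi> = germ_of G2"
      "((\<lambda>\<zeta>. G2 \<zeta> - (1 * \<zeta> + 0)) \<longlongrightarrow> 0) (at_Re_top (quadratic_domain C2))"
    using norm unfolding normalizing_germ_def parabolic_germ_def germ_affine_def by blast
  obtain K where K: "K \<ge> K0" "K \<ge> 1" "sqrt_domain K \<subseteq> quadratic_domain C" "sqrt_domain K \<subseteq> quadratic_domain C2"
    using sqrt_domain_subset_quadratic2[OF G(1) G2(1)] by blast
  interpret H: hyperbolic_map f a K M b by (rule hyp[OF K(1)])
  let ?E = "sqrt_domain K"
  have hol: "G holomorphic_on ?E"
    by (rule analytic_imp_holomorphic[OF analytic_on_subset[OF G(3) K(3)]])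
  \<comment> \<open>The equation of germs holds on some spiraling domain \<open>D\<close>, which
    meets the connected domain \<open>?E\<close> far out on the real axis. Both sides are
    holomorphic on \<open>?E\<close> because \<open>f\<close> maps it into itself, so the identity
    theorem applies.\<close>
  have eq: "G (f \<zeta>) = of_real a * G \<zeta>" if \<zeta>: "\<zeta> \<in> ?E" for \<zeta>
  proof -
    have "germ_eq (G \<circ> f) (\<lambda>\<zeta>. of_real a * G \<zeta>)"
      using norm unfolding normalizing_germ_def G(2) H.germ_comp_f
      by (simp add: germ_scale.abs_eq germ.abs_eq_iff)
    then obtain D where D: "spiraling_domain D" "\<And>\<zeta>. \<zeta> \<in> D \<Longrightarrow> (G \<circ> f) \<zeta> = of_real a * G \<zeta>"
      unfolding germ_eq_def by blast
    obtain X where X: "\<And>x. x > X \<Longrightarrow> complex_of_real x \<in> D \<inter> ?E"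
      using spiraling_domain_real[OF spiraling_domain_Int[OF D(1) spiraling_sqrt_domain]] by blast
    have ne: "D \<inter> ?E \<noteq> {}" using X[of "X + 1"] by auto
    have "(G \<circ> f) holomorphic_on ?E"
      by (rule holomorphic_on_compose_gen[OF H.hol hol]) (use H.f_in_E in blast)
    moreover have "(\<lambda>\<zeta>. of_real a * G \<zeta>) holomorphic_on ?E" using hol by (intro holomorphic_intros)
    ultimately have "(G \<circ> f) \<zeta> = of_real a * G \<zeta>"
      using analytic_continuation_open[of "D \<inter> ?E" ?E "G \<circ> f" "\<lambda>\<zeta>. of_real a * G \<zeta>" \<zeta>]
        open_Int[OF open_spiraling_domain[OF D(1)] open_sqrt_domain[of K]] open_sqrt_domain[of K]
        ne connected_sqrt_domain[of K] K(2) D(2) \<zeta> by auto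
    thus ?thesis by simp
  qed
  have ex: "expands (at_Re_top ?E) (\<lambda>\<zeta>. G \<zeta> - \<zeta>) (y - tzeta)"
    by (intro expands_diff H.tame_E expands_tzeta
        expands_of_expands_on[OF G(4) at_Re_top_mono[OF K(3)] H.tame_E])
  \<comment> \<open>Parabolicity is known for the representative \<open>G2\<close>, the expansion
    for \<open>G\<close>. Along the real axis the limit passes to \<open>G\<close> and forces
    positive exponents in \<open>y - tzeta\<close>; these in turn make
    \<open>G \<zeta> - \<zeta>\<close> tend to 0 uniformly on \<open>?E\<close>, as
    \<open>eq_phi\<close> needs.\<close>
  have "expo0_gt 0 (y - tzeta)"
  proof (rule expands_tendsto_0_imp[OF tame_real_filter[OF K(2)] real_filter_neq_bot])
    show "expands (real_filter K) (\<lambda>\<zeta>. G \<zeta> - \<zeta>) (y - tzeta)"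
      by (rule expands_filter_mono[OF ex at_Re_top_mono]) auto
    have "germ_eq G G2" using G(2) G2(2) germ.abs_eq_iff[of G G2] by simp
    hence "eventually (\<lambda>\<zeta>. G2 \<zeta> - (1 * \<zeta> + 0) = G \<zeta> - \<zeta>) (real_filter K)"
      using germ_eq_real_filter[of G G2 K] by (auto elim!: eventually_mono)
    moreover have "((\<lambda>\<zeta>. G2 \<zeta> - (1 * \<zeta> + 0)) \<longlongrightarrow> 0) (real_filter K)"
      by (rule tendsto_mono[OF at_Re_top_mono G2(3)]) (use K(4) in blast)
    ultimately show "((\<lambda>\<zeta>. G \<zeta> - \<zeta>) \<longlongrightarrow> 0) (real_filter K)"
      by (rule Lim_transform_eventually[rotated])
  qed
  from expands_tendsto_0[OF H.tame_E ex this]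
  have "eventually (\<lambda>\<zeta>. dist (G \<zeta> - \<zeta>) 0 < 1) (at_Re_top ?E)" by (rule tendstoD) simp
  then obtain X where X: "\<And>\<zeta>. \<zeta> \<in> ?E \<Longrightarrow> Re \<zeta> \<ge> X \<Longrightarrow> norm (G \<zeta> - \<zeta>) \<le> 1"
    unfolding eventually_at_Re_top by fastforce
  have "G \<zeta> = H.phi \<zeta>" if "\<zeta> \<in> ?E" for \<zeta> by (rule H.eq_phi[OF eq X that])
  hence "germ_eq G H.phi" unfolding germ_eq_def using spiraling_sqrt_domain by blast
  thus ?thesis using G(2) by (simp add: germ.abs_eq_iff)
qed

lemma real_normalizing_germ:
  assumes hyp: "\<And>K. K \<ge> K0 \<Longrightarrow> hyperbolic_map f a K M b"
    and real: "real_dulac_germ (germ_of f)" and dulac: "dulac_germ (germ_of (hyperbolic_map.phi f a))"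
  shows "real_dulac_germ (germ_of (hyperbolic_map.phi f a))"
proof -
  obtain F D where F: "germ_of f = germ_of F" "spiraling_domain D" "\<And>\<zeta>. \<zeta> \<in> D \<inter> \<real> \<Longrightarrow> F \<zeta> \<in> \<real>"
    using real unfolding real_dulac_germ_def by blast
  have "germ_eq f F" using F(1) by (simp add: germ.abs_eq_iff)
  then obtain D' where D': "spiraling_domain D'" "\<And>\<zeta>. \<zeta> \<in> D' \<Longrightarrow> f \<zeta> = F \<zeta>"
    unfolding germ_eq_def by blast
  obtain X where X: "\<And>x. x > X \<Longrightarrow> complex_of_real x \<in> D \<inter> D'"
    using spiraling_domain_real[OF spiraling_domain_Int[OF F(2) D'(1)]] by blast
  have f_real: "f w \<in> \<real>" if "w \<in> \<real>" "Re w > X" for w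
    using X[OF that(2)] F(3)[of w] D'(2)[of w] that(1) by (simp add: of_real_Re)
  \<comment> \<open>With \<open>K \<ge> X\<close>, all real points of the domain lie where
    \<open>f\<close> is known to be real.\<close>
  define K where "K = max K0 X"
  interpret H: hyperbolic_map f a K M b by (rule hyp) (simp add: K_def)
  have "H.phi \<zeta> \<in> \<real>" if \<zeta>: "\<zeta> \<in> sqrt_domain K \<inter> \<real>" for \<zeta>
  proof (rule H.phi_real)
    have "Re \<zeta> > X" using sqrt_domain_Re[of \<zeta> K] \<zeta> H.K by (auto simp: K_def)
    thus "f w \<in> \<real>" if "w \<in> \<real>" "Re w \<ge> Re \<zeta>" for w using f_real that by simp
  qed (use \<zeta> in auto)
  thus ?thesis unfolding real_dulac_germ_def using dulac spiraling_sqrt_domain by blast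
qed

theorem theoremC:
  fixes f :: germ and fhat :: transseries and \<alpha> :: real
  assumes "dulac_germ f"
    and "strongly_hyperbolic_germ f"
    and "has_expansion f fhat"
    and "\<alpha> > 1"
    and "infinitesimal (fhat - tconst (of_real \<alpha>) * tzeta)"
  shows "(\<exists>!\<phi>. normalizing_germ \<alpha> f \<phi>) \<and>
    (\<forall>\<phi>. normalizing_germ \<alpha> f \<phi> \<and> real_dulac_germ f \<longrightarrow> real_dulac_germ \<phi>) \<and>
    (\<exists>!\<phi>hat. normalizing_transseries \<alpha> fhat \<phi>hat) \<and>
    (\<forall>\<phi> \<phi>hat. normalizing_germ \<alpha> f \<phi> \<and> normalizing_transseries \<alpha> fhat \<phi>hat \<longrightarrow>
       has_expansion \<phi> (zeta_chart \<phi>hat))"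
proof -
  let ?\<eta> = "fhat - tconst (of_real \<alpha>) * tzeta"
  obtain F C x where F: "C > 0" "f = germ_of F" "F analytic_on quadratic_domain C"
      "expands_on F (quadratic_domain C) x"
    using assms(1) unfolding dulac_germ_def by blast
  obtain F' C' where F': "C' > 0" "f = germ_of F'" "expands_on F' (quadratic_domain C') fhat"
    using assms(3) unfolding has_expansion_def by blast
  \<comment> \<open>The expansion in the Dulac property of \<open>f\<close> and the given
    \<open>fhat\<close> may belong to different representatives; they coincide by comparison along
    the real axis.\<close>
  have "germ_eq F F'" using F(2) F'(2) germ.abs_eq_iff[of F F'] by simp
  hence "x = fhat" by (rule expansion_unique[OF F(1) F'(1) F(4) F'(3)])
  from hyperbolic_map_ex[OF F(1,3) F(4)[unfolded this] assms(4,5)]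
  obtain K0 M b where b: "b > 0" "expo0_gt b ?\<eta>"
    and hyp: "\<And>K. K \<ge> K0 \<Longrightarrow> hyperbolic_map F \<alpha> K M b"
    and \<eta>: "\<And>K. K \<ge> K0 \<Longrightarrow>
      expands (at_Re_top (sqrt_domain K)) (\<lambda>\<zeta>. F \<zeta> - of_real \<alpha> * \<zeta>) ?\<eta>"
    by blast
  interpret H: hyperbolic_map F \<alpha> K0 M b by (rule hyp) simp
  obtain \<psi> where \<psi>: "expands (at_Re_top (sqrt_domain K0)) H.phi \<psi>"
      "expo0_gt 0 (\<psi> - tzeta)" "tsum (tcomp_term \<alpha> ?\<eta> \<psi>) = tconst (of_real \<alpha>) * \<psi>"
    using H.phi_expands[OF \<eta>[OF order_refl] b] unfolding tzeta_eq by blast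
  have \<eta>0: "expo0_gt 0 ?\<eta>" using b by force
  note formal = normalizing_transseries_ex1[OF assms(4) \<eta>0 \<psi>(2,3)]
  note phi = H.phi_normalizing[OF \<psi>(1,2), folded F(2)]
  have unique: "\<phi> = germ_of H.phi" if "normalizing_germ \<alpha> f \<phi>" for \<phi>
    using normalizing_germ_unique[OF hyp that[unfolded F(2)]] by simp
  have real: "real_dulac_germ (germ_of H.phi)" if "real_dulac_germ f"
    using real_normalizing_germ[OF hyp that[unfolded F(2)]] phi(1) by (simp add: normalizing_germ_def)
  show ?thesis
  proof (intro conjI allI impI)
    show "\<exists>!\<phi>. normalizing_germ \<alpha> f \<phi>" using phi(1) unique by blast
    show "\<exists>!\<phi>hat. normalizing_transseries \<alpha> fhat \<phi>hat" by (rule formal(1))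
  next
    fix \<phi> assume "normalizing_germ \<alpha> f \<phi> \<and> real_dulac_germ f"
    thus "real_dulac_germ \<phi>" using unique real by blast
  next
    fix \<phi> \<phi>hat assume "normalizing_germ \<alpha> f \<phi> \<and> normalizing_transseries \<alpha> fhat \<phi>hat"
    hence "\<phi> = germ_of H.phi" "zeta_chart \<phi>hat = \<psi>" using unique formal(2) by blast+
    thus "has_expansion \<phi> (zeta_chart \<phi>hat)" using phi(2) by simp
  qed
qed

end
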